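(* Let $\Omega=\mathbb{R}^n$, $\mu$ the Lebesgue measure and $\Sigma$ the Lebesgue $\sigma$-algebra on $\Omega$. Let $\rho\in L^1(\mu)$ be non-negative with $\int\rho\,d\mu=1$, and let $P(\mathcal{M}):=\int\rho\mathbf{1}_\mathcal{M}\,d\mu$ for $\mathcal{M}\in\Sigma$; let $L^2(P)$ be the real Hilbert space with scalar product $(x,y)=\int xy\rho\,d\mu$. Let $\mathbf{F}:\Omega\to\Omega$ be continuously differentiable with bounded derivative, and let $\varphi:\mathbb{R}\times\Omega\to\Omega$ be its flow ($\varphi_0=\mathrm{id}$, $\varphi_{t+s}=\varphi_t\circ\varphi_s$, $\frac{d}{dt}\varphi_t(\mathbf{x})=\mathbf{F}(\varphi_t(\mathbf{x}))$). Assume $\rho\mathbf{F}\in W^{1,1}(\Omega)$ and $\omega_0:=\frac12\|\rho^{-1}\mathrm{div}(\rho\mathbf{F})\|_{L^\infty(P)}<\infty$. Then: (i) the closure in $L^2(P)$ of the operator $\mathbf{F}\cdot\boldsymbol{\nabla}$ with domain $C^1_c(\Omega)$ generates a strongly continuous group $\{\mathcal{U}(t)\}_{t\in\mathbb{R}}$ on $L^2(P)$; (ii) $\|\mathcal{U}(t)\|\le e^{\omega_0|t|}$ for all $t\in\mathbb{R}$; (iii) $\mathcal{U}(t)x=x\circ\varphi_t$ for all $x\in C^1_c(\Omega)$ and $t\in\mathbb{R}$. If in addition $\mathrm{div}(\rho\mathbf{F})=0$, then: $\mathcal{U}(t)$ is a linear isometry on $L^2(P)$ for all $t\in\mathbb{R}$;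 $P$ is invariant under $\varphi_t$ (i.e. $P=P\circ\varphi_t^{-1}$ on $\Sigma$) for all $t\in\mathbb{R}$; and $\mathcal{U}(t)x=x\circ\varphi_t$ for all $x\in L^2(P)$ and $t\in\mathbb{R}$.
   Context: $\rho^{-1}$ is well-defined $P$-almost everywhere since $\{\rho=0\}$ is a $P$-null set. $W^{1,1}$ denotes the Sobolev space and $\mathrm{div}$ the weak divergence. *)

theory Defs
  imports "HOL-Analysis.Analysis" "HOL-Probability.Probability"
begin

text \<open>Functions on R^n are modelled as functions on real^'n; elements of L^2(P)
  are represented by measurable square-integrable functions, equalities in L^2(P)
  are stated P-almost everywhere.\<close>

definition grad :: "(real^'n \<Rightarrow> real) \<Rightarrow> real^'n \<Rightarrow> real^'n" where
  "grad u x = (\<chi> i. frechet_derivative u (at x) (axis i 1))"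

definition C1c :: "(real^'n \<Rightarrow> real) \<Rightarrow> bool" where
  "C1c u \<longleftrightarrow> (\<forall>x. u differentiable (at x)) \<and> continuous_on UNIV (grad u)
      \<and> bounded {x. u x \<noteq> 0}"

definition weak_partial :: "(real^'n \<Rightarrow> real) \<Rightarrow> 'n \<Rightarrow> (real^'n \<Rightarrow> real) \<Rightarrow> bool" where
  "weak_partial u j h \<longleftrightarrow> (\<forall>\<phi>. C1c \<phi> \<longrightarrow>
      (\<integral>x. u x * grad \<phi> x $ j \<partial>lebesgue) = - (\<integral>x. h x * \<phi> x \<partial>lebesgue))"

definition W11 :: "(real^'n \<Rightarrow> real^'n) \<Rightarrow> bool" where
  "W11 G \<longleftrightarrow> (\<forall>i. integrable lebesgue (\<lambda>x. G x $ i)) \<and>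
      (\<forall>i j. \<exists>h. integrable lebesgue h \<and> weak_partial (\<lambda>x. G x $ i) j h)"

definition weak_div :: "(real^'n \<Rightarrow> real^'n) \<Rightarrow> (real^'n \<Rightarrow> real) \<Rightarrow> bool" where
  "weak_div G d \<longleftrightarrow> integrable lebesgue d \<and> (\<forall>\<phi>. C1c \<phi> \<longrightarrow>
      (\<integral>x. G x \<bullet> grad \<phi> x \<partial>lebesgue) = - (\<integral>x. d x * \<phi> x \<partial>lebesgue))"

definition L2 :: "'a measure \<Rightarrow> ('a \<Rightarrow> real) set" where
  "L2 P = {f. f \<in> borel_measurable P \<and> integrable P (\<lambda>x. (f x)\<^sup>2)}"

definition l2norm :: "'a measure \<Rightarrow> ('a \<Rightarrow> real) \<Rightarrow> real" where
  "l2norm P f = sqrt (\<integral>x. (f x)\<^sup>2 \<partial>P)"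

text \<open>Strongly continuous group of bounded linear operators on L^2(P)
  (operators act on representatives and respect a.e. equality).\<close>
definition sc_group :: "'a measure \<Rightarrow> (real \<Rightarrow> ('a \<Rightarrow> real) \<Rightarrow> ('a \<Rightarrow> real)) \<Rightarrow> bool" where
  "sc_group P U \<longleftrightarrow>
     (\<forall>t. \<forall>f\<in>L2 P. U t f \<in> L2 P) \<and>
     (\<forall>t. \<forall>f\<in>L2 P. \<forall>g\<in>L2 P. (AE x in P. f x = g x) \<longrightarrow> (AE x in P. U t f x = U t g x)) \<and>
     (\<forall>t a b. \<forall>f\<in>L2 P. \<forall>g\<in>L2 P.
        AE x in P. U t (\<lambda>y. a * f y + b * g y) x = a * U t f x + b * U t g x) \<and>
     (\<forall>t. \<exists>C. \<forall>f\<in>L2 P. l2norm P (U t f) \<le> C * l2norm P f) \<and>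
     (\<forall>f\<in>L2 P. AE x in P. U 0 f x = f x) \<and>
     (\<forall>s t. \<forall>f\<in>L2 P. AE x in P. U (s + t) f x = U s (U t f) x) \<and>
     (\<forall>f\<in>L2 P. \<forall>t0. ((\<lambda>t. l2norm P (\<lambda>x. U t f x - U t0 f x)) \<longlongrightarrow> 0) (at t0))"

definition generator_rel :: "'a measure \<Rightarrow> (real \<Rightarrow> ('a \<Rightarrow> real) \<Rightarrow> ('a \<Rightarrow> real))
    \<Rightarrow> ('a \<Rightarrow> real) \<Rightarrow> ('a \<Rightarrow> real) \<Rightarrow> bool" where
  "generator_rel P U f g \<longleftrightarrow> f \<in> L2 P \<and> g \<in> L2 P \<and>
     ((\<lambda>t. l2norm P (\<lambda>x. (U t f x - f x) / t - g x)) \<longlongrightarrow> 0) (at 0)"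

definition closure_rel :: "(real^'n) measure \<Rightarrow> (real^'n \<Rightarrow> real^'n)
    \<Rightarrow> (real^'n \<Rightarrow> real) \<Rightarrow> (real^'n \<Rightarrow> real) \<Rightarrow> bool" where
  "closure_rel P F f g \<longleftrightarrow> f \<in> L2 P \<and> g \<in> L2 P \<and>
     (\<exists>u :: nat \<Rightarrow> real^'n \<Rightarrow> real. (\<forall>k. C1c (u k)) \<and>
        (\<lambda>k. l2norm P (\<lambda>x. u k x - f x)) \<longlonglongrightarrow> 0 \<and>
        (\<lambda>k. l2norm P (\<lambda>x. F x \<bullet> grad (u k) x - g x)) \<longlonglongrightarrow> 0)"

end

theory Submission
  imports Defs
begin

text \<open>The group is \<open>U(t) f = f \<circ> \<phi> t\<close>, so everything rests on bounding the image of \<open>P\<close> under the flow.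
  The flow is \<open>C\<^sup>1\<close> in the initial point, hence \<open>u \<circ> \<phi> t\<close> is again a \<open>C\<^sup>1\<close> function of compact support for each
  such \<open>u\<close>, and \<open>m(t) = \<integral> \<rho> (u \<circ> \<phi> t)\<close> has derivative \<open>- \<integral> d (u \<circ> \<phi> t)\<close>. If \<open>\<bar>d\<bar> \<le> 2 \<omega>0 \<rho>\<close> almost
  everywhere, Gronwall gives \<open>m(t) \<le> exp (2 \<omega>0 \<bar>t\<bar>) m(0)\<close> for \<open>u \<ge> 0\<close>, and density extends this to all
  measurable functions. The hypothesis on \<open>\<omega>0\<close> yields that bound only where \<open>\<rho> > 0\<close>; but \<open>d\<close> vanishes
  almost everywhere on \<open>\<rho> = 0\<close>, since \<open>\<rho>\<close> is non-negative and its minimum along the flow has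
  derivative zero. Finally, the test functions are dense and invariant under the group, hence a core of
  its generator.\<close>

section \<open>Continuously differentiable functions on Euclidean space\<close>

text \<open>Two features of the setting shape the argument. The flow is only once differentiable, so
  the test class has to be \<open>C1c\<close>: composition with \<open>\<phi> t\<close> maps it into
  itself, which lets the weak divergence be applied at every time. And the transport estimate is
  proved for an arbitrary locally integrable weight \<open>r\<close> with divergence
  \<open>q\<close>, because it is used with two weights: with \<open>\<rho>\<close>, and with the
  constant 1, where \<open>q\<close> is the trace of \<open>F'\<close>. The second use bounds the
  image of Lebesgue measure under the flow without a Jacobian formula. It carries the minimum
  argument: for a function that is only measurable,
  \<open>t \<mapsto> \<integral>\<rho> (f \<circ> \<phi> t)\<close> is not visibly differentiable,
  and its derivative at 0 is reached through estimates on \<open>C1c\<close> approximants that are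
  uniform in the approximant. The exponent \<open>\<omega>0\<close> is half of the essential bound
  on the quotient because the transport estimate controls integrals of squares, whose root is the
  norm. In the generator argument, pairings with elements of \<open>L2 P\<close> and Riemann sums
  take the place of integrals with values in that space.\<close>

lemma has_derivative_grad:
  fixes u :: "real^'n \<Rightarrow> real"
  assumes "u differentiable (at x)"
  shows "(u has_derivative (\<lambda>h. grad u x \<bullet> h)) (at x)"
proof -
  let ?D = "frechet_derivative u (at x)"
  have D: "(u has_derivative ?D) (at x)"
    using assms by (simp add: frechet_derivative_works)
  then interpret bounded_linear ?D by (rule has_derivative_bounded_linear)
  have "?D h = grad u x \<bullet> h" for h
  proof -
    have "?D h = ?D (\<Sum>i\<in>UNIV. (h $ i) *\<^sub>R axis i 1)"
      by (simp add: basis_expansion scalar_mult_eq_scaleR[symmetric])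
    also have "\<dots> = (\<Sum>i\<in>UNIV. h $ i * ?D (axis i 1))"
      by (simp add: sum scaleR)
    also have "\<dots> = grad u x \<bullet> h"
      by (simp add: grad_def inner_vec_def mult.commute)
    finally show ?thesis .
  qed
  then have "?D = (\<lambda>h. grad u x \<bullet> h)" by auto
  with D show ?thesis by simp
qed

lemma grad_eqI:
  fixes u :: "real^'n \<Rightarrow> real"
  assumes "(u has_derivative (\<lambda>h. G \<bullet> h)) (at x)"
  shows "grad u x = G"
proof -
  have "frechet_derivative u (at x) = (\<lambda>h. G \<bullet> h)"
    using frechet_derivative_at[OF assms] by simp
  then show ?thesis
    by (simp add: grad_def vec_eq_iff inner_axis)
qed

text \<open>Room for factors without bounded support: polynomials, the components of
  \<open>F\<close>, the squared norm. One \<open>C1c\<close> factor brings a product back to the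
  test class (\<open>C1c_mult\<close>).\<close>

definition C1 :: "(real^'n \<Rightarrow> real) \<Rightarrow> bool" where
  "C1 u \<longleftrightarrow> (\<forall>x. (u has_derivative (\<lambda>h. grad u x \<bullet> h)) (at x)) \<and> continuous_on UNIV (grad u)"

lemma C1c_iff: "C1c u \<longleftrightarrow> C1 u \<and> bounded {x. u x \<noteq> 0}"
  unfolding C1c_def C1_def
  using has_derivative_grad differentiable_def by blast

lemma C1_I:
  assumes "\<And>x. (u has_derivative (\<lambda>h. G x \<bullet> h)) (at x)" "continuous_on UNIV G"
  shows "C1 u" "grad u = G"
proof -
  show "grad u = G" using grad_eqI[OF assms(1)] by auto
  then show "C1 u" using assms by (simp add: C1_def)
qed

lemma C1_has_derivative: "C1 u \<Longrightarrow> (u has_derivative (\<lambda>h. grad u x \<bullet> h)) (at x)"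
  by (simp add: C1_def)

lemma C1_continuous_grad: "C1 u \<Longrightarrow> continuous_on S (grad u)"
  using continuous_on_subset by (auto simp: C1_def)

lemma C1_continuous: "C1 u \<Longrightarrow> continuous_on S u"
  by (meson C1_has_derivative continuous_at_imp_continuous_on has_derivative_continuous)

lemma C1_add:
  assumes "C1 u" "C1 v"
  shows "C1 (\<lambda>x. u x + v x)" "grad (\<lambda>x. u x + v x) = (\<lambda>x. grad u x + grad v x)"
proof -
  have 1: "((\<lambda>x. u x + v x) has_derivative (\<lambda>h. (grad u x + grad v x) \<bullet> h)) (at x)" for x
    using has_derivative_add[OF C1_has_derivative[OF assms(1)] C1_has_derivative[OF assms(2)]]
    by (simp add: inner_add_left)
  have 2: "continuous_on UNIV (\<lambda>x. grad u x + grad v x)"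
    using assms by (intro continuous_intros C1_continuous_grad)
  show "C1 (\<lambda>x. u x + v x)" "grad (\<lambda>x. u x + v x) = (\<lambda>x. grad u x + grad v x)"
    using C1_I[OF 1 2] by auto
qed

lemma C1_mult:
  assumes "C1 u" "C1 v"
  shows "C1 (\<lambda>x. u x * v x)"
    "grad (\<lambda>x. u x * v x) = (\<lambda>x. u x *\<^sub>R grad v x + v x *\<^sub>R grad u x)"
proof -
  have 1: "((\<lambda>x. u x * v x) has_derivative (\<lambda>h. (u x *\<^sub>R grad v x + v x *\<^sub>R grad u x) \<bullet> h)) (at x)" for x
    using has_derivative_mult[OF C1_has_derivative[OF assms(1)] C1_has_derivative[OF assms(2)]]
    by (simp add: inner_add_left mult.commute)
  have 2: "continuous_on UNIV (\<lambda>x. u x *\<^sub>R grad v x + v x *\<^sub>R grad u x)"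
    using assms by (intro continuous_intros C1_continuous_grad C1_continuous)
  show "C1 (\<lambda>x. u x * v x)"
    "grad (\<lambda>x. u x * v x) = (\<lambda>x. u x *\<^sub>R grad v x + v x *\<^sub>R grad u x)"
    using C1_I[OF 1 2] by auto
qed

lemma C1_const: "C1 (\<lambda>x. c)"
  by (rule C1_I(1)[where G="\<lambda>x. 0"]) (auto intro!: continuous_intros)

lemma C1_linear:
  fixes f :: "real^'n \<Rightarrow> real"
  assumes "bounded_linear f"
  shows "C1 f"
proof (rule C1_I(1)[where G="\<lambda>x. grad f 0"])
  have f: "(f has_derivative f) (at x)" for x
    by (rule bounded_linear.has_derivative[OF assms has_derivative_ident])
  have "(f has_derivative (\<lambda>h. grad f 0 \<bullet> h)) (at 0)"
    using f by (intro has_derivative_grad) (auto simp: differentiable_def)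
  then have "f = (\<lambda>h. grad f 0 \<bullet> h)" using f has_derivative_unique by blast
  then show "(f has_derivative (\<lambda>h. grad f 0 \<bullet> h)) (at x)" for x using f by metis
qed (auto intro!: continuous_intros)

text \<open>Lets Stone-Weierstrass polynomials become test functions after multiplication by a
  cut-off.\<close>

lemma C1_real_polynomial_function: "real_polynomial_function p \<Longrightarrow> C1 p"
  by (induction rule: real_polynomial_function.induct)
     (auto intro: C1_linear C1_const C1_add C1_mult)

lemma C1_compose_real:
  assumes u: "C1 u" and g: "\<And>s. (g has_real_derivative g' s) (at s)"
    and g': "continuous_on UNIV g'"
  shows "C1 (\<lambda>x. g (u x))"
proof (rule C1_I(1)[where G="\<lambda>x. g' (u x) *\<^sub>R grad u x"])
  show "((\<lambda>x. g (u x)) has_derivative (\<lambda>h. (g' (u x) *\<^sub>R grad u x) \<bullet> h)) (at x)" for x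
    using has_derivative_compose[OF C1_has_derivative[OF u] g[of "u x", unfolded has_field_derivative_def]]
    by (simp add: mult.commute)
  show "continuous_on UNIV (\<lambda>x. g' (u x) *\<^sub>R grad u x)"
    using u by (intro continuous_intros C1_continuous_grad continuous_on_compose2[OF g'] C1_continuous) auto
qed

lemma C1_norm_square: "C1 (\<lambda>x::real^'n. x \<bullet> x)"
  by (rule C1_I(1)[where G="\<lambda>x. 2 *\<^sub>R x"])
     (auto intro!: derivative_eq_intros continuous_intros simp: inner_commute)

text \<open>Squaring removes the kink of the positive part: at 0 the difference quotient is at most
  \<open>\<bar>h\<bar>\<close>. One continuous derivative is all that a cut-off in the class
  \<open>C1c\<close> must have.\<close>

lemma has_real_derivative_pos_part_square:
  "((\<lambda>s::real. (max 0 s)\<^sup>2) has_real_derivative 2 * max 0 s) (at s)"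
proof (cases "s = 0")
  case True
  have "((\<lambda>h. ((max 0 h)\<^sup>2 - (max 0 0)\<^sup>2) / (h - 0)) \<longlongrightarrow> (0::real)) (at 0)"
  proof (rule Lim_null_comparison)
    show "eventually (\<lambda>h::real. norm (((max 0 h)\<^sup>2 - (max 0 0)\<^sup>2) / (h - 0)) \<le> \<bar>h\<bar>) (at 0)"
      by (rule always_eventually) (auto simp: max_def power2_eq_square)
    show "((\<lambda>h::real. \<bar>h\<bar>) \<longlongrightarrow> 0) (at 0)" by (auto intro!: tendsto_eq_intros)
  qed
  then show ?thesis using True by (simp add: has_field_derivative_iff)
next
  case False
  then consider "s > 0" | "s < 0" by linarith
  then show ?thesis
  proof cases
    case 1
    have "((\<lambda>s::real. s\<^sup>2) has_real_derivative 2 * max 0 s) (at s)"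
      using 1 by (auto intro!: derivative_eq_intros)
    moreover have "eventually (\<lambda>s::real. s > 0) (nhds s)" using 1
      using eventually_nhds_in_open[of "{0<..}" s] by simp
    ultimately show ?thesis
      by (subst DERIV_cong_ev[OF refl _ refl]) (auto elim: eventually_mono)
  next
    case 2
    have "((\<lambda>s::real. 0) has_real_derivative 2 * max 0 s) (at s)" using 2 by auto
    moreover have "eventually (\<lambda>s::real. s < 0) (nhds s)" using 2
      using eventually_nhds_in_open[of "{..<0}" s] by simp
    ultimately show ?thesis
      by (subst DERIV_cong_ev[OF refl _ refl]) (auto elim: eventually_mono)
  qed
qed

lemma C1_pos_part_square: "C1 u \<Longrightarrow> C1 (\<lambda>x. (max 0 (u x))\<^sup>2)"
  by (rule C1_compose_real[OF _ has_real_derivative_pos_part_square]) (auto intro!: continuous_intros)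

section \<open>Test functions with bounded support\<close>

lemma C1c_cutoff:
  fixes R :: real
  assumes "R \<ge> 0"
  obtains \<eta> :: "real^'n \<Rightarrow> real" where "C1c \<eta>" "\<And>x. 0 \<le> \<eta> x" "\<And>x. \<eta> x \<le> 1"
    "\<And>x. norm x \<le> R \<Longrightarrow> \<eta> x = 1" "\<And>x. norm x > R + 1 \<Longrightarrow> \<eta> x = 0"
proof
  \<comment> \<open>The inner squared positive part is 0 on the ball of radius \<open>R\<close> and
    at least 1 beyond radius \<open>R + 1\<close>, because
    \<open>(R + 1)\<^sup>2 \<ge> R\<^sup>2 + 1\<close>. Hence 1 minus it is 1 on the ball and
    nonpositive far out, and the outer positive part turns the latter into 0.\<close>
  define \<eta> where "\<eta> = (\<lambda>x::real^'n. (max 0 (1 + (-1) * (max 0 (x \<bullet> x + (- R\<^sup>2)))\<^sup>2))\<^sup>2)"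
  show z: "\<eta> x = 0" if "norm x > R + 1" for x
  proof -
    have "x \<bullet> x \<ge> (R + 1)\<^sup>2" using that assms power_mono[of "R+1" "norm x" 2]
      by (simp add: power2_norm_eq_inner)
    moreover have "(R + 1)\<^sup>2 \<ge> R\<^sup>2 + 1" using assms by (simp add: power2_eq_square algebra_simps)
    ultimately have "x \<bullet> x - R\<^sup>2 \<ge> 1" by linarith
    then have "(max 0 (x \<bullet> x + (- R\<^sup>2)))\<^sup>2 \<ge> 1" by (simp add: max_def)
    then show ?thesis by (simp add: \<eta>_def max_def)
  qed
  have "{x. \<eta> x \<noteq> 0} \<subseteq> cball 0 (R + 1)" using z by (force simp: not_less[symmetric])
  moreover have "C1 \<eta>" unfolding \<eta>_def
    by (intro C1_pos_part_square C1_add C1_mult C1_const C1_norm_square)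
  ultimately show "C1c \<eta>"
    unfolding C1c_iff using bounded_subset[OF bounded_cball] by blast
  show "0 \<le> \<eta> x" for x by (simp add: \<eta>_def)
  show "\<eta> x \<le> 1" for x by (auto simp: \<eta>_def max_def intro!: power_le_one)
  show "\<eta> x = 1" if "norm x \<le> R" for x
  proof -
    have "x \<bullet> x \<le> R\<^sup>2" using power_mono[OF that, of 2] by (simp add: power2_norm_eq_inner)
    then show ?thesis by (simp add: \<eta>_def)
  qed
qed

lemma C1c_add:
  assumes "C1c u" "C1c v" shows "C1c (\<lambda>x. u x + v x)"
  unfolding C1c_iff
proof
  show "C1 (\<lambda>x. u x + v x)" using assms C1_add by (auto simp: C1c_iff)
  show "bounded {x. u x + v x \<noteq> 0}"
    by (rule bounded_subset[of "{x. u x \<noteq> 0} \<union> {x. v x \<noteq> 0}"]) (use assms in \<open>auto simp: C1c_iff\<close>)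
qed

lemma C1c_mult:
  assumes "C1c u" "C1 v" shows "C1c (\<lambda>x. u x * v x)"
  unfolding C1c_iff
proof
  show "C1 (\<lambda>x. u x * v x)" using assms C1_mult by (auto simp: C1c_iff)
  show "bounded {x. u x * v x \<noteq> 0}"
    by (rule bounded_subset[of "{x. u x \<noteq> 0}"]) (use assms in \<open>auto simp: C1c_iff\<close>)
qed

lemma grad_scale:
  fixes u :: "real^'n \<Rightarrow> real"
  assumes "C1 u"
  shows "grad (\<lambda>x. c * u x) = (\<lambda>x. c *\<^sub>R grad u x)"
proof -
  have "grad (\<lambda>x::real^'n. c) x = 0" for x by (rule grad_eqI) simp
  then show ?thesis using C1_mult(2)[OF C1_const[of c] assms] by simp
qed

lemma C1c_scale: "C1c u \<Longrightarrow> C1c (\<lambda>x. c * u x)"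
  using C1c_mult[OF _ C1_const[of c], of u] by (simp add: mult.commute)

lemma C1c_sum:
  assumes "finite I" "\<And>i. i \<in> I \<Longrightarrow> C1c (u i)"
  shows "C1c (\<lambda>x. \<Sum>i\<in>I. u i x) \<and> grad (\<lambda>x. \<Sum>i\<in>I. u i x) = (\<lambda>x. \<Sum>i\<in>I. grad (u i) x)"
  using assms
proof (induction I rule: finite_induct)
  case empty
  then show ?case
    using C1_const[of 0] grad_eqI[of "\<lambda>x. 0" 0] by (auto simp: C1c_iff fun_eq_iff)
next
  case (insert i I)
  then have "C1c (u i)" "C1c (\<lambda>x. \<Sum>i\<in>I. u i x)" by auto
  then show ?case
    using insert C1c_add[of "u i"] C1_add(2)[of "u i" "\<lambda>x. \<Sum>i\<in>I. u i x"]
    by (simp add: C1c_iff[of "u i"] C1c_iff[of "\<lambda>x. \<Sum>i\<in>I. u i x"])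
qed

text \<open>Outside a closed ball \<open>u\<close> is locally zero, since the complement is open;
  hence its gradient vanishes there too. A radius is handier than the topological support when
  supports are moved by the flow.\<close>

lemma C1c_vanishing:
  assumes "C1c u"
  obtains R where "R \<ge> 0" "\<And>x. norm x > R \<Longrightarrow> u x = 0" "\<And>x. norm x > R \<Longrightarrow> grad u x = 0"
proof -
  obtain R where R: "\<And>x. u x \<noteq> 0 \<Longrightarrow> norm x \<le> R"
    using assms unfolding C1c_iff bounded_iff by auto
  have z: "u x = 0" if "norm x > max R 0" for x using R[of x] that by linarith
  have "grad u x = 0" if "norm x > max R 0" for x
  proof (rule grad_eqI)
    have o: "open {x::real^'a. norm x > max R 0}"
      by (intro open_Collect_less continuous_intros)
    show "(u has_derivative (\<lambda>h. 0 \<bullet> h)) (at x)"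
      by (rule has_derivative_transform_within_open[OF _ o, of "\<lambda>x. 0"]) (use that z in auto)
  qed
  with z that show thesis by (metis max.cobounded2)
qed

lemma vanishing_continuous_bounded:
  fixes w :: "'a::euclidean_space \<Rightarrow> 'b::real_normed_vector"
  assumes "continuous_on UNIV w" "\<And>x. norm x > R \<Longrightarrow> w x = 0"
  obtains B where "B \<ge> 0" "\<And>x. norm (w x) \<le> B"
proof -
  have "bounded (w ` cball 0 R)"
    by (intro compact_imp_bounded compact_continuous_image continuous_on_subset[OF assms(1)]) auto
  then obtain B where B: "\<And>x. norm x \<le> R \<Longrightarrow> norm (w x) \<le> B"
    by (force simp: bounded_iff)
  have "norm (w x) \<le> max B 0" for x
    using B[of x] assms(2)[of x] by (cases "norm x \<le> R") auto
  then show thesis using that by (metis max.cobounded2)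
qed

lemma C1c_bounded:
  assumes "C1c u"
  obtains B where "B \<ge> 0" "\<And>x. \<bar>u x\<bar> \<le> B"
proof -
  obtain R where "\<And>x. norm x > R \<Longrightarrow> u x = 0" using C1c_vanishing[OF assms] by blast
  moreover have "continuous_on UNIV u" using assms by (simp add: C1c_iff C1_continuous)
  ultimately show thesis using vanishing_continuous_bounded[of u R] that by (metis real_norm_def)
qed

section \<open>Approximation of measurable functions by test functions\<close>

lemma continuous_borel_measurable_lebesgue:
  fixes f :: "'a::euclidean_space \<Rightarrow> 'b::euclidean_space"
  shows "continuous_on UNIV f \<Longrightarrow> f \<in> borel_measurable lebesgue"
  by (simp add: borel_measurable_continuous_onI measurable_completion)

lemma C1c_measurable: "C1c u \<Longrightarrow> u \<in> borel_measurable lebesgue"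
  by (simp add: C1c_iff C1_continuous continuous_borel_measurable_lebesgue)

text \<open>Lebesgue measurable functions are almost everywhere limits of continuous functions, which
  Stone-Weierstrass replaces by polynomials on growing balls.\<close>

lemma bounded_measurable_approx_C1c:
  fixes f :: "real^'n \<Rightarrow> real"
  assumes f: "f \<in> borel_measurable lebesgue" and B: "\<And>x. \<bar>f x\<bar> \<le> B"
  obtains u where "\<And>k::nat. C1c (u k)" "\<And>k x. \<bar>u k x\<bar> \<le> B + 1"
    "AE x in lebesgue. (\<lambda>k. u k x) \<longlonglongrightarrow> f x"
proof -
  have B0: "B \<ge> 0" using B[of 0] by linarith
  have "f measurable_on UNIV"
    using f by (simp add: lebesgue_measurable_imp_measurable_on)
  then obtain N g where N: "negligible N" and g: "\<And>n::nat. continuous_on UNIV (g n)"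
    and lim: "\<And>x. x \<notin> N \<Longrightarrow> (\<lambda>n. g n x) \<longlonglongrightarrow> f x"
    unfolding measurable_on_def by auto
  \<comment> \<open>Clipping makes the approximants uniformly bounded; the limit is unaffected
    because \<open>f\<close> already takes its values in the clipping interval.\<close>
  define c where "c k x = max (-B) (min B (g k x))" for k x
  have cc: "continuous_on (cball 0 (real k + 1)) (c k)" for k
    unfolding c_def by (intro continuous_intros continuous_on_subset[OF g]) auto
  have cB: "\<bar>c k x\<bar> \<le> B" for k x using B0 by (auto simp: c_def)
  have clim: "(\<lambda>k. c k x) \<longlonglongrightarrow> f x" if "x \<notin> N" for x
  proof -
    have "(\<lambda>k. c k x) \<longlonglongrightarrow> max (-B) (min B (f x))"
      unfolding c_def by (intro tendsto_intros lim that)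
    moreover have "max (-B) (min B (f x)) = f x" using B[of x] by auto
    ultimately show ?thesis by simp
  qed
  \<comment> \<open>The radius \<open>real k + 1\<close> is where the cut-off
    \<open>\<eta> k\<close> chosen below becomes 0, so the polynomial is controlled wherever the
    product may be nonzero. An error of at most 1 there gives the bound
    \<open>B + 1\<close>.\<close>
  have "\<exists>p. real_polynomial_function p \<and> (\<forall>x\<in>cball 0 (real k + 1). \<bar>c k x - p x\<bar> < 1 / (real k + 1))" for k
    by (rule Stone_Weierstrass_real_polynomial_function[OF compact_cball cc[of k], of "1 / (real k + 1)"]) auto
  then obtain p where p: "\<And>k. real_polynomial_function (p k)"
    "\<And>k x. norm x \<le> real k + 1 \<Longrightarrow> \<bar>c k x - p k x\<bar> < 1 / (real k + 1)"
    by (metis mem_cball_0)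
  have "\<exists>\<eta>::real^'n \<Rightarrow> real. C1c \<eta> \<and> (\<forall>x. 0 \<le> \<eta> x) \<and> (\<forall>x. \<eta> x \<le> 1) \<and>
    (\<forall>x. norm x \<le> real k \<longrightarrow> \<eta> x = 1) \<and> (\<forall>x. norm x > real k + 1 \<longrightarrow> \<eta> x = 0)" for k
    by (rule C1c_cutoff[of "real k"]) auto
  then obtain \<eta> :: "nat \<Rightarrow> real^'n \<Rightarrow> real" where \<eta>: "\<And>k. C1c (\<eta> k)" "\<And>k x. 0 \<le> \<eta> k x"
    "\<And>k x. \<eta> k x \<le> 1" "\<And>k x. norm x \<le> real k \<Longrightarrow> \<eta> k x = 1"
    "\<And>k x. norm x > real k + 1 \<Longrightarrow> \<eta> k x = 0"
    by metis
  show thesis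
  proof
    show "C1c (\<lambda>x. \<eta> k x * p k x)" for k
      by (intro C1c_mult \<eta> C1_real_polynomial_function p)
    show "\<bar>\<eta> k x * p k x\<bar> \<le> B + 1" for k x
    proof (cases "norm x \<le> real k + 1")
      case True
      have "1 / (real k + 1) \<le> 1" by simp
      then have "\<bar>p k x\<bar> \<le> B + 1" using p(2)[OF True] cB[of k x] by linarith
      moreover have "\<bar>\<eta> k x * p k x\<bar> \<le> 1 * \<bar>p k x\<bar>"
        unfolding abs_mult using \<eta> by (intro mult_right_mono) (auto simp: abs_le_iff intro: order_trans[of _ 0])
      ultimately show ?thesis by linarith
    next
      case False
      then show ?thesis using \<eta>(5)[of k x] B0 by simp
    qed
    have "(\<lambda>k. \<eta> k x * p k x) \<longlonglongrightarrow> f x" if "x \<notin> N" for x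
    proof -
      obtain n where n: "norm x \<le> real n" using real_arch_simple by blast
      have "(\<lambda>k. \<eta> k x * p k x - c k x) \<longlonglongrightarrow> 0"
      proof (rule Lim_null_comparison)
        show "eventually (\<lambda>k. norm (\<eta> k x * p k x - c k x) \<le> 1 / real (Suc k)) sequentially"
        proof (rule eventually_mono[OF eventually_ge_at_top[of n]])
          fix k assume "n \<le> k"
          then have "norm x \<le> real k" using n by linarith
          then show "norm (\<eta> k x * p k x - c k x) \<le> 1 / real (Suc k)"
            using \<eta>(4)[of x k] p(2)[of x k] by (simp add: abs_minus_commute add.commute)
        qed
        show "(\<lambda>k. 1 / real (Suc k)) \<longlonglongrightarrow> 0" by (rule LIMSEQ_Suc[OF lim_1_over_n])
      qed
      from tendsto_add[OF this clim[OF that]] show ?thesis by simp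
    qed
    then have "{x. \<not> (\<lambda>k. \<eta> k x * p k x) \<longlonglongrightarrow> f x} \<subseteq> N" by blast
    moreover have "N \<in> null_sets lebesgue" using N negligible_iff_null_sets by blast
    ultimately show "AE x in lebesgue. (\<lambda>k. \<eta> k x * p k x) \<longlonglongrightarrow> f x"
      by (intro AE_I') auto
  qed
qed

section \<open>Differentiable dependence of the flow on the initial point\<close>

text \<open>The norm need not be differentiable at zeros of \<open>v\<close>, so the square is
  estimated. From \<open>2 * b * norm (v s) \<le> (norm (v s))\<^sup>2 + b\<^sup>2\<close> the
  derivative of the square is at most \<open>2 * a + 1\<close> times the square plus
  \<open>b\<^sup>2\<close>, which explains both the exponent and the term
  \<open>b\<^sup>2 * t\<close>.\<close>

lemma gronwall_square_nonneg:
  fixes v :: "real \<Rightarrow> 'a::real_inner"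
  assumes v: "\<And>s. (v has_vector_derivative v' s) (at s)"
    and bound: "\<And>s. 0 \<le> s \<Longrightarrow> s \<le> t \<Longrightarrow> norm (v' s) \<le> a * norm (v s) + b"
    and t: "t \<ge> 0" and a: "a \<ge> 0"
  shows "(norm (v t))\<^sup>2 \<le> exp ((2 * a + 1) * t) * ((norm (v 0))\<^sup>2 + b\<^sup>2 * t)"
proof -
  define c where "c = 2 * a + 1"
  define k where "k s = exp (- (c * s)) * (v s \<bullet> v s) - b\<^sup>2 * s" for s
  have n: "((\<lambda>s. v s \<bullet> v s) has_real_derivative 2 * (v s \<bullet> v' s)) (at s)" for s
    using has_derivative_inner[OF v[of s, unfolded has_vector_derivative_def] v[of s, unfolded has_vector_derivative_def]]
    unfolding has_field_derivative_def
    by (rule has_derivative_eq_rhs) (auto simp: fun_eq_iff algebra_simps inner_commute)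
  have kd: "(k has_real_derivative
      (exp (- (c * s)) * (2 * (v s \<bullet> v' s) - c * (v s \<bullet> v s)) - b\<^sup>2)) (at s)" for s
    unfolding k_def by (rule derivative_eq_intros refl n)+ (simp add: algebra_simps)
  have "k t \<le> k 0"
  proof (rule DERIV_nonpos_imp_nonincreasing[OF t])
    fix s assume s: "0 \<le> s" "s \<le> t"
    have "2 * (v s \<bullet> v' s) \<le> 2 * (norm (v s) * (a * norm (v s) + b))"
      using norm_cauchy_schwarz[of "v s" "v' s"] mult_left_mono[OF bound[OF s] norm_ge_zero[of "v s"]]
      by linarith
    also have "\<dots> \<le> c * (norm (v s))\<^sup>2 + b\<^sup>2"
      using sum_squares_bound[of "norm (v s)" b] by (simp add: c_def power2_eq_square algebra_simps)
    finally have "2 * (v s \<bullet> v' s) - c * (v s \<bullet> v s) \<le> b\<^sup>2"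
      by (simp add: power2_norm_eq_inner)
    then have "exp (- (c * s)) * (2 * (v s \<bullet> v' s) - c * (v s \<bullet> v s)) \<le> exp (- (c * s)) * b\<^sup>2"
      by (intro mult_left_mono) auto
    also have "\<dots> \<le> 1 * b\<^sup>2"
      using s a by (intro mult_right_mono) (auto simp: c_def)
    finally show "\<exists>y. (k has_real_derivative y) (at s) \<and> y \<le> 0"
      using kd[of s] by (intro exI[of _ "exp (- (c * s)) * (2 * (v s \<bullet> v' s) - c * (v s \<bullet> v s)) - b\<^sup>2"]) auto
  qed
  then have "exp (- (c * t)) * (norm (v t))\<^sup>2 \<le> (norm (v 0))\<^sup>2 + b\<^sup>2 * t"
    by (simp add: k_def power2_norm_eq_inner)
  then have "exp (c * t) * (exp (- (c * t)) * (norm (v t))\<^sup>2) \<le> exp (c * t) * ((norm (v 0))\<^sup>2 + b\<^sup>2 * t)"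
    by (intro mult_left_mono) auto
  moreover have "exp (c * t) * (exp (- (c * t)) * (norm (v t))\<^sup>2) = (norm (v t))\<^sup>2"
    by (simp add: exp_minus)
  ultimately show ?thesis by (simp only: c_def)
qed

lemma gronwall_square:
  fixes v :: "real \<Rightarrow> 'a::real_inner"
  assumes v: "\<And>s. (v has_vector_derivative v' s) (at s)"
    and bound: "\<And>s. \<bar>s\<bar> \<le> \<bar>t\<bar> \<Longrightarrow> norm (v' s) \<le> a * norm (v s) + b"
    and a: "a \<ge> 0"
  shows "(norm (v t))\<^sup>2 \<le> exp ((2 * a + 1) * \<bar>t\<bar>) * ((norm (v 0))\<^sup>2 + b\<^sup>2 * \<bar>t\<bar>)"
proof (cases "t \<ge> 0")
  case True
  then show ?thesis using gronwall_square_nonneg[OF v _ True a, of b] bound by simp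
next
  case False
  have "((\<lambda>s. v (- s)) has_vector_derivative - v' (- s)) (at s)" for s
  proof -
    have "(uminus has_vector_derivative (-1::real)) (at s)"
      by (rule has_real_derivative_iff_has_vector_derivative[THEN iffD1])
        (auto intro!: derivative_eq_intros)
    then show ?thesis
      using vector_diff_chain_at[of uminus "-1" s v "v' (- s)"] v[of "-s"] by (simp add: o_def)
  qed
  then show ?thesis
    using gronwall_square_nonneg[of "\<lambda>s. v (- s)" "\<lambda>s. - v' (- s)" "-t" a b] bound a False by simp
qed

text \<open>The hypothesis is a Cauchy criterion for difference quotients, uniform over nearby base
  points, and it asks for no candidate derivative. For the flow this avoids solving the linearised
  equation along the orbit. Limits of the quotients define \<open>T\<close>; moving the base point
  gives additivity and continuity, changing the step gives homogeneity, and finite dimension gives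
  boundedness.\<close>

lemma strict_quotient_imp_C1:
  fixes f :: "'a::euclidean_space \<Rightarrow> 'b::banach"
  assumes strict: "\<And>x0 e. e > 0 \<Longrightarrow> \<exists>\<delta>>0. \<forall>x\<in>ball x0 \<delta>. \<forall>y\<in>ball x0 \<delta>. \<forall>v h k.
      h \<noteq> 0 \<and> k \<noteq> 0 \<and> norm (h *\<^sub>R v) < \<delta> \<and> norm (k *\<^sub>R v) < \<delta> \<longrightarrow>
      norm ((f (x + h *\<^sub>R v) - f x) /\<^sub>R h - (f (y + k *\<^sub>R v) - f y) /\<^sub>R k) \<le> e * norm v"
  obtains T where "\<And>x. (f has_derivative T x) (at x)" "\<And>v. continuous_on UNIV (\<lambda>x. T x v)"
proof -
  define q where "q x h v = (f (x + h *\<^sub>R v) - f x) /\<^sub>R h" for x v and h :: real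
  have small: "eventually (\<lambda>n. norm ((1 / real (Suc n)) *\<^sub>R v) < \<delta>) sequentially" if "\<delta> > 0" for v :: 'a and \<delta>
  proof -
    have "(\<lambda>n. norm ((1 / real (Suc n)) *\<^sub>R v)) \<longlonglongrightarrow> norm (0 *\<^sub>R v)"
      by (intro tendsto_intros LIMSEQ_Suc[OF lim_1_over_n])
    then show ?thesis using that by (intro order_tendstoD) auto
  qed
  have "convergent (\<lambda>n. q x (1 / real (Suc n)) v)" for x v
  proof (rule Cauchy_convergent, rule CauchyI)
    fix e :: real assume e: "e > 0"
    have e': "e / (norm v + 1) > 0" using e by (simp add: add_nonneg_pos)
    obtain \<delta> where d: "\<delta> > 0" and D: "\<And>h k. h \<noteq> 0 \<Longrightarrow> k \<noteq> 0 \<Longrightarrow> norm (h *\<^sub>R v) < \<delta> \<Longrightarrow> norm (k *\<^sub>R v) < \<delta> \<Longrightarrow>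
      norm (q x h v - q x k v) \<le> e / (norm v + 1) * norm v"
      using strict[OF e', of x] unfolding q_def by (metis centre_in_ball)
    have "e / (norm v + 1) * norm v < e" using e by (simp add: divide_simps add_nonneg_pos)
    moreover obtain M where M: "\<And>n. n \<ge> M \<Longrightarrow> norm ((1 / real (Suc n)) *\<^sub>R v) < \<delta>"
      using small[OF d, of v] unfolding eventually_sequentially by blast
    ultimately show "\<exists>M. \<forall>m\<ge>M. \<forall>n\<ge>M. norm (q x (1 / real (Suc m)) v - q x (1 / real (Suc n)) v) < e"
      using D[of "1 / real (Suc _)" "1 / real (Suc _)"] by (intro exI[of _ M]) (smt (verit) of_nat_Suc of_nat_0_less_iff zero_less_Suc zero_less_divide_iff)
  qed
  then obtain T where T: "\<And>x v. (\<lambda>n. q x (1 / real (Suc n)) v) \<longlonglongrightarrow> T x v"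
    unfolding convergent_def by metis
  \<comment> \<open>Letting the second step tend to 0 along \<open>1 / real (Suc n)\<close> in the
    Cauchy criterion. The base points of the quotient and of the limit stay independent of each
    other, which all later steps exploit.\<close>
  have est: "\<exists>\<delta>>0. \<forall>x\<in>ball x0 \<delta>. \<forall>y\<in>ball x0 \<delta>. \<forall>v h.
      h \<noteq> 0 \<and> norm (h *\<^sub>R v) < \<delta> \<longrightarrow> norm (q x h v - T y v) \<le> e * norm v" if e: "e > 0" for x0 e
  proof -
    obtain \<delta> where d: "\<delta> > 0" and D: "\<And>x y v h k. x \<in> ball x0 \<delta> \<Longrightarrow> y \<in> ball x0 \<delta> \<Longrightarrow>
      h \<noteq> 0 \<Longrightarrow> k \<noteq> 0 \<Longrightarrow> norm (h *\<^sub>R v) < \<delta> \<Longrightarrow> norm (k *\<^sub>R v) < \<delta> \<Longrightarrow>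
      norm (q x h v - q y k v) \<le> e * norm v"
      using strict[OF e, of x0] unfolding q_def by metis
    have "norm (q x h v - T y v) \<le> e * norm v"
      if "x \<in> ball x0 \<delta>" "y \<in> ball x0 \<delta>" "h \<noteq> 0" "norm (h *\<^sub>R v) < \<delta>" for x y h v
    proof (rule tendsto_upperbound)
      show "(\<lambda>n. norm (q x h v - q y (1 / real (Suc n)) v)) \<longlonglongrightarrow> norm (q x h v - T y v)"
        by (intro tendsto_intros T)
      show "eventually (\<lambda>n. norm (q x h v - q y (1 / real (Suc n)) v) \<le> e * norm v) sequentially"
        using small[OF d, of v] by (rule eventually_mono) (use that D in auto)
    qed auto
    with d show ?thesis by blast
  qed
  have zeroI: "a = 0" if "\<And>e. e > 0 \<Longrightarrow> norm a \<le> e * c" for a :: 'b and c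
  proof -
    have "norm a \<le> 0"
    proof (rule field_le_epsilon)
      fix e :: real assume e: "e > 0"
      have "norm a \<le> e / (\<bar>c\<bar> + 1) * c" using e by (intro that) auto
      also have "\<dots> \<le> e / (\<bar>c\<bar> + 1) * (\<bar>c\<bar> + 1)" using e by (intro mult_left_mono) auto
      finally show "norm a \<le> 0 + e" by simp
    qed
    then show ?thesis by simp
  qed
  have add: "T x (v + w) = T x v + T x w" for x v w
  proof -
    have "T x (v + w) - T x v - T x w = 0"
    proof (rule zeroI[where c="norm (v + w) + norm v + norm w"])
      fix e :: real assume "e > 0"
      then obtain \<delta> where d: "\<delta> > 0" and D: "\<And>z v h. z \<in> ball x \<delta> \<Longrightarrow>
        h \<noteq> 0 \<Longrightarrow> norm (h *\<^sub>R v) < \<delta> \<Longrightarrow> norm (q z h v - T x v) \<le> e * norm v"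
        using est[of e x] by (metis centre_in_ball)
      define h where "h = \<delta> / (2 * (norm v + norm w + 1))"
      have h: "h > 0" using d by (simp add: h_def add_nonneg_pos)
      have "h * (norm v + norm w) < \<delta>" using d by (simp add: h_def divide_simps add_nonneg_pos)
      then have s: "norm (h *\<^sub>R (v + w)) < \<delta>" "norm (h *\<^sub>R v) < \<delta>" "norm (h *\<^sub>R w) < \<delta>"
      proof -
        have "h * norm (v + w) \<le> h * (norm v + norm w)" "h * norm v \<le> h * (norm v + norm w)"
          "h * norm w \<le> h * (norm v + norm w)"
          using h norm_triangle_ineq[of v w] by (auto intro!: mult_left_mono)
        then show "norm (h *\<^sub>R (v + w)) < \<delta>" "norm (h *\<^sub>R v) < \<delta>" "norm (h *\<^sub>R w) < \<delta>"
          using \<open>h * (norm v + norm w) < \<delta>\<close> unfolding norm_scaleR abs_of_pos[OF h] by linarith+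
      qed
      \<comment> \<open>A step along \<open>v + w\<close> is a step along \<open>w\<close> followed
        by a step along \<open>v\<close> from the displaced point \<open>x + h *\<^sub>R w\<close>.
        The estimate tolerates this displacement, which is why the criterion has to hold at nearby
        base points and not only at \<open>x\<close>.\<close>
      have "q x h (v + w) = q (x + h *\<^sub>R w) h v + q x h w"
        by (simp add: q_def algebra_simps)
      then have "T x (v + w) - T x v - T x w =
        (q (x + h *\<^sub>R w) h v - T x v) + (q x h w - T x w) - (q x h (v + w) - T x (v + w))"
        by (simp add: algebra_simps)
      also have "norm \<dots> \<le> e * norm v + e * norm w + e * norm (v + w)"
        by (intro order_trans[OF norm_triangle_ineq4] order_trans[OF norm_triangle_ineq] add_mono D)
          (use s d h in \<open>auto simp: dist_norm\<close>)
      finally show "norm (T x (v + w) - T x v - T x w) \<le> e * (norm (v + w) + norm v + norm w)"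
        by (simp add: algebra_simps)
    qed
    then show ?thesis by (simp add: algebra_simps)
  qed
  have scale: "T x (c *\<^sub>R v) = c *\<^sub>R T x v" for x c v
  proof (cases "c = 0")
    case True
    then show ?thesis using add[of x 0 0] by simp
  next
    case False
    have "T x (c *\<^sub>R v) - c *\<^sub>R T x v = 0"
    proof (rule zeroI[where c="\<bar>c\<bar> * norm v + norm (c *\<^sub>R v)"])
      fix e :: real assume "e > 0"
      then obtain \<delta> where d: "\<delta> > 0" and D: "\<And>z v h. z \<in> ball x \<delta> \<Longrightarrow>
        h \<noteq> 0 \<Longrightarrow> norm (h *\<^sub>R v) < \<delta> \<Longrightarrow> norm (q z h v - T x v) \<le> e * norm v"
        using est[of e x] by (metis centre_in_ball)
      define h where "h = \<delta> / (2 * (norm (c *\<^sub>R v) + 1))"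
      have h: "h > 0" using d by (simp add: h_def add_nonneg_pos)
      have "h * norm (c *\<^sub>R v) < \<delta>" using d by (simp add: h_def divide_simps add_nonneg_pos)
      then have s: "norm (h *\<^sub>R c *\<^sub>R v) < \<delta>" "norm ((h * c) *\<^sub>R v) < \<delta>" using h by (auto simp: abs_mult)
      have "q x h (c *\<^sub>R v) = c *\<^sub>R q x (h * c) v"
        using False by (simp add: q_def field_simps)
      then have "T x (c *\<^sub>R v) - c *\<^sub>R T x v =
        c *\<^sub>R (q x (h * c) v - T x v) - (q x h (c *\<^sub>R v) - T x (c *\<^sub>R v))"
        by (simp add: algebra_simps)
      also have "norm \<dots> \<le> \<bar>c\<bar> * norm (q x (h * c) v - T x v) + norm (q x h (c *\<^sub>R v) - T x (c *\<^sub>R v))"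
        by (rule order_trans[OF norm_triangle_ineq4]) simp
      also have "\<dots> \<le> \<bar>c\<bar> * (e * norm v) + e * norm (c *\<^sub>R v)"
        using s h d False by (intro add_mono mult_left_mono D) auto
      finally show "norm (T x (c *\<^sub>R v) - c *\<^sub>R T x v) \<le> e * (\<bar>c\<bar> * norm v + norm (c *\<^sub>R v))"
        by (simp add: algebra_simps)
    qed
    then show ?thesis by simp
  qed
  have bl: "bounded_linear (T x)" for x
    using add scale by (intro linear_conv_bounded_linear[THEN iffD1] linearI) auto
  show thesis
  proof
    show "(f has_derivative T x) (at x)" for x
      unfolding has_derivative_at_alt
    proof (intro conjI allI impI bl)
      fix e :: real assume "e > 0"
      then obtain \<delta> where d: "\<delta> > 0" and D: "\<And>v h.
        h \<noteq> 0 \<Longrightarrow> norm (h *\<^sub>R v) < \<delta> \<Longrightarrow> norm (q x h v - T x v) \<le> e * norm v"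
        using est[of e x] by (metis centre_in_ball)
      \<comment> \<open>With step 1 in direction \<open>y - x\<close> the quotient is the increment
        of \<open>f\<close> itself.\<close>
      have "norm (f y - f x - T x (y - x)) \<le> e * norm (y - x)" if "norm (y - x) < \<delta>" for y
        using D[of 1 "y - x"] that by (simp add: q_def)
      with d show "\<exists>d>0. \<forall>y. norm (y - x) < d \<longrightarrow> norm (f y - f x - T x (y - x)) \<le> e * norm (y - x)"
        by blast
    qed
    show "continuous_on UNIV (\<lambda>x. T x v)" for v
      unfolding continuous_on_iff
    proof (intro ballI allI impI)
      fix x :: 'a and e :: real assume e: "e > 0"
      have "e / (2 * (norm v + 1)) > 0" using e by (simp add: add_nonneg_pos)
      then obtain \<delta> where d: "\<delta> > 0" and D: "\<And>y h. y \<in> ball x \<delta> \<Longrightarrow>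
        h \<noteq> 0 \<Longrightarrow> norm (h *\<^sub>R v) < \<delta> \<Longrightarrow> norm (q x h v - T y v) \<le> e / (2 * (norm v + 1)) * norm v"
        using est[of "e / (2 * (norm v + 1))" x] by (metis centre_in_ball)
      obtain n where n: "norm ((1 / real (Suc n)) *\<^sub>R v) < \<delta>"
        using small[OF d, of v] eventually_happens'[OF sequentially_bot] by blast
      have lt: "e / (2 * (norm v + 1)) * norm v < e / 2" using e by (simp add: divide_simps add_nonneg_pos)
      have "dist (T y v) (T x v) < e" if y: "dist y x < \<delta>" for y
      proof -
        have "norm (T y v - T x v) \<le> norm (q x (1 / real (Suc n)) v - T x v) + norm (q x (1 / real (Suc n)) v - T y v)"
          using norm_triangle_ineq4[of "q x (1 / real (Suc n)) v - T x v" "q x (1 / real (Suc n)) v - T y v"] by simp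
        moreover have "norm (q x (1 / real (Suc n)) v - T x v) \<le> e / (2 * (norm v + 1)) * norm v"
          by (rule D[OF _ _ n]) (use d in auto)
        moreover have "norm (q x (1 / real (Suc n)) v - T y v) \<le> e / (2 * (norm v + 1)) * norm v"
          by (rule D[OF _ _ n]) (use y in \<open>auto simp: dist_commute\<close>)
        ultimately have "norm (T y v - T x v) < e / 2 + e / 2"
          using lt by (meson add_strict_mono le_less_trans)
        then show ?thesis by (simp add: dist_norm)
      qed
      with d show "\<exists>d>0. \<forall>x'\<in>UNIV. dist x' x < d \<longrightarrow> dist (T x' v) (T x v) < e" by blast
    qed
  qed
qed

section \<open>The flow of a field with bounded derivative\<close>

locale c1_flow =
  fixes F :: "'a::euclidean_space \<Rightarrow> 'a" and F' :: "'a \<Rightarrow> 'a \<Rightarrow>\<^sub>L 'a"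
    and L :: real and \<phi> :: "real \<Rightarrow> 'a \<Rightarrow> 'a"
  assumes F'_cont: "continuous_on UNIV F'"
    and F'_bound: "\<And>x. norm (F' x) \<le> L"
    and F_deriv: "\<And>x. (F has_derivative blinfun_apply (F' x)) (at x)"
    and flow0: "\<And>x. \<phi> 0 x = x"
    and flow_add: "\<And>s t. \<phi> (t + s) = \<phi> t \<circ> \<phi> s"
    and flow_deriv: "\<And>t x. ((\<lambda>t. \<phi> t x) has_vector_derivative F (\<phi> t x)) (at t)"
begin

lemma L_nonneg: "L \<ge> 0"
  using F'_bound[of 0] norm_ge_zero[of "F' 0"] by linarith

lemma F_lipschitz: "norm (F x - F y) \<le> L * norm (x - y)"
  using differentiable_bound[of UNIV F "\<lambda>x. blinfun_apply (F' x)" L] F_deriv F'_bound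
  by (auto simp: norm_blinfun.rep_eq)

lemma F_continuous: "continuous_on S F"
  by (meson F_deriv continuous_at_imp_continuous_on has_derivative_continuous)

lemma flow_add': "\<phi> (t + s) x = \<phi> t (\<phi> s x)"
  by (simp add: flow_add)

lemma flow_inverse [simp]: "\<phi> t (\<phi> (-t) x) = x" "\<phi> (-t) (\<phi> t x) = x"
  by (simp_all add: flow_add'[symmetric] flow0)

text \<open>The root of the factor \<open>exp ((2 * L + 1) * \<bar>t\<bar>)\<close> in
  \<open>gronwall_square\<close>, hence the extra 1/2. It measures the spreading of orbits only; the
  exponent of the group comes from a separate scalar estimate.\<close>

definition K :: "real \<Rightarrow> real" where "K t = exp ((L + 1/2) * \<bar>t\<bar>)"

lemma K_ge_1: "K t \<ge> 1"
  using L_nonneg by (simp add: K_def)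

lemma K_mono: "\<bar>s\<bar> \<le> \<bar>t\<bar> \<Longrightarrow> K s \<le> K t"
  using L_nonneg by (simp add: K_def mult_left_mono)

lemma K_square: "exp ((2 * L + 1) * \<bar>t\<bar>) = (K t)\<^sup>2"
  by (simp add: K_def power2_eq_square mult_exp_exp algebra_simps)

lemma flow_lipschitz: "norm (\<phi> t x - \<phi> t y) \<le> K t * norm (x - y)"
proof -
  have "(norm (\<phi> t x - \<phi> t y))\<^sup>2 \<le> exp ((2 * L + 1) * \<bar>t\<bar>) * ((norm (\<phi> 0 x - \<phi> 0 y))\<^sup>2 + 0\<^sup>2 * \<bar>t\<bar>)"
    by (rule gronwall_square[where v'="\<lambda>s. F (\<phi> s x) - F (\<phi> s y)"])
      (auto intro!: has_vector_derivative_diff flow_deriv F_lipschitz L_nonneg)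
  then have "(norm (\<phi> t x - \<phi> t y))\<^sup>2 \<le> (K t * norm (x - y))\<^sup>2"
    by (simp add: K_square flow0 power_mult_distrib)
  then show ?thesis
    by (rule power2_le_imp_le) (use K_ge_1[of t] in auto)
qed

lemma flow_continuous: "continuous_on S (\<phi> t)"
  by (rule lipschitz_on_continuous_on[where L="K t"], rule lipschitz_onI)
    (use flow_lipschitz K_ge_1[of t] in \<open>auto simp: dist_norm\<close>)

lemma flow_time_continuous: "continuous_on S (\<lambda>t. \<phi> t x)"
  by (intro continuous_at_imp_continuous_on ballI has_vector_derivative_continuous[OF flow_deriv])

text \<open>The point \<open>x\<close> is recovered from \<open>\<phi> t x\<close> by running the
  flow backwards, and \<open>norm (F y) \<le> L * norm y + norm (F 0)\<close> bounds how far that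
  can lead. Preimages of a ball are thus bounded uniformly over a time interval, which gives
  \<open>u \<circ> \<phi> t\<close> bounded support and gives families over \<open>t\<close> a
  common dominating function.\<close>

lemma flow_bounded:
  obtains R' where "R' \<ge> 0" "\<And>t x. \<bar>t\<bar> \<le> T \<Longrightarrow> norm (\<phi> t x) \<le> R \<Longrightarrow> norm x \<le> R'"
proof -
  define S where "S = sqrt ((K T)\<^sup>2 * (R\<^sup>2 + (norm (F 0))\<^sup>2 * \<bar>T\<bar>))"
  have "norm x \<le> S" if t: "\<bar>t\<bar> \<le> T" and R: "norm (\<phi> t x) \<le> R" for t x
  proof -
    define y where "y = \<phi> t x"
    have "(norm (\<phi> (-t) y))\<^sup>2 \<le> exp ((2 * L + 1) * \<bar>-t\<bar>) * ((norm (\<phi> 0 y))\<^sup>2 + (norm (F 0))\<^sup>2 * \<bar>-t\<bar>)"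
    proof (rule gronwall_square[where v'="\<lambda>s. F (\<phi> s y)"])
      show "norm (F (\<phi> s y)) \<le> L * norm (\<phi> s y) + norm (F 0)" for s
        using F_lipschitz[of "\<phi> s y" 0] norm_triangle_sub[of "F (\<phi> s y)" "F 0"] by simp
    qed (auto intro: flow_deriv L_nonneg)
    then have "(norm x)\<^sup>2 \<le> (K t)\<^sup>2 * ((norm y)\<^sup>2 + (norm (F 0))\<^sup>2 * \<bar>t\<bar>)"
      unfolding K_square by (simp add: y_def flow0 K_def)
    also have "\<dots> \<le> (K T)\<^sup>2 * (R\<^sup>2 + (norm (F 0))\<^sup>2 * \<bar>T\<bar>)"
      using t R K_ge_1[of t] K_mono[of t T]
      by (intro mult_mono add_mono power_mono) (auto simp: y_def)
    finally show ?thesis unfolding S_def by (rule real_le_rsqrt)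
  qed
  then show thesis by (intro that[of S]) (auto simp: S_def)
qed

text \<open>The orbit piece is compact, so \<open>F'\<close> is uniformly continuous on a ball
  containing its unit neighbourhood. The mean value inequality for \<open>F\<close> minus its linear
  part at \<open>\<phi> s x0\<close> then yields one \<open>\<delta>\<close> for all times; the
  minimum with 1 keeps the points inside that ball.\<close>

lemma linearization_along_orbit:
  assumes "e > 0"
  obtains \<delta> where "\<delta> > 0" "\<And>s p q. \<bar>s\<bar> \<le> T \<Longrightarrow> p \<in> ball (\<phi> s x0) \<delta> \<Longrightarrow> q \<in> ball (\<phi> s x0) \<delta> \<Longrightarrow>
    norm (F p - F q - F' (\<phi> s x0) (p - q)) \<le> e * norm (p - q)"
proof -
  have "bounded ((\<lambda>s. \<phi> s x0) ` {-T..T})"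
    by (intro compact_imp_bounded compact_continuous_image flow_time_continuous) auto
  then obtain R where R: "\<And>s. \<bar>s\<bar> \<le> T \<Longrightarrow> norm (\<phi> s x0) \<le> R"
    by (force simp: bounded_iff abs_le_iff)
  have "uniformly_continuous_on (cball 0 (R + 1)) F'"
    by (intro compact_uniformly_continuous continuous_on_subset[OF F'_cont]) auto
  then obtain d where d: "d > 0" and D: "\<And>z w. norm z \<le> R + 1 \<Longrightarrow> norm w \<le> R + 1 \<Longrightarrow>
      dist z w < d \<Longrightarrow> dist (F' z) (F' w) < e"
    using assms unfolding uniformly_continuous_on_def by (metis mem_cball_0)
  show thesis
  proof
    show "min d 1 > 0" using d by simp
    fix s p q assume s: "\<bar>s\<bar> \<le> T" and p: "p \<in> ball (\<phi> s x0) (min d 1)" and q: "q \<in> ball (\<phi> s x0) (min d 1)"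
    let ?w = "\<phi> s x0"
    have "norm ((F p - F' ?w p) - (F q - F' ?w q)) \<le> e * norm (p - q)"
    proof (rule differentiable_bound[OF convex_ball[of ?w "min d 1"]])
      fix z assume z: "z \<in> ball ?w (min d 1)"
      have "((\<lambda>z. F z - F' ?w z) has_derivative (\<lambda>h. F' z h - F' ?w h)) (at z)"
        by (intro has_derivative_diff F_deriv blinfun.bounded_linear_right[THEN bounded_linear_imp_has_derivative])
      then show "((\<lambda>z. F z - F' ?w z) has_derivative blinfun_apply (F' z - F' ?w)) (at z within ball ?w (min d 1))"
        by (simp add: blinfun.diff_left[abs_def] has_derivative_at_withinI fun_diff_def)
      have "norm z \<le> R + 1" using z R[OF s] norm_triangle_sub[of z ?w]
        by (simp add: dist_norm norm_minus_commute)
      then have "dist (F' z) (F' ?w) < e"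
        using z R[OF s] by (intro D) (auto simp: dist_commute)
      then show "onorm (blinfun_apply (F' z - F' ?w)) \<le> e"
        by (simp add: dist_norm norm_blinfun.rep_eq)
    qed (use p q in auto)
    then show "norm (F p - F q - F' ?w (p - q)) \<le> e * norm (p - q)"
      by (simp add: blinfun.diff_right algebra_simps)
  qed
qed

text \<open>Both quotients equal \<open>v\<close> at time 0, and each solves the linear equation
  with coefficient \<open>F' (\<phi> s x0)\<close> up to a small error. Their difference therefore
  starts at 0 and stays small by Gronwall's inequality.\<close>

lemma flow_quotient_strict:
  assumes e: "e > 0"
  shows "\<exists>\<delta>>0. \<forall>x\<in>ball x0 \<delta>. \<forall>y\<in>ball x0 \<delta>. \<forall>v h k.
      h \<noteq> 0 \<and> k \<noteq> 0 \<and> norm (h *\<^sub>R v) < \<delta> \<and> norm (k *\<^sub>R v) < \<delta> \<longrightarrow>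
      norm ((\<phi> t (x + h *\<^sub>R v) - \<phi> t x) /\<^sub>R h - (\<phi> t (y + k *\<^sub>R v) - \<phi> t y) /\<^sub>R k) \<le> e * norm v"
proof -
  define T where "T = \<bar>t\<bar>"
  have T0: "T \<ge> 0" by (simp add: T_def)
  have K1: "K T \<ge> 1" by (rule K_ge_1)
  have KT: "K s \<le> K T" if "\<bar>s\<bar> \<le> T" for s using that K_mono[of s T] by simp
  \<comment> \<open>Chosen so that \<open>K T * b = e * norm v / (T + 1)\<close> for the total error
    \<open>b = 2 * e' * K T * norm v\<close> below; the factor \<open>T\<close> produced by
    \<open>gronwall_square\<close> is absorbed by \<open>(T + 1)\<^sup>2\<close>.\<close>
  define e' where "e' = e / (2 * (K T)\<^sup>2 * (T + 1))"
  have e': "e' > 0" using e K1 T0 by (simp add: e'_def)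
  obtain \<delta> where d: "\<delta> > 0" and lin: "\<And>s p q. \<bar>s\<bar> \<le> T \<Longrightarrow> p \<in> ball (\<phi> s x0) \<delta> \<Longrightarrow> q \<in> ball (\<phi> s x0) \<delta> \<Longrightarrow>
    norm (F p - F q - F' (\<phi> s x0) (p - q)) \<le> e' * norm (p - q)"
    using linearization_along_orbit[OF e', of T x0] by blast
  \<comment> \<open>The displaced points lie within \<open>2 * \<epsilon>\<close> of
    \<open>x0\<close>, and the flow spreads distances by at most \<open>K T\<close>, so all orbits
    involved stay within \<open>\<delta>\<close> of the orbit of \<open>x0\<close>.\<close>
  define \<epsilon> where "\<epsilon> = \<delta> / (2 * K T)"
  have eps: "\<epsilon> > 0" using d K1 by (simp add: \<epsilon>_def)
  have near: "\<phi> s z \<in> ball (\<phi> s x0) \<delta>" if "\<bar>s\<bar> \<le> T" "norm (z - x0) < 2 * \<epsilon>" for s z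
  proof -
    have "norm (\<phi> s z - \<phi> s x0) \<le> K T * norm (z - x0)"
      using flow_lipschitz[of s z x0] mult_right_mono[OF KT[OF that(1)] norm_ge_zero[of "z - x0"]] by linarith
    also have "\<dots> < K T * (2 * \<epsilon>)" using that K1 by (intro mult_strict_left_mono) auto
    also have "\<dots> = \<delta>" using K1 by (simp add: \<epsilon>_def)
    finally show ?thesis by (simp add: dist_norm norm_minus_commute)
  qed
  have quot: "norm ((F (\<phi> s (x + h *\<^sub>R v)) - F (\<phi> s x)) /\<^sub>R h - F' (\<phi> s x0) ((\<phi> s (x + h *\<^sub>R v) - \<phi> s x) /\<^sub>R h))
      \<le> e' * K T * norm v"
    if s: "\<bar>s\<bar> \<le> T" and x: "x \<in> ball x0 \<epsilon>" and h: "h \<noteq> 0" "norm (h *\<^sub>R v) < \<epsilon>" for s x h v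
  proof -
    let ?p = "\<phi> s (x + h *\<^sub>R v)" and ?q = "\<phi> s x"
    have x': "norm (x - x0) < \<epsilon>" using x by (simp add: dist_norm norm_minus_commute)
    have "norm (x + h *\<^sub>R v - x0) < 2 * \<epsilon>"
      using norm_triangle_ineq[of "x - x0" "h *\<^sub>R v"] x' h(2) by (simp add: algebra_simps)
    then have "norm (F ?p - F ?q - F' (\<phi> s x0) (?p - ?q)) \<le> e' * norm (?p - ?q)"
      using x' eps by (intro lin near s) auto
    also have "norm (?p - ?q) \<le> K T * norm (h *\<^sub>R v)"
      using flow_lipschitz[of s "x + h *\<^sub>R v" x] mult_right_mono[OF KT[OF s] norm_ge_zero[of "h *\<^sub>R v"]] by simp
    finally have *: "norm (F ?p - F ?q - F' (\<phi> s x0) (?p - ?q)) \<le> e' * (K T * norm (h *\<^sub>R v))"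
      using e' by simp
    have "(F ?p - F ?q) /\<^sub>R h - F' (\<phi> s x0) ((?p - ?q) /\<^sub>R h) = (F ?p - F ?q - F' (\<phi> s x0) (?p - ?q)) /\<^sub>R h"
      by (simp add: blinfun.scaleR_right blinfun.diff_right scaleR_diff_right)
    also have "norm \<dots> \<le> e' * (K T * norm (h *\<^sub>R v)) / \<bar>h\<bar>"
      using * by (simp add: divide_inverse mult.commute mult_left_mono)
    also have "\<dots> = e' * K T * norm v" using h(1) by simp
    finally show ?thesis .
  qed
  have "norm ((\<phi> t (x + h *\<^sub>R v) - \<phi> t x) /\<^sub>R h - (\<phi> t (y + k *\<^sub>R v) - \<phi> t y) /\<^sub>R k) \<le> e * norm v"
    if x: "x \<in> ball x0 \<epsilon>" and y: "y \<in> ball x0 \<epsilon>" and h: "h \<noteq> 0" "norm (h *\<^sub>R v) < \<epsilon>"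
      and k: "k \<noteq> 0" "norm (k *\<^sub>R v) < \<epsilon>" for x y v h k
  proof -
    define D where "D s = (\<phi> s (x + h *\<^sub>R v) - \<phi> s x) /\<^sub>R h - (\<phi> s (y + k *\<^sub>R v) - \<phi> s y) /\<^sub>R k" for s
    define D' where "D' s = (F (\<phi> s (x + h *\<^sub>R v)) - F (\<phi> s x)) /\<^sub>R h - (F (\<phi> s (y + k *\<^sub>R v)) - F (\<phi> s y)) /\<^sub>R k" for s
    define b where "b = 2 * e' * K T * norm v"
    have der: "(D has_vector_derivative D' s) (at s)" for s
      unfolding D_def D'_def
      by (intro has_vector_derivative_diff flow_deriv
          has_vector_derivative_scaleR[OF DERIV_const, where 'a='a, simplified])
    have D'b: "norm (D' s) \<le> L * norm (D s) + b" if "\<bar>s\<bar> \<le> \<bar>t\<bar>" for s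
    proof -
      have s: "\<bar>s\<bar> \<le> T" using that by (simp add: T_def)
      have "D' s = F' (\<phi> s x0) (D s)
        + ((F (\<phi> s (x + h *\<^sub>R v)) - F (\<phi> s x)) /\<^sub>R h - F' (\<phi> s x0) ((\<phi> s (x + h *\<^sub>R v) - \<phi> s x) /\<^sub>R h))
        - ((F (\<phi> s (y + k *\<^sub>R v)) - F (\<phi> s y)) /\<^sub>R k - F' (\<phi> s x0) ((\<phi> s (y + k *\<^sub>R v) - \<phi> s y) /\<^sub>R k))"
        by (simp add: D_def D'_def blinfun.diff_right)
      also have "norm \<dots> \<le> norm (F' (\<phi> s x0) (D s)) + e' * K T * norm v + e' * K T * norm v"
        by (intro order_trans[OF norm_triangle_ineq4] order_trans[OF norm_triangle_ineq] add_mono quot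
            s x y h k order_refl)
      also have "norm (F' (\<phi> s x0) (D s)) \<le> L * norm (D s)"
        using norm_blinfun[of "F' (\<phi> s x0)" "D s"] mult_right_mono[OF F'_bound[of "\<phi> s x0"] norm_ge_zero[of "D s"]]
        by linarith
      finally show ?thesis by (simp add: b_def mult_ac)
    qed
    have "D 0 = 0" using h(1) k(1) by (simp add: D_def flow0)
    then have "(norm (D t))\<^sup>2 \<le> (K T)\<^sup>2 * (b\<^sup>2 * T)"
      using gronwall_square[OF der D'b L_nonneg] by (simp add: K_square T_def K_def)
    also have "\<dots> = (e * norm v)\<^sup>2 * (T / (T + 1)\<^sup>2)"
    proof -
      have "K T * b = e * norm v / (T + 1)"
        using K1 T0 by (simp add: b_def e'_def power2_eq_square)
      then have "(K T * b)\<^sup>2 * T = (e * norm v / (T + 1))\<^sup>2 * T" by simp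
      then show ?thesis by (simp add: power_mult_distrib power_divide)
    qed
    also have "\<dots> \<le> (e * norm v)\<^sup>2 * 1"
    proof (rule mult_left_mono)
      have "T \<le> (T + 1)\<^sup>2" using T0 by (simp add: power2_eq_square algebra_simps)
      then show "T / (T + 1)\<^sup>2 \<le> 1" using T0 by (simp add: divide_le_eq)
    qed auto
    finally have "(norm (D t))\<^sup>2 \<le> (e * norm v)\<^sup>2" by simp
    then have "norm (D t) \<le> e * norm v"
      by (rule power2_le_imp_le) (use e in simp)
    then show ?thesis by (simp add: D_def)
  qed
  with eps show ?thesis by blast
qed

lemma flow_C1:
  obtains T where "\<And>x. (\<phi> t has_derivative T x) (at x)" "\<And>v. continuous_on UNIV (\<lambda>x. T x v)"
  by (rule strict_quotient_imp_C1[of "\<phi> t", OF flow_quotient_strict]) (assumption, rule that)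

text \<open>The curve \<open>\<phi> (t + s) x = \<phi> t (\<phi> s x)\<close> is differentiated at
  \<open>s = 0\<close> in two ways. The derivative of the flow thus carries \<open>F\<close> to
  itself, which is why the operator \<open>F \<bullet> grad\<close> commutes with composition by the
  flow.\<close>

lemma flow_derivative_F:
  assumes "(\<phi> t has_derivative T) (at x)"
  shows "T (F x) = F (\<phi> t x)"
proof -
  have "((\<lambda>s. \<phi> s x) has_vector_derivative F x) (at 0)"
    using flow_deriv[where t=0 and x=x] by (simp add: flow0)
  then have 1: "((\<lambda>s. \<phi> s x) has_derivative (\<lambda>h. h *\<^sub>R F x)) (at 0)"
    by (simp add: has_vector_derivative_def)
  have "((\<lambda>s. \<phi> t (\<phi> s x)) has_derivative (\<lambda>h. T (h *\<^sub>R F x))) (at 0)"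
    by (rule has_derivative_compose[OF 1]) (use assms in \<open>simp add: flow0\<close>)
  moreover have "T (h *\<^sub>R F x) = h *\<^sub>R T (F x)" for h
    using has_derivative_linear[OF assms] by (simp add: linear_cmul)
  ultimately have "((\<lambda>s. \<phi> (t + s) x) has_vector_derivative T (F x)) (at 0)"
    by (simp add: has_vector_derivative_def flow_add')
  moreover have "((\<lambda>s. \<phi> (t + s) x) has_vector_derivative F (\<phi> t x)) (at 0)"
  proof -
    have "((\<lambda>s. \<phi> s x) \<circ> (\<lambda>s. t + s) has_vector_derivative 1 *\<^sub>R F (\<phi> (t + 0) x)) (at 0)"
    proof (rule vector_diff_chain_at)
      show "((\<lambda>s. t + s) has_vector_derivative 1) (at 0)"
        by (rule has_real_derivative_iff_has_vector_derivative[THEN iffD1])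
          (auto intro!: derivative_eq_intros)
    qed (rule flow_deriv)
    then show ?thesis by (simp add: o_def)
  qed
  ultimately show ?thesis by (rule vector_derivative_unique_at)
qed

end

section \<open>Transport of densities along the flow\<close>

text \<open>Limits at a real point are tested along sequences. Domination is asked only at distance
  below 1 from \<open>a\<close>, so each sequence is shifted by \<open>N\<close> before the
  sequential theorem applies.\<close>

lemma integral_dominated_convergence_at:
  fixes s :: "real \<Rightarrow> 'a \<Rightarrow> real"
  assumes f: "f \<in> borel_measurable M" and s: "\<And>h. s h \<in> borel_measurable M"
    and w: "integrable M w"
    and lim: "AE x in M. ((\<lambda>h. s h x) \<longlongrightarrow> f x) (at a)"
    and bound: "\<And>h. h \<noteq> a \<Longrightarrow> \<bar>h - a\<bar> < 1 \<Longrightarrow> AE x in M. \<bar>s h x\<bar> \<le> w x"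
  shows "((\<lambda>h. \<integral>x. s h x \<partial>M) \<longlongrightarrow> (\<integral>x. f x \<partial>M)) (at a)"
  unfolding tendsto_at_iff_sequentially
proof (intro allI impI)
  fix X :: "nat \<Rightarrow> real" assume X: "\<forall>i. X i \<in> UNIV - {a}" "X \<longlonglongrightarrow> a"
  then obtain N where N: "\<And>n. n \<ge> N \<Longrightarrow> \<bar>X n - a\<bar> < 1"
    using LIMSEQ_D[OF X(2), of 1] by auto
  have "(\<lambda>n. \<integral>x. s (X (n + N)) x \<partial>M) \<longlonglongrightarrow> (\<integral>x. f x \<partial>M)"
  proof (rule integral_dominated_convergence[OF f s w])
    show "AE x in M. (\<lambda>n. s (X (n + N)) x) \<longlonglongrightarrow> f x"
      using lim
    proof eventually_elim
      fix x assume "((\<lambda>h. s h x) \<longlongrightarrow> f x) (at a)"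
      then have "(\<lambda>n. s (X n) x) \<longlonglongrightarrow> f x"
        using X unfolding tendsto_at_iff_sequentially by (auto simp: o_def)
      then show "(\<lambda>n. s (X (n + N)) x) \<longlonglongrightarrow> f x" by (rule LIMSEQ_ignore_initial_segment)
    qed
    show "AE x in M. norm (s (X (n + N)) x) \<le> w x" for n
      using bound[of "X (n + N)"] X N[of "n + N"] by auto
  qed
  then have "(\<lambda>n. \<integral>x. s (X n) x \<partial>M) \<longlonglongrightarrow> (\<integral>x. f x \<partial>M)" by (rule LIMSEQ_offset)
  then show "((\<lambda>h. \<integral>x. s h x \<partial>M) \<circ> X) \<longlonglongrightarrow> (\<integral>x. f x \<partial>M)" by (simp add: o_def)
qed

text \<open>\<open>exp (- (c * s)) * m s\<close> is nonincreasing, and negative times are reached by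
  reversal. Unlike \<open>gronwall_square\<close>, this keeps the exact exponent \<open>c\<close>,
  on which the bound with \<open>\<omega>0\<close> rests.\<close>

lemma gronwall_abs:
  fixes m :: "real \<Rightarrow> real"
  assumes m: "\<And>s. (m has_real_derivative m' s) (at s)"
    and bound: "\<And>s. \<bar>m' s\<bar> \<le> c * m s"
  shows "m t \<le> exp (c * \<bar>t\<bar>) * m 0"
proof -
  have pos: "n t \<le> exp (c * t) * n 0"
    if t: "t \<ge> 0" and n: "\<And>s. (n has_real_derivative n' s) (at s)" "\<And>s. \<bar>n' s\<bar> \<le> c * n s" for n n' t
  proof -
    have "exp (- (c * t)) * n t \<le> exp (- (c * 0)) * n 0"
    proof (rule DERIV_nonpos_imp_nonincreasing[OF t])
      fix s
      have "((\<lambda>s. exp (- (c * s)) * n s) has_real_derivative exp (- (c * s)) * (n' s - c * n s)) (at s)"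
        by (rule derivative_eq_intros refl n)+ (simp add: algebra_simps)
      moreover have "exp (- (c * s)) * (n' s - c * n s) \<le> 0"
        using n(2)[of s] by (intro mult_nonneg_nonpos) auto
      ultimately show "\<exists>y. ((\<lambda>s. exp (- (c * s)) * n s) has_real_derivative y) (at s) \<and> y \<le> 0" by blast
    qed
    then have "exp (c * t) * (exp (- (c * t)) * n t) \<le> exp (c * t) * n 0" by simp
    moreover have "exp (c * t) * (exp (- (c * t)) * n t) = n t" by (simp add: exp_minus)
    ultimately show ?thesis by simp
  qed
  show ?thesis
  proof (cases "t \<ge> 0")
    case True
    then show ?thesis using pos[OF True m bound] by simp
  next
    case False
    have "((\<lambda>s. m (- s)) has_real_derivative - m' (- s)) (at s)" for s
    proof -
      have "(uminus has_real_derivative -1) (at s)" by (auto intro!: derivative_eq_intros)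
      from DERIV_chain2[OF _ this, of m "m' (- s)"] m[of "- s"] show ?thesis by simp
    qed
    then show ?thesis using pos[of "-t" "\<lambda>s. m (- s)" "\<lambda>s. - m' (- s)"] bound False by simp
  qed
qed

text \<open>Translation invariance of Lebesgue measure makes the integral of every difference
  quotient in a coordinate direction zero, and dominated convergence passes this on to the
  derivative.\<close>

lemma integral_grad_component_eq_0:
  fixes w :: "real^'n \<Rightarrow> real"
  assumes w: "C1c w"
  shows "(\<integral>x. grad w x $ i \<partial>lebesgue) = 0"
proof -
  have C1: "C1 w" using w by (simp add: C1c_iff)
  define e :: "real^'n" where "e = axis i 1"
  have ne: "norm e = 1" by (simp add: e_def)
  obtain R where R: "R \<ge> 0" "\<And>x. norm x > R \<Longrightarrow> w x = 0" "\<And>x. norm x > R \<Longrightarrow> grad w x = 0"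
    by (rule C1c_vanishing[OF w], rule that)
  obtain B where B: "B \<ge> 0" "\<And>x. norm (grad w x) \<le> B"
    by (rule vanishing_continuous_bounded[OF C1_continuous_grad[OF C1] R(3)], simp, rule that)
  have wm: "w \<in> borel_measurable lborel" by (simp add: C1 C1_continuous borel_measurable_continuous_onI)
  have der: "((\<lambda>h. w (x + h *\<^sub>R e)) has_real_derivative grad w (x + h *\<^sub>R e) \<bullet> e) (at h)" for x h
  proof -
    have "((\<lambda>h. x + h *\<^sub>R e) has_derivative (\<lambda>k. k *\<^sub>R e)) (at h)" by (auto intro!: derivative_eq_intros)
    from has_derivative_compose[OF this C1_has_derivative[OF C1]]
    show ?thesis unfolding has_field_derivative_def
      by (rule has_derivative_eq_rhs) (auto simp: mult.commute)
  qed
  have lip: "\<bar>(w (x + h *\<^sub>R e) - w x) / h\<bar> \<le> B" for x h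
  proof (cases "h = 0")
    case False
    have "norm (w (x + h *\<^sub>R e) - w (x + 0 *\<^sub>R e)) \<le> B * norm (h - 0)"
    proof (rule field_differentiable_bound[of UNIV "\<lambda>h. w (x + h *\<^sub>R e)"])
      show "norm (grad w (x + h *\<^sub>R e) \<bullet> e) \<le> B" for h
        using Cauchy_Schwarz_ineq2[of "grad w (x + h *\<^sub>R e)" e] B(2)[of "x + h *\<^sub>R e"] by (simp add: ne)
    qed (use der in auto)
    then show ?thesis using False by (simp add: divide_le_eq)
  qed (use B in simp)
  have wint: "integrable lborel w"
  proof -
    obtain C where C: "\<And>x. \<bar>w x\<bar> \<le> C" using C1c_bounded[OF w] by blast
    have "integrable lborel (\<lambda>x::real^'n. C * indicator (cball 0 R) x)"
      by (intro integrable_mult_right integrable_real_indicator) (auto intro: emeasure_lborel_cball_finite[unfolded infinity_ennreal_def] simp: infinity_ennreal_def)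
    then show ?thesis
    proof (rule Bochner_Integration.integrable_bound)
      show "AE x in lborel. norm (w x) \<le> norm (C * indicator (cball 0 R) x)"
        using C R(2) by (intro AE_I2) (auto simp: indicator_def not_le intro: order_trans[OF _ abs_ge_self])
    qed (use wm in auto)
  qed
  have shift: "(\<integral>x. w (x + h *\<^sub>R e) \<partial>lborel) = (\<integral>x. w x \<partial>lborel)" "integrable lborel (\<lambda>x. w (x + h *\<^sub>R e))" for h
  proof -
    have "(\<integral>x. w x \<partial>distr lborel borel ((+) (h *\<^sub>R e))) = (\<integral>x. w (x + h *\<^sub>R e) \<partial>lborel)"
      using wm by (subst integral_distr) (auto simp: add.commute)
    then show "(\<integral>x. w (x + h *\<^sub>R e) \<partial>lborel) = (\<integral>x. w x \<partial>lborel)"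
      by (simp add: lborel_distr_plus)
    have "integrable (distr lborel borel ((+) (h *\<^sub>R e))) w" using wint by (simp add: lborel_distr_plus)
    then show "integrable lborel (\<lambda>x. w (x + h *\<^sub>R e))"
      using wm by (subst (asm) integrable_distr_eq) (auto simp: add.commute)
  qed
  have "((\<lambda>h. \<integral>x. (w (x + h *\<^sub>R e) - w x) / h \<partial>lborel) \<longlongrightarrow> (\<integral>x. grad w x \<bullet> e \<partial>lborel)) (at 0)"
  proof (rule integral_dominated_convergence_at)
    show "(\<lambda>x. grad w x \<bullet> e) \<in> borel_measurable lborel"
      using C1 by (auto intro!: borel_measurable_continuous_onI continuous_intros C1_continuous_grad)
    show "(\<lambda>x. (w (x + h *\<^sub>R e) - w x) / h) \<in> borel_measurable lborel" for h
      using wm by measurable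
    \<comment> \<open>A shift by \<open>h *\<^sub>R e\<close> with \<open>\<bar>h\<bar> < 1\<close>
      moves the support by less than 1, hence the radius \<open>R + 1\<close>.\<close>
    show "integrable lborel (\<lambda>x::real^'n. B * indicator (cball 0 (R + 1)) x)"
      by (intro integrable_mult_right integrable_real_indicator) (auto intro: emeasure_lborel_cball_finite[unfolded infinity_ennreal_def] simp: infinity_ennreal_def)
    show "AE x in lborel. ((\<lambda>h. (w (x + h *\<^sub>R e) - w x) / h) \<longlongrightarrow> grad w x \<bullet> e) (at 0)"
      using der[of _ 0] by (intro AE_I2) (simp add: has_field_derivative_iff)
    show "AE x in lborel. \<bar>(w (x + h *\<^sub>R e) - w x) / h\<bar> \<le> B * indicator (cball 0 (R + 1)) x"
      if "h \<noteq> 0" "\<bar>h - 0\<bar> < 1" for h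
    proof (rule AE_I2)
      fix x
      show "\<bar>(w (x + h *\<^sub>R e) - w x) / h\<bar> \<le> B * indicator (cball 0 (R + 1)) x"
      proof (cases "norm x \<le> R + 1")
        case True
        then show ?thesis using lip by simp
      next
        case False
        then have "norm (x + h *\<^sub>R e) > R"
          using norm_triangle_ineq4[of "x + h *\<^sub>R e" "h *\<^sub>R e"] that(2) by (simp add: ne)
        then show ?thesis using R(2) False by simp
      qed
    qed
  qed
  moreover have "(\<integral>x. (w (x + h *\<^sub>R e) - w x) / h \<partial>lborel) = 0" for h
    using shift[of h] wint by simp
  ultimately have "((\<lambda>h::real. 0) \<longlongrightarrow> (\<integral>x. grad w x \<bullet> e \<partial>lborel)) (at (0::real))"
    by (simp only:)
  then have "(\<integral>x. grad w x \<bullet> e \<partial>lborel) = 0"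
    by (simp add: tendsto_const_iff)
  moreover have "(\<integral>x. grad w x $ i \<partial>lebesgue) = (\<integral>x. grad w x \<bullet> e \<partial>lborel)"
    using C1 by (subst integral_completion)
      (auto intro!: borel_measurable_continuous_onI continuous_intros C1_continuous_grad simp: e_def inner_axis)
  ultimately show ?thesis by simp
qed

section \<open>Test functions and null sets under the flow\<close>

locale c1_flow_vec = c1_flow F F' L \<phi>
  for F :: "real^'n \<Rightarrow> real^'n" and F' :: "real^'n \<Rightarrow> (real^'n) \<Rightarrow>\<^sub>L (real^'n)"
    and L :: real and \<phi> :: "real \<Rightarrow> real^'n \<Rightarrow> real^'n"
begin

text \<open>Chain rule for the \<open>C1\<close> map \<open>\<phi> t\<close>, with the support
  controlled by \<open>flow_bounded\<close>. The second identity is \<open>flow_derivative_F\<close>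
  inserted into the chain rule.\<close>

lemma C1c_flow:
  assumes u: "C1c u"
  shows "C1c (\<lambda>x. u (\<phi> t x))"
    and "F x \<bullet> grad (\<lambda>x. u (\<phi> t x)) x = F (\<phi> t x) \<bullet> grad u (\<phi> t x)"
proof -
  have C1: "C1 u" using u by (simp add: C1c_iff)
  obtain T where T: "\<And>x. (\<phi> t has_derivative T x) (at x)" "\<And>v. continuous_on UNIV (\<lambda>x. T x v)"
    using flow_C1 by blast
  define w where "w = (\<lambda>x. u (\<phi> t x))"
  have dw: "(w has_derivative (\<lambda>h. grad u (\<phi> t x) \<bullet> T x h)) (at x)" for x
    unfolding w_def by (rule has_derivative_compose[OF T(1) C1_has_derivative[OF C1]])
  then have dw': "(w has_derivative (\<lambda>h. grad w x \<bullet> h)) (at x)" for x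
    by (intro has_derivative_grad) (auto simp: differentiable_def)
  have g: "grad w x \<bullet> h = grad u (\<phi> t x) \<bullet> T x h" for x h
    using has_derivative_unique[OF dw dw'] by metis
  have "grad w = (\<lambda>x. \<chi> i. grad u (\<phi> t x) \<bullet> T x (axis i 1))"
    by (auto simp: fun_eq_iff vec_eq_iff g[symmetric] inner_axis)
  moreover have "continuous_on UNIV (\<lambda>x. \<chi> i. grad u (\<phi> t x) \<bullet> T x (axis i 1))"
    by (intro continuous_intros T continuous_on_compose2[OF C1_continuous_grad[OF C1, of UNIV] flow_continuous]) auto
  ultimately have "C1 w" using dw' by (simp add: C1_def)
  moreover have "bounded {x. w x \<noteq> 0}"
  proof -
    obtain R where R: "R \<ge> 0" "\<And>x. norm x > R \<Longrightarrow> u x = 0" "\<And>x. norm x > R \<Longrightarrow> grad u x = 0"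
      by (rule C1c_vanishing[OF u], rule that)
    obtain R' where R': "R' \<ge> 0" "\<And>s x. \<bar>s\<bar> \<le> \<bar>t\<bar> \<Longrightarrow> norm (\<phi> s x) \<le> R \<Longrightarrow> norm x \<le> R'"
      by (rule flow_bounded[of "\<bar>t\<bar>" R], rule that)
    have "norm x \<le> R'" if "w x \<noteq> 0" for x
      using that R(2)[of "\<phi> t x"] R'(2)[of t x] by (force simp: w_def)
    then show ?thesis by (auto simp: bounded_iff)
  qed
  ultimately show "C1c (\<lambda>x. u (\<phi> t x))" by (simp add: C1c_iff w_def)
  show "F x \<bullet> grad (\<lambda>x. u (\<phi> t x)) x = F (\<phi> t x) \<bullet> grad u (\<phi> t x)"
    using g[of x "F x"] flow_derivative_F[OF T(1)] by (simp add: w_def inner_commute)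
qed

lemma vimage_eq_image: "\<phi> t -` A = \<phi> (-t) ` A"
  using flow_inverse by (force simp: image_iff)

lemma flow_differentiable: "\<phi> t differentiable_on S"
  using flow_C1[of t] by (metis differentiable_at_withinI differentiable_def differentiable_on_def)

text \<open>Continuity alone controls preimages of Borel sets only. In the completed sigma-algebra
  the preimage is written as an image under the differentiable inverse \<open>\<phi> (-t)\<close>,
  and such images of Lebesgue sets are Lebesgue sets.\<close>

lemma flow_vimage_sets: "A \<in> sets lebesgue \<Longrightarrow> \<phi> t -` A \<in> sets lebesgue"
  unfolding vimage_eq_image by (rule differentiable_image_in_sets_lebesgue) (auto intro: flow_differentiable)

lemma flow_measurable [measurable]: "\<phi> t \<in> lebesgue \<rightarrow>\<^sub>M lebesgue"
  by (rule measurableI) (auto intro: flow_vimage_sets)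

lemma flow_AE:
  assumes "AE x in lebesgue. Q x"
  shows "AE x in lebesgue. Q (\<phi> t x)"
proof -
  obtain N where N: "{x. \<not> Q x} \<subseteq> N" "N \<in> null_sets lebesgue"
    using assms by (force elim!: AE_E simp: null_sets_def)
  have "negligible (\<phi> (-t) ` N)"
    using N(2) by (intro negligible_differentiable_image_negligible flow_differentiable)
      (auto simp: negligible_iff_null_sets)
  then have "\<phi> t -` N \<in> null_sets lebesgue"
    unfolding vimage_eq_image negligible_iff_null_sets .
  moreover have "{x. \<not> Q (\<phi> t x)} \<subseteq> \<phi> t -` N" using N(1) by auto
  ultimately show ?thesis by (intro AE_I') auto
qed

lemma C1c_flow_deriv:
  assumes "C1c u"
  shows "((\<lambda>s. u (\<phi> s x)) has_real_derivative F (\<phi> s x) \<bullet> grad u (\<phi> s x)) (at s)"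
proof -
  have C1: "C1 u" using assms by (simp add: C1c_iff)
  from has_derivative_compose[OF flow_deriv[of x s, unfolded has_vector_derivative_def] C1_has_derivative[OF C1]]
  show ?thesis unfolding has_field_derivative_def
    by (rule has_derivative_eq_rhs) (auto simp: mult.commute inner_commute)
qed

text \<open>\<open>F\<close> itself may grow linearly, but \<open>F \<bullet> grad u\<close> is
  continuous and zero outside a ball. It is the time derivative of \<open>u\<close> along orbits, so
  one constant bounds all difference quotients in time.\<close>

lemma C1c_flow_lipschitz:
  assumes u: "C1c u"
  obtains B where "B \<ge> 0" "\<And>x. \<bar>F x \<bullet> grad u x\<bar> \<le> B" "\<And>x s t. \<bar>u (\<phi> s x) - u (\<phi> t x)\<bar> \<le> B * \<bar>s - t\<bar>"
proof -
  have C1: "C1 u" using u by (simp add: C1c_iff)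
  obtain R where R: "R \<ge> 0" "\<And>x. norm x > R \<Longrightarrow> u x = 0" "\<And>x. norm x > R \<Longrightarrow> grad u x = 0"
    by (rule C1c_vanishing[OF u], rule that)
  have "continuous_on UNIV (\<lambda>x. F x \<bullet> grad u x)"
    using C1 by (intro continuous_intros F_continuous C1_continuous_grad)
  then obtain B where B: "B \<ge> 0" "\<And>x. \<bar>F x \<bullet> grad u x\<bar> \<le> B"
    by (rule vanishing_continuous_bounded[of "\<lambda>x. F x \<bullet> grad u x" R]) (simp_all add: R)
  have "\<bar>u (\<phi> s x) - u (\<phi> t x)\<bar> \<le> B * \<bar>s - t\<bar>" for x s t
    using field_differentiable_bound[of UNIV "\<lambda>s. u (\<phi> s x)" "\<lambda>s. F (\<phi> s x) \<bullet> grad u (\<phi> s x)" B s t]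
      C1c_flow_deriv[OF u] B(2) by auto
  with B that show thesis by blast
qed

end

text \<open>Weak enough to admit the constant weight 1 besides \<open>\<rho>\<close> and
  \<open>d\<close>, so that Lebesgue measure can be transported by the same estimate as
  \<open>P\<close>.\<close>

definition locally_integrable :: "('a::euclidean_space \<Rightarrow> real) \<Rightarrow> bool" where
  "locally_integrable r \<longleftrightarrow> r \<in> borel_measurable lebesgue \<and>
     (\<forall>R. integrable lebesgue (\<lambda>x. r x * indicator (cball 0 R) x))"

lemma locally_integrable_bounded_support:
  assumes r: "locally_integrable r" and w: "w \<in> borel_measurable lebesgue"
    and B: "\<And>x. \<bar>w x\<bar> \<le> B" and R: "\<And>x. norm x > R \<Longrightarrow> w x = 0"
  shows "integrable lebesgue (\<lambda>x. r x * w x)"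
proof (rule Bochner_Integration.integrable_bound)
  show "integrable lebesgue (\<lambda>x. B * (r x * indicator (cball 0 R) x))"
    using r by (intro integrable_mult_right) (auto simp: locally_integrable_def)
  show "(\<lambda>x. r x * w x) \<in> borel_measurable lebesgue"
    using r w by (auto simp: locally_integrable_def)
  show "AE x in lebesgue. norm (r x * w x) \<le> norm (B * (r x * indicator (cball 0 R) x))"
  proof (rule AE_I2)
    fix x
    show "norm (r x * w x) \<le> norm (B * (r x * indicator (cball 0 R) x))"
    proof (cases "norm x \<le> R")
      case True
      have "\<bar>r x\<bar> * \<bar>w x\<bar> \<le> \<bar>r x\<bar> * \<bar>B\<bar>" using B[of x] by (intro mult_left_mono) auto
      then show ?thesis using True by (simp add: abs_mult mult.commute)
    qed (use R[of x] in auto)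
  qed
qed

lemma integrable_imp_locally_integrable:
  fixes r :: "'a::euclidean_space \<Rightarrow> real"
  assumes "integrable lebesgue r"
  shows "locally_integrable r"
  unfolding locally_integrable_def
proof (intro conjI allI)
  show "r \<in> borel_measurable lebesgue" using assms by auto
  show "integrable lebesgue (\<lambda>x. r x * indicator (cball 0 R) x)" for R
  proof (rule Bochner_Integration.integrable_bound[OF assms])
    have "cball (0::'a) R \<in> sets lebesgue" by simp
    then show "(\<lambda>x. r x * indicator (cball 0 R) x) \<in> borel_measurable lebesgue"
      using assms by measurable
  qed (auto simp: indicator_def)
qed

section \<open>Growth of weighted integrals along the flow\<close>

context c1_flow_vec
begin

text \<open>The equation \<open>div (r F) = q\<close> in weak form. The weight is kept apart from
  the field because the field stays fixed while the weight varies.\<close>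

definition loc_weak_div :: "(real^'n \<Rightarrow> real) \<Rightarrow> (real^'n \<Rightarrow> real) \<Rightarrow> bool" where
  "loc_weak_div r q \<longleftrightarrow> locally_integrable r \<and> locally_integrable q \<and>
     (\<forall>\<psi>. C1c \<psi> \<longrightarrow> (\<integral>x. r x * (F x \<bullet> grad \<psi> x) \<partial>lebesgue) = - (\<integral>x. q x * \<psi> x \<partial>lebesgue))"

lemma flow_measurable_compose:
  "f \<in> borel_measurable lebesgue \<Longrightarrow> (\<lambda>x. f (\<phi> t x)) \<in> borel_measurable lebesgue"
  by (rule measurable_compose[OF flow_measurable])

lemma F_grad_measurable:
  assumes "C1c u"
  shows "(\<lambda>x. F x \<bullet> grad u x) \<in> borel_measurable lebesgue"
  using assms unfolding C1c_iff
  by (intro continuous_borel_measurable_lebesgue continuous_intros F_continuous C1_continuous_grad) auto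

lemma C1c_flow_integrable:
  assumes r: "locally_integrable r" and u: "C1c u"
  shows "integrable lebesgue (\<lambda>x. r x * u (\<phi> s x))"
proof -
  have us: "C1c (\<lambda>x. u (\<phi> s x))" by (rule C1c_flow[OF u])
  obtain S where S: "S \<ge> 0" "\<And>x. norm x > S \<Longrightarrow> u (\<phi> s x) = 0" "\<And>x. norm x > S \<Longrightarrow> grad (\<lambda>x. u (\<phi> s x)) x = 0"
    by (rule C1c_vanishing[OF us], rule that)
  obtain C where C: "C \<ge> 0" "\<And>x. \<bar>u (\<phi> s x)\<bar> \<le> C" by (rule C1c_bounded[OF us], rule that)
  show ?thesis by (rule locally_integrable_bounded_support[OF r C1c_measurable[OF us] C(2) S(2)])
qed

text \<open>Along the flow, \<open>u \<circ> \<phi> t\<close> has time derivative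
  \<open>F \<bullet> grad (u \<circ> \<phi> t)\<close> by \<open>C1c_flow\<close>. As
  \<open>u \<circ> \<phi> t\<close> is itself a test function, the weak divergence evaluates the
  resulting integral.\<close>

lemma transport_deriv:
  assumes rq: "loc_weak_div r q" and u: "C1c u"
  shows "((\<lambda>t. \<integral>x. r x * u (\<phi> t x) \<partial>lebesgue) has_real_derivative
           - (\<integral>x. q x * u (\<phi> t x) \<partial>lebesgue)) (at t)"
proof -
  have r: "locally_integrable r" using rq by (simp add: loc_weak_div_def)
  have rm: "r \<in> borel_measurable lebesgue" using r by (simp add: locally_integrable_def)
  obtain R where R: "R \<ge> 0" "\<And>x. norm x > R \<Longrightarrow> u x = 0" "\<And>x. norm x > R \<Longrightarrow> grad u x = 0"
    by (rule C1c_vanishing[OF u], rule that)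
  \<comment> \<open>The margin 1 covers all times \<open>t + h\<close> with
    \<open>\<bar>h\<bar> < 1\<close> at which the difference quotient is dominated.\<close>
  obtain R' where R': "R' \<ge> 0" "\<And>s x. \<bar>s\<bar> \<le> \<bar>t\<bar> + 1 \<Longrightarrow> norm (\<phi> s x) \<le> R \<Longrightarrow> norm x \<le> R'"
    by (rule flow_bounded[of "\<bar>t\<bar> + 1" R], rule that)
  obtain B where B: "B \<ge> 0" "\<And>x. \<bar>F x \<bullet> grad u x\<bar> \<le> B"
    "\<And>x s t. \<bar>u (\<phi> s x) - u (\<phi> t x)\<bar> \<le> B * \<bar>s - t\<bar>"
    by (rule C1c_flow_lipschitz[OF u], rule that)
  note int = C1c_flow_integrable[OF r u]
  have um: "u \<in> borel_measurable lebesgue" by (rule C1c_measurable[OF u])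
  have "((\<lambda>h. \<integral>x. r x * ((u (\<phi> (t + h) x) - u (\<phi> t x)) / h) \<partial>lebesgue) \<longlongrightarrow>
         (\<integral>x. r x * (F (\<phi> t x) \<bullet> grad u (\<phi> t x)) \<partial>lebesgue)) (at 0)"
  proof (rule integral_dominated_convergence_at)
    show "(\<lambda>x. r x * (F (\<phi> t x) \<bullet> grad u (\<phi> t x))) \<in> borel_measurable lebesgue"
      by (intro borel_measurable_times rm flow_measurable_compose[OF F_grad_measurable[OF u]])
    show "(\<lambda>x. r x * ((u (\<phi> (t + h) x) - u (\<phi> t x)) / h)) \<in> borel_measurable lebesgue" for h
      by (intro borel_measurable_times borel_measurable_divide borel_measurable_diff
          rm borel_measurable_const flow_measurable_compose um)
    have "integrable lebesgue (\<lambda>x. \<bar>r x * indicator (cball 0 R') x\<bar>)"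
      using r by (intro integrable_abs) (auto simp: locally_integrable_def)
    then show "integrable lebesgue (\<lambda>x. B * \<bar>r x * indicator (cball 0 R') x\<bar>)"
      by (rule integrable_mult_right)
    show "AE x in lebesgue. ((\<lambda>h. r x * ((u (\<phi> (t + h) x) - u (\<phi> t x)) / h)) \<longlongrightarrow>
        r x * (F (\<phi> t x) \<bullet> grad u (\<phi> t x))) (at 0)"
      by (intro AE_I2 tendsto_mult_left C1c_flow_deriv[OF u, unfolded DERIV_def])
    show "AE x in lebesgue. \<bar>r x * ((u (\<phi> (t + h) x) - u (\<phi> t x)) / h)\<bar> \<le> B * \<bar>r x * indicator (cball 0 R') x\<bar>"
      if h: "h \<noteq> 0" "\<bar>h - 0\<bar> < 1" for h
    proof (rule AE_I2)
      fix x
      show "\<bar>r x * ((u (\<phi> (t + h) x) - u (\<phi> t x)) / h)\<bar> \<le> B * \<bar>r x * indicator (cball 0 R') x\<bar>"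
      proof (cases "norm x \<le> R'")
        case True
        have "\<bar>(u (\<phi> (t + h) x) - u (\<phi> t x)) / h\<bar> \<le> B"
          using B(3)[of "t + h" x t] h by (simp add: divide_le_eq)
        then have "\<bar>r x\<bar> * \<bar>(u (\<phi> (t + h) x) - u (\<phi> t x)) / h\<bar> \<le> \<bar>r x\<bar> * B" by (intro mult_left_mono) auto
        then show ?thesis using True by (simp add: abs_mult mult.commute)
      next
        case False
        have "\<bar>t + h\<bar> \<le> \<bar>t\<bar> + 1" using h(2) by linarith
        then have "norm (\<phi> (t + h) x) > R" using R'(2)[of "t + h" x] False by linarith
        moreover have "norm (\<phi> t x) > R" using R'(2)[of t x] False by linarith
        ultimately show ?thesis using R(2) B(1) by simp
      qed
    qed
  qed
  moreover have "(\<integral>x. r x * ((u (\<phi> (t + h) x) - u (\<phi> t x)) / h) \<partial>lebesgue) =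
     ((\<integral>x. r x * u (\<phi> (t + h) x) \<partial>lebesgue) - (\<integral>x. r x * u (\<phi> t x) \<partial>lebesgue)) / h" for h
  proof -
    have "(\<integral>x. r x * ((u (\<phi> (t + h) x) - u (\<phi> t x)) / h) \<partial>lebesgue) =
      (\<integral>x. (r x * u (\<phi> (t + h) x) - r x * u (\<phi> t x)) / h \<partial>lebesgue)"
      by (simp add: right_diff_distrib)
    then show ?thesis using int by simp
  qed
  moreover have "(\<integral>x. r x * (F (\<phi> t x) \<bullet> grad u (\<phi> t x)) \<partial>lebesgue) = - (\<integral>x. q x * u (\<phi> t x) \<partial>lebesgue)"
  proof -
    have "(\<integral>x. r x * (F x \<bullet> grad (\<lambda>x. u (\<phi> t x)) x) \<partial>lebesgue) = - (\<integral>x. q x * u (\<phi> t x) \<partial>lebesgue)"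
      using rq C1c_flow(1)[OF u, of t] unfolding loc_weak_div_def by blast
    then show ?thesis by (simp only: C1c_flow(2)[OF u])
  qed
  ultimately show ?thesis unfolding DERIV_def by (simp only:)
qed

lemma transport_bound_C1c:
  assumes rq: "loc_weak_div r q" and c: "AE x in lebesgue. \<bar>q x\<bar> \<le> c * r x"
    and u: "C1c u" "\<And>x. u x \<ge> 0"
  shows "(\<integral>x. r x * u (\<phi> t x) \<partial>lebesgue) \<le> exp (c * \<bar>t\<bar>) * (\<integral>x. r x * u x \<partial>lebesgue)"
proof -
  have r: "locally_integrable r" and q: "locally_integrable q" using rq by (simp_all add: loc_weak_div_def)
  have "\<bar>- (\<integral>x. q x * u (\<phi> s x) \<partial>lebesgue)\<bar> \<le> c * (\<integral>x. r x * u (\<phi> s x) \<partial>lebesgue)" for s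
  proof -
    have "\<bar>- (\<integral>x. q x * u (\<phi> s x) \<partial>lebesgue)\<bar> \<le> (\<integral>x. \<bar>q x * u (\<phi> s x)\<bar> \<partial>lebesgue)" by simp
    also have "\<dots> \<le> (\<integral>x. c * (r x * u (\<phi> s x)) \<partial>lebesgue)"
    proof (rule integral_mono_AE)
      show "integrable lebesgue (\<lambda>x. \<bar>q x * u (\<phi> s x)\<bar>)"
        by (intro integrable_abs C1c_flow_integrable q u)
      show "integrable lebesgue (\<lambda>x. c * (r x * u (\<phi> s x)))"
        by (intro integrable_mult_right C1c_flow_integrable r u)
      show "AE x in lebesgue. \<bar>q x * u (\<phi> s x)\<bar> \<le> c * (r x * u (\<phi> s x))"
        using c
      proof eventually_elim
        case (elim x)
        then have "\<bar>q x\<bar> * u (\<phi> s x) \<le> c * r x * u (\<phi> s x)" using u(2) by (intro mult_right_mono) auto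
        then show ?case using u(2) by (simp add: abs_mult mult.assoc)
      qed
    qed
    finally show ?thesis by simp
  qed
  from gronwall_abs[OF transport_deriv[OF rq u(1)] this, of t] show ?thesis by (simp add: flow0)
qed

lemma transport_bound_bounded_support:
  assumes rq: "loc_weak_div r q" and c: "AE x in lebesgue. \<bar>q x\<bar> \<le> c * r x"
    and f: "f \<in> borel_measurable lebesgue" "\<And>x. 0 \<le> f x" "\<And>x. f x \<le> B" "\<And>x. norm x > R \<Longrightarrow> f x = 0"
    and R0: "R \<ge> 0"
  shows "integrable lebesgue (\<lambda>x. r x * f (\<phi> t x))"
    and "(\<integral>x. r x * f (\<phi> t x) \<partial>lebesgue) \<le> exp (c * \<bar>t\<bar>) * (\<integral>x. r x * f x \<partial>lebesgue)"
proof -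
  have r: "locally_integrable r" using rq by (simp add: loc_weak_div_def)
  have rm: "r \<in> borel_measurable lebesgue" using r by (simp add: locally_integrable_def)
  obtain R' where R': "R' \<ge> 0" "\<And>s x. \<bar>s\<bar> \<le> \<bar>t\<bar> \<Longrightarrow> norm (\<phi> s x) \<le> R + 1 \<Longrightarrow> norm x \<le> R'"
    by (rule flow_bounded[of "\<bar>t\<bar>" "R + 1"], rule that)
  show "integrable lebesgue (\<lambda>x. r x * f (\<phi> t x))"
  proof (rule locally_integrable_bounded_support[OF r flow_measurable_compose[OF f(1)]])
    show "\<bar>f (\<phi> t x)\<bar> \<le> B" for x using f(2,3)[of "\<phi> t x"] by simp
    show "f (\<phi> t x) = 0" if "norm x > R'" for x
      using R'(2)[of t x] that f(4)[of "\<phi> t x"] by force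
  qed
  \<comment> \<open>The Gronwall step requires nonnegative test functions, and the positive part of
    a \<open>C1\<close> function may fail to be \<open>C1\<close>. Approximating the root of
    \<open>f\<close> and squaring gives the sign and keeps the derivative.\<close>
  have "\<bar>sqrt (f x)\<bar> \<le> sqrt B" for x using f(2,3) by simp
  then obtain v where v: "\<And>k::nat. C1c (v k)" "\<And>k x. \<bar>v k x\<bar> \<le> sqrt B + 1"
    "AE x in lebesgue. (\<lambda>k. v k x) \<longlonglongrightarrow> sqrt (f x)"
    using bounded_measurable_approx_C1c[of "\<lambda>x. sqrt (f x)" "sqrt B"] f(1) by auto
  \<comment> \<open>The cut-off confines all approximants to the ball of radius
    \<open>R + 1\<close>, for which \<open>R'\<close> was chosen, and equals 1 wherever
    \<open>f\<close> can be nonzero, so the limit is unchanged.\<close>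
  obtain \<eta> :: "real^'n \<Rightarrow> real" where \<eta>: "C1c \<eta>" "\<And>x. 0 \<le> \<eta> x" "\<And>x. \<eta> x \<le> 1"
    "\<And>x. norm x \<le> R \<Longrightarrow> \<eta> x = 1" "\<And>x. norm x > R + 1 \<Longrightarrow> \<eta> x = 0"
    by (rule C1c_cutoff[OF R0], rule that)
  define u where "u k x = (\<eta> x * v k x) * (\<eta> x * v k x)" for k x
  have uC: "C1c (u k)" for k
    unfolding u_def using v(1)[of k] \<eta>(1) by (intro C1c_mult C1_mult) (auto simp: C1c_iff)
  have u0: "u k x \<ge> 0" for k x by (simp add: u_def)
  have uB: "\<bar>u k x\<bar> \<le> (sqrt B + 1)\<^sup>2" for k x
  proof -
    have "\<bar>\<eta> x * v k x\<bar> \<le> 1 * (sqrt B + 1)" unfolding abs_mult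
      using \<eta>(2,3)[of x] v(2)[of k x] by (intro mult_mono) auto
    then have "\<bar>\<eta> x * v k x\<bar>\<^sup>2 \<le> (sqrt B + 1)\<^sup>2" by (intro power_mono) auto
    then show ?thesis by (simp add: u_def power2_eq_square)
  qed
  have uz: "u k x = 0" if "norm x > R + 1" for k x using \<eta>(5)[OF that] by (simp add: u_def)
  have ulim: "AE x in lebesgue. (\<lambda>k. u k x) \<longlonglongrightarrow> f x"
    using v(3)
  proof eventually_elim
    case (elim x)
    have "(\<lambda>k. u k x) \<longlonglongrightarrow> (\<eta> x * sqrt (f x)) * (\<eta> x * sqrt (f x))"
      unfolding u_def by (intro tendsto_intros elim)
    moreover have "(\<eta> x * sqrt (f x)) * (\<eta> x * sqrt (f x)) = f x"
      using \<eta>(4)[of x] f(2)[of x] f(4)[of x] by (cases "norm x \<le> R") auto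
    ultimately show ?case by simp
  qed
  have dom: "(\<lambda>k. \<integral>x. r x * u k (\<phi> s x) \<partial>lebesgue) \<longlonglongrightarrow> (\<integral>x. r x * f (\<phi> s x) \<partial>lebesgue)"
    if s: "\<bar>s\<bar> \<le> \<bar>t\<bar>" for s
  proof (rule integral_dominated_convergence)
    show "(\<lambda>x. r x * f (\<phi> s x)) \<in> borel_measurable lebesgue"
      by (intro borel_measurable_times rm flow_measurable_compose f)
    show "(\<lambda>x. r x * u k (\<phi> s x)) \<in> borel_measurable lebesgue" for k
      by (intro borel_measurable_times rm flow_measurable_compose C1c_measurable uC)
    have "integrable lebesgue (\<lambda>x. \<bar>r x * indicator (cball 0 R') x\<bar>)"
      using r by (intro integrable_abs) (auto simp: locally_integrable_def)
    then show "integrable lebesgue (\<lambda>x. (sqrt B + 1)\<^sup>2 * \<bar>r x * indicator (cball 0 R') x\<bar>)"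
      by (rule integrable_mult_right)
    \<comment> \<open>The exceptional set of the approximation stays null after composition, because
      the flow pulls Lebesgue null sets back to null sets.\<close>
    show "AE x in lebesgue. (\<lambda>k. r x * u k (\<phi> s x)) \<longlonglongrightarrow> r x * f (\<phi> s x)"
      using flow_AE[OF ulim, of s] by eventually_elim (intro tendsto_intros)
    show "AE x in lebesgue. norm (r x * u k (\<phi> s x)) \<le> (sqrt B + 1)\<^sup>2 * \<bar>r x * indicator (cball 0 R') x\<bar>" for k
    proof (rule AE_I2)
      fix x
      show "norm (r x * u k (\<phi> s x)) \<le> (sqrt B + 1)\<^sup>2 * \<bar>r x * indicator (cball 0 R') x\<bar>"
      proof (cases "norm x \<le> R'")
        case True
        then show ?thesis using mult_left_mono[OF uB[of k "\<phi> s x"], of "\<bar>r x\<bar>"]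
          by (simp add: abs_mult mult.commute)
      next
        case False
        then have "norm (\<phi> s x) > R + 1" using R'(2)[OF s, of x] by force
        then show ?thesis using uz by simp
      qed
    qed
  qed
  show "(\<integral>x. r x * f (\<phi> t x) \<partial>lebesgue) \<le> exp (c * \<bar>t\<bar>) * (\<integral>x. r x * f x \<partial>lebesgue)"
  proof (rule LIMSEQ_le)
    show "(\<lambda>k. \<integral>x. r x * u k (\<phi> t x) \<partial>lebesgue) \<longlonglongrightarrow> (\<integral>x. r x * f (\<phi> t x) \<partial>lebesgue)"
      by (rule dom) simp
    show "(\<lambda>k. exp (c * \<bar>t\<bar>) * (\<integral>x. r x * u k x \<partial>lebesgue)) \<longlonglongrightarrow> exp (c * \<bar>t\<bar>) * (\<integral>x. r x * f x \<partial>lebesgue)"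
      using dom[of 0] by (intro tendsto_intros) (simp add: flow0)
    show "\<exists>N. \<forall>n\<ge>N. (\<integral>x. r x * u n (\<phi> t x) \<partial>lebesgue) \<le> exp (c * \<bar>t\<bar>) * (\<integral>x. r x * u n x \<partial>lebesgue)"
      using transport_bound_C1c[OF rq c uC u0] by blast
  qed
qed

text \<open>Cutting \<open>f\<close> in height and in space at level \<open>n\<close> leads to the
  bounded case, and monotone convergence removes the cut. Integrals with values in
  \<open>ennreal\<close> allow \<open>f\<close> to have infinite integral.\<close>

lemma transport_bound:
  assumes rq: "loc_weak_div r q" and c: "AE x in lebesgue. \<bar>q x\<bar> \<le> c * r x"
    and r0: "\<And>x. r x \<ge> 0"
    and f: "f \<in> borel_measurable lebesgue" "\<And>x. 0 \<le> f x"
  shows "(\<integral>\<^sup>+x. ennreal (r x * f (\<phi> t x)) \<partial>lebesgue)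
      \<le> ennreal (exp (c * \<bar>t\<bar>)) * (\<integral>\<^sup>+x. ennreal (r x * f x) \<partial>lebesgue)"
proof -
  have r: "locally_integrable r" using rq by (simp add: loc_weak_div_def)
  have rm: "r \<in> borel_measurable lebesgue" using r by (simp add: locally_integrable_def)
  define g where "g n x = indicator (cball 0 (real n)) x * min (f x) (real n)" for n :: nat and x :: "real^'n"
  have gm: "g n \<in> borel_measurable lebesgue" for n
  proof -
    have "cball (0::real^'n) (real n) \<in> sets lebesgue" by simp
    then show ?thesis unfolding g_def using f(1) by measurable
  qed
  have g0: "0 \<le> g n x" for n x using f(2) by (simp add: g_def)
  have gn: "g n x \<le> real n" for n x by (simp add: g_def indicator_def)
  have gf: "g n x \<le> f x" for n x using f(2) by (simp add: g_def indicator_def)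
  have gz: "g n x = 0" if "norm x > real n" for n x using that by (simp add: g_def)
  have ginc: "g m x \<le> g n x" if "m \<le> n" for m n x
    using that f(2)[of x] by (auto simp: g_def indicator_def)
  have glim: "(\<lambda>n. g n x) \<longlonglongrightarrow> f x" for x
  proof -
    obtain N where N: "max (norm x) (f x) \<le> real N" using real_arch_simple by blast
    have "eventually (\<lambda>n. g n x = f x) sequentially"
      using eventually_ge_at_top[of N]
    proof eventually_elim
      case (elim n)
      then have "max (norm x) (f x) \<le> real n" using N by linarith
      then show ?case by (simp add: g_def)
    qed
    then show ?thesis by (rule tendsto_eventually)
  qed
  have each: "(\<integral>\<^sup>+x. ennreal (r x * g n (\<phi> t x)) \<partial>lebesgue)
      \<le> ennreal (exp (c * \<bar>t\<bar>)) * (\<integral>\<^sup>+x. ennreal (r x * f x) \<partial>lebesgue)" for n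
  proof -
    note b = transport_bound_bounded_support[OF rq c gm g0 gn gz of_nat_0_le_iff, where t=t]
    note b0 = transport_bound_bounded_support(1)[OF rq c gm g0 gn gz of_nat_0_le_iff, where t=0]
    have "(\<integral>\<^sup>+x. ennreal (r x * g n (\<phi> t x)) \<partial>lebesgue) = ennreal (\<integral>x. r x * g n (\<phi> t x) \<partial>lebesgue)"
      using b(1) r0 g0 by (intro nn_integral_eq_integral) auto
    also have "\<dots> \<le> ennreal (exp (c * \<bar>t\<bar>) * (\<integral>x. r x * g n x \<partial>lebesgue))"
      using b(2) by (intro ennreal_leI) auto
    also have "\<dots> = ennreal (exp (c * \<bar>t\<bar>)) * ennreal (\<integral>x. r x * g n x \<partial>lebesgue)"
      using r0 g0 by (intro ennreal_mult integral_nonneg_AE) auto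
    also have "ennreal (\<integral>x. r x * g n x \<partial>lebesgue) = (\<integral>\<^sup>+x. ennreal (r x * g n x) \<partial>lebesgue)"
      using b0 r0 g0 by (intro nn_integral_eq_integral[symmetric]) (auto simp: flow0)
    also have "\<dots> \<le> (\<integral>\<^sup>+x. ennreal (r x * f x) \<partial>lebesgue)"
      using gf r0 by (intro nn_integral_mono ennreal_leI mult_left_mono) auto
    finally show ?thesis by (simp add: mult_left_mono)
  qed
  have "(\<lambda>n. \<integral>\<^sup>+x. ennreal (r x * g n (\<phi> t x)) \<partial>lebesgue) \<longlonglongrightarrow> (\<integral>\<^sup>+x. ennreal (r x * f (\<phi> t x)) \<partial>lebesgue)"
  proof (rule nn_integral_LIMSEQ)
    show "incseq (\<lambda>n x. ennreal (r x * g n (\<phi> t x)))"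
      using ginc r0 by (auto simp: incseq_def le_fun_def intro!: ennreal_leI mult_left_mono)
    show "(\<lambda>x. ennreal (r x * g n (\<phi> t x))) \<in> borel_measurable lebesgue" for n
      by (intro measurable_compose[OF _ measurable_ennreal] borel_measurable_times rm flow_measurable_compose gm)
    show "(\<lambda>n. ennreal (r x * g n (\<phi> t x))) \<longlonglongrightarrow> ennreal (r x * f (\<phi> t x))" for x
      by (intro tendsto_ennrealI tendsto_intros glim)
  qed
  then show ?thesis using each by (intro LIMSEQ_le_const2) auto
qed

section \<open>Lebesgue measure under the flow\<close>

definition divF :: "real^'n \<Rightarrow> real" where
  "divF x = (\<Sum>i\<in>UNIV. blinfun_apply (F' x) (axis i 1) $ i)"

lemma divF_bound: "\<bar>divF x\<bar> \<le> real CARD('n) * L"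
proof -
  have "\<bar>divF x\<bar> \<le> (\<Sum>i\<in>(UNIV::'n set). L)"
    unfolding divF_def
  proof (rule sum_abs[THEN order_trans], rule sum_mono)
    fix i :: 'n
    have "\<bar>F' x (axis i 1) $ i\<bar> \<le> norm (F' x (axis i 1))" by (rule component_le_norm_cart)
    also have "\<dots> \<le> norm (F' x) * norm (axis i (1::real) :: real^'n)" by (rule norm_blinfun)
    finally show "\<bar>F' x (axis i 1) $ i\<bar> \<le> L" using F'_bound[of x] by simp
  qed
  then show ?thesis by simp
qed

lemma divF_continuous: "continuous_on UNIV divF"
  unfolding divF_def
  by (intro continuous_intros continuous_on_component F'_cont)

lemma C1_F_component:
  "C1 (\<lambda>x. F x $ i)" "grad (\<lambda>x. F x $ i) = (\<lambda>x. \<chi> j. F' x (axis j 1) $ i)"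
proof -
  have d: "((\<lambda>x. F x $ i) has_derivative (\<lambda>h. F' x h $ i)) (at x)" for x
    by (rule bounded_linear.has_derivative[OF bounded_linear_vec_nth F_deriv])
  then have d': "((\<lambda>x. F x $ i) has_derivative (\<lambda>h. grad (\<lambda>x. F x $ i) x \<bullet> h)) (at x)" for x
    by (intro has_derivative_grad) (auto simp: differentiable_def)
  have "grad (\<lambda>x. F x $ i) x \<bullet> h = F' x h $ i" for x h
    using has_derivative_unique[OF d d'] by metis
  from this[of _ "axis _ 1"] show g: "grad (\<lambda>x. F x $ i) = (\<lambda>x. \<chi> j. F' x (axis j 1) $ i)"
    by (auto simp: fun_eq_iff vec_eq_iff inner_axis)
  have "continuous_on UNIV (\<lambda>x. \<chi> j. F' x (axis j 1) $ i)"
    by (intro continuous_intros continuous_on_component F'_cont)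
  with d' show "C1 (\<lambda>x. F x $ i)" by (simp add: C1_def g)
qed

text \<open>By the product rule \<open>F \<bullet> grad \<psi> + divF * \<psi>\<close> is the sum of
  the \<open>i\<close>-th derivatives of the test functions \<open>\<psi> * F $ i\<close>, and each
  of these integrates to 0.\<close>

lemma loc_weak_div_lebesgue: "loc_weak_div (\<lambda>x. 1) divF"
  unfolding loc_weak_div_def
proof (intro conjI allI impI)
  have lm: "integrable lebesgue (indicator (cball 0 R) :: real^'n \<Rightarrow> real)" for R
    by (intro integrable_real_indicator) (auto intro: emeasure_lborel_cball_finite[unfolded infinity_ennreal_def] simp: infinity_ennreal_def)
  then show 1: "locally_integrable (\<lambda>x::real^'n. 1)"
    by (simp add: locally_integrable_def)
  have dm: "divF \<in> borel_measurable lebesgue" by (rule continuous_borel_measurable_lebesgue[OF divF_continuous])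
  show 2: "locally_integrable divF"
    unfolding locally_integrable_def
  proof (intro conjI allI dm)
    fix R
    have "cball (0::real^'n) R \<in> sets lebesgue" by simp
    then have m: "(\<lambda>x. divF x * indicator (cball 0 R) x) \<in> borel_measurable lebesgue" using dm by measurable
    have "integrable lebesgue (\<lambda>x::real^'n. (real CARD('n) * L) * indicator (cball 0 R) x)"
      by (intro integrable_mult_right lm)
    then show "integrable lebesgue (\<lambda>x. divF x * indicator (cball 0 R) x)"
    proof (rule Bochner_Integration.integrable_bound[OF _ m])
      show "AE x in lebesgue. norm (divF x * indicator (cball 0 R) x) \<le> norm ((real CARD('n) * L) * indicator (cball 0 R) x)"
        using divF_bound L_nonneg by (intro AE_I2) (auto simp: indicator_def)
    qed
  qed
  fix \<psi> :: "real^'n \<Rightarrow> real" assume p: "C1c \<psi>"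
  then have C1: "C1 \<psi>" by (simp add: C1c_iff)
  have comp: "C1c (\<lambda>x. \<psi> x * F x $ i)" for i by (rule C1c_mult[OF p C1_F_component(1)])
  have eq: "(\<Sum>i\<in>UNIV. grad (\<lambda>x. \<psi> x * F x $ i) x $ i) = 1 * (F x \<bullet> grad \<psi> x) + divF x * \<psi> x" for x
    by (simp add: C1_mult(2)[OF C1 C1_F_component(1)] C1_F_component(2) divF_def inner_vec_def
        sum.distrib sum_distrib_left mult_ac)
  have int1: "integrable lebesgue (\<lambda>x. 1 * (F x \<bullet> grad \<psi> x))"
  proof -
    obtain R where R: "R \<ge> 0" "\<And>x. norm x > R \<Longrightarrow> \<psi> x = 0" "\<And>x. norm x > R \<Longrightarrow> grad \<psi> x = 0"
      by (rule C1c_vanishing[OF p], rule that)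
    obtain B where B: "B \<ge> 0" "\<And>x. \<bar>F x \<bullet> grad \<psi> x\<bar> \<le> B"
      "\<And>x s t. \<bar>\<psi> (\<phi> s x) - \<psi> (\<phi> t x)\<bar> \<le> B * \<bar>s - t\<bar>"
      by (rule C1c_flow_lipschitz[OF p], rule that)
    show ?thesis
      by (rule locally_integrable_bounded_support[OF 1 F_grad_measurable[OF p] B(2), of R]) (simp add: R)
  qed
  have int2: "integrable lebesgue (\<lambda>x. divF x * \<psi> x)"
    using C1c_flow_integrable[OF 2 p, of 0] by (simp add: flow0)
  have "integrable lebesgue (\<lambda>x. grad (\<lambda>x. \<psi> x * F x $ i) x $ i)" for i
  proof -
    obtain R where R: "R \<ge> 0" "\<And>x. norm x > R \<Longrightarrow> \<psi> x * F x $ i = 0" "\<And>x. norm x > R \<Longrightarrow> grad (\<lambda>x. \<psi> x * F x $ i) x = 0"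
      by (rule C1c_vanishing[OF comp], rule that)
    have cg: "continuous_on UNIV (\<lambda>x. grad (\<lambda>x. \<psi> x * F x $ i) x $ i)"
      using comp[of i] by (intro continuous_on_component C1_continuous_grad) (auto simp: C1c_iff)
    obtain B where B: "B \<ge> 0" "\<And>x. norm (grad (\<lambda>x. \<psi> x * F x $ i) x $ i) \<le> B"
      by (rule vanishing_continuous_bounded[OF cg, of R]) (simp_all add: R)
    have "integrable lebesgue (\<lambda>x. 1 * grad (\<lambda>x. \<psi> x * F x $ i) x $ i)"
      by (rule locally_integrable_bounded_support[OF 1 continuous_borel_measurable_lebesgue[OF cg], of B R])
        (use B R in auto)
    then show ?thesis by simp
  qed
  then have "(\<integral>x. (\<Sum>i\<in>UNIV. grad (\<lambda>x. \<psi> x * F x $ i) x $ i) \<partial>lebesgue) = 0"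
    by (simp add: integral_grad_component_eq_0[OF comp])
  then have "(\<integral>x. 1 * (F x \<bullet> grad \<psi> x) \<partial>lebesgue) + (\<integral>x. divF x * \<psi> x \<partial>lebesgue) = 0"
    unfolding eq using int1 int2 by (simp del: mult_1)
  then show "(\<integral>x. 1 * (F x \<bullet> grad \<psi> x) \<partial>lebesgue) = - (\<integral>x. divF x * \<psi> x \<partial>lebesgue)" by linarith
qed

end

text \<open>For a weight that is integrable but possibly unbounded, closeness of two functions in
  \<open>L1\<close> does not control their weighted difference. Splitting at height \<open>K\<close>
  leaves a bounded weight and a tail of small integral; dominated convergence makes the tail
  small.\<close>

lemma L1_tail_small:
  fixes d :: "'a \<Rightarrow> real"
  assumes d: "integrable M d" and e: "e > 0"
  obtains K where "K > 0" "(\<integral>x. \<bar>d x\<bar> * indicator {x. \<bar>d x\<bar> > K} x \<partial>M) < e"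
    "integrable M (\<lambda>x. \<bar>d x\<bar> * indicator {x. \<bar>d x\<bar> > K} x)"
proof -
  have dm[measurable]: "d \<in> borel_measurable M" using d by auto
  have m: "(\<lambda>x. \<bar>d x\<bar> * indicator {x. \<bar>d x\<bar> > K} x) \<in> borel_measurable M" for K
  proof -
    have "(\<lambda>x. \<bar>d x\<bar> * indicator {x. \<bar>d x\<bar> > K} x) = (\<lambda>x. if \<bar>d x\<bar> > K then \<bar>d x\<bar> else 0)"
      by (auto simp: indicator_def)
    also have "\<dots> \<in> borel_measurable M" by measurable
    finally show ?thesis .
  qed
  have "(\<lambda>n. \<integral>x. \<bar>d x\<bar> * indicator {x. \<bar>d x\<bar> > real (Suc n)} x \<partial>M) \<longlonglongrightarrow> (\<integral>x. 0 \<partial>M)"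
  proof (rule integral_dominated_convergence[where w="\<lambda>x. \<bar>d x\<bar>"])
    show "AE x in M. (\<lambda>n. \<bar>d x\<bar> * indicator {x. \<bar>d x\<bar> > real (Suc n)} x) \<longlonglongrightarrow> 0"
    proof (rule AE_I2)
      fix x
      obtain N where N: "\<bar>d x\<bar> \<le> real N" using real_arch_simple by blast
      have "eventually (\<lambda>n. \<bar>d x\<bar> * indicator {x. \<bar>d x\<bar> > real (Suc n)} x = 0) sequentially"
        using eventually_ge_at_top[of N] by eventually_elim (use N in \<open>auto simp: indicator_def\<close>)
      then show "(\<lambda>n. \<bar>d x\<bar> * indicator {x. \<bar>d x\<bar> > real (Suc n)} x) \<longlonglongrightarrow> 0" by (rule tendsto_eventually)
    qed
  qed (use d m in \<open>auto simp: indicator_def\<close>)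
  then have "eventually (\<lambda>n. (\<integral>x. \<bar>d x\<bar> * indicator {x. \<bar>d x\<bar> > real (Suc n)} x \<partial>M) < e) sequentially"
    using e by (intro order_tendstoD) auto
  then obtain n where n: "(\<integral>x. \<bar>d x\<bar> * indicator {x. \<bar>d x\<bar> > real (Suc n)} x \<partial>M) < e"
    using eventually_happens'[OF sequentially_bot] by blast
  have "integrable M (\<lambda>x. \<bar>d x\<bar> * indicator {x. \<bar>d x\<bar> > real (Suc n)} x)"
    by (rule Bochner_Integration.integrable_bound[OF d m]) (auto simp: indicator_def)
  with n that[of "real (Suc n)"] show thesis by simp
qed

section \<open>The divergence on the zero set of the density\<close>

context c1_flow_vec
begin

text \<open>The transport estimate with weight 1: \<open>divF\<close> is bounded by
  \<open>real CARD('n) * L\<close>, so composition with the flow is bounded on \<open>L1\<close>,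
  uniformly for bounded times.\<close>

lemma lebesgue_transport:
  assumes "integrable lebesgue w"
  shows "integrable lebesgue (\<lambda>x. w (\<phi> t x))"
    and "(\<integral>x. \<bar>w (\<phi> t x)\<bar> \<partial>lebesgue) \<le> exp (real CARD('n) * L * \<bar>t\<bar>) * (\<integral>x. \<bar>w x\<bar> \<partial>lebesgue)"
proof -
  have wm: "w \<in> borel_measurable lebesgue" using assms by auto
  have "AE x in lebesgue. \<bar>divF x\<bar> \<le> (real CARD('n) * L) * 1" using divF_bound by simp
  from transport_bound[OF loc_weak_div_lebesgue this, of "\<lambda>x. \<bar>w x\<bar>" t] wm
  have le: "(\<integral>\<^sup>+x. ennreal \<bar>w (\<phi> t x)\<bar> \<partial>lebesgue) \<le>
      ennreal (exp (real CARD('n) * L * \<bar>t\<bar>)) * (\<integral>\<^sup>+x. ennreal \<bar>w x\<bar> \<partial>lebesgue)" by simp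
  have fin: "(\<integral>\<^sup>+x. ennreal \<bar>w x\<bar> \<partial>lebesgue) = ennreal (\<integral>x. \<bar>w x\<bar> \<partial>lebesgue)"
    using assms by (intro nn_integral_eq_integral) auto
  have wtm: "(\<lambda>x. w (\<phi> t x)) \<in> borel_measurable lebesgue" by (rule flow_measurable_compose[OF wm])
  show int: "integrable lebesgue (\<lambda>x. w (\<phi> t x))"
    unfolding integrable_iff_bounded
  proof (intro conjI wtm)
    have "(\<integral>\<^sup>+x. ennreal (norm (w (\<phi> t x))) \<partial>lebesgue) \<le>
      ennreal (exp (real CARD('n) * L * \<bar>t\<bar>)) * ennreal (\<integral>x. \<bar>w x\<bar> \<partial>lebesgue)"
      using le fin by simp
    also have "\<dots> < \<infinity>" by (simp add: ennreal_mult_less_top)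
    finally show "(\<integral>\<^sup>+x. ennreal (norm (w (\<phi> t x))) \<partial>lebesgue) < \<infinity>" .
  qed
  have "ennreal (\<integral>x. \<bar>w (\<phi> t x)\<bar> \<partial>lebesgue) = (\<integral>\<^sup>+x. ennreal \<bar>w (\<phi> t x)\<bar> \<partial>lebesgue)"
    using int by (intro nn_integral_eq_integral[symmetric]) auto
  also have "\<dots> \<le> ennreal (exp (real CARD('n) * L * \<bar>t\<bar>) * (\<integral>x. \<bar>w x\<bar> \<partial>lebesgue))"
    using le fin by (simp add: ennreal_mult)
  finally show "(\<integral>x. \<bar>w (\<phi> t x)\<bar> \<partial>lebesgue) \<le> exp (real CARD('n) * L * \<bar>t\<bar>) * (\<integral>x. \<bar>w x\<bar> \<partial>lebesgue)"
    by (subst (asm) ennreal_le_iff) auto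
qed

text \<open>For a bounded \<open>f\<close> that vanishes wherever \<open>\<rho>\<close> is positive, \<open>t \<mapsto> \<integral>\<rho> (f \<circ> \<phi> t)\<close> is non-negative with
  minimum 0 at \<open>t = 0\<close>, and its derivative there is \<open>- \<integral>d f\<close>.\<close>

lemma weak_div_vanishes_aux:
  assumes rd: "loc_weak_div \<rho> d" and ri: "integrable lebesgue \<rho>" and di: "integrable lebesgue d"
    and r0: "\<And>x. \<rho> x \<ge> 0"
    and f: "f \<in> borel_measurable lebesgue" "\<And>x. 0 \<le> f x" "\<And>x. f x \<le> 1" "\<And>x. norm x > R \<Longrightarrow> f x = 0"
    and R0: "R \<ge> 0" and rf: "\<And>x. \<rho> x * f x = 0"
  shows "(\<integral>x. d x * f x \<partial>lebesgue) = 0"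
proof -
  have dm: "d \<in> borel_measurable lebesgue" using di by auto
  \<comment> \<open>Bounds the growth of Lebesgue integrals under the flow for all times in
    \<open>[-1, 1]\<close>.\<close>
  define C where "C = exp (real CARD('n) * L)"
  have C1: "C \<ge> 1" using L_nonneg by (simp add: C_def)
  obtain v where v: "\<And>k::nat. C1c (v k)" "\<And>k x. \<bar>v k x\<bar> \<le> 1 + 1"
    "AE x in lebesgue. (\<lambda>k. v k x) \<longlonglongrightarrow> f x"
    by (rule bounded_measurable_approx_C1c[OF f(1), of 1]) (use f in auto)
  obtain \<eta> :: "real^'n \<Rightarrow> real" where \<eta>: "C1c \<eta>" "\<And>x. 0 \<le> \<eta> x" "\<And>x. \<eta> x \<le> 1"
    "\<And>x. norm x \<le> R \<Longrightarrow> \<eta> x = 1" "\<And>x. norm x > R + 1 \<Longrightarrow> \<eta> x = 0"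
    by (rule C1c_cutoff[OF R0], rule that)
  define u where "u k x = \<eta> x * v k x" for k x
  have uC: "C1c (u k)" for k
    unfolding u_def using v(1)[of k] \<eta>(1) by (intro C1c_mult) (auto simp: C1c_iff)
  have um: "u k \<in> borel_measurable lebesgue" for k by (rule C1c_measurable[OF uC])
  have uB: "\<bar>u k x\<bar> \<le> 2" for k x
  proof -
    have "\<bar>\<eta> x * v k x\<bar> \<le> 1 * 2" unfolding abs_mult
      using \<eta>(2,3)[of x] v(2)[of k x] by (intro mult_mono) auto
    then show ?thesis by (simp add: u_def)
  qed
  have uz: "u k x = 0" if "norm x > R + 1" for k x using \<eta>(5)[OF that] by (simp add: u_def)
  have ulim: "AE x in lebesgue. (\<lambda>k. u k x) \<longlonglongrightarrow> f x"
    using v(3)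
  proof eventually_elim
    case (elim x)
    have "(\<lambda>k. u k x) \<longlonglongrightarrow> \<eta> x * f x"
      unfolding u_def by (intro tendsto_intros elim)
    moreover have "\<eta> x * f x = f x" using \<eta>(4)[of x] f(4)[of x] by (cases "norm x \<le> R") auto
    ultimately show ?case by simp
  qed
  have ball: "integrable lebesgue (indicator (cball 0 (R + 1)) :: real^'n \<Rightarrow> real)"
    using loc_weak_div_lebesgue by (simp add: loc_weak_div_def locally_integrable_def)
  have uint: "integrable lebesgue (u k)" for k
  proof (rule Bochner_Integration.integrable_bound[OF integrable_mult_right[OF ball, of 2] um])
    show "AE x in lebesgue. norm (u k x) \<le> norm (2 * indicator (cball 0 (R + 1)) x :: real)"
      using uB[of k] uz by (intro AE_I2) (auto simp: indicator_def)
  qed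
  have L1: "(\<lambda>k. \<integral>x. \<bar>u k x - f x\<bar> \<partial>lebesgue) \<longlonglongrightarrow> (\<integral>x. 0 \<partial>(lebesgue :: (real^'n) measure))"
  proof (rule integral_dominated_convergence[OF _ _ integrable_mult_right[OF ball, of 3]])
    show "AE x in lebesgue. (\<lambda>k. \<bar>u k x - f x\<bar>) \<longlonglongrightarrow> 0"
      using ulim
    proof eventually_elim
      case (elim x)
      have "(\<lambda>k. \<bar>u k x - f x\<bar>) \<longlonglongrightarrow> \<bar>f x - f x\<bar>" by (intro tendsto_intros elim)
      then show ?case by simp
    qed
    show "AE x in lebesgue. norm \<bar>u k x - f x\<bar> \<le> 3 * indicator (cball 0 (R + 1)) x" for k
    proof (rule AE_I2)
      fix x
      show "norm \<bar>u k x - f x\<bar> \<le> 3 * indicator (cball 0 (R + 1)) x"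
        using uB[of k x] uz[of x k] f(2,3)[of x] f(4)[of x] by (auto simp: indicator_def)
    qed
  qed (use um f(1) in auto)
  have domlim: "(\<lambda>k. \<integral>x. p x * u k (\<phi> t x) \<partial>lebesgue) \<longlonglongrightarrow> (\<integral>x. p x * f (\<phi> t x) \<partial>lebesgue)"
    if p: "integrable lebesgue p" for p t
  proof (rule integral_dominated_convergence)
    have pm: "p \<in> borel_measurable lebesgue" using p by auto
    show "(\<lambda>x. p x * f (\<phi> t x)) \<in> borel_measurable lebesgue"
      by (intro borel_measurable_times pm flow_measurable_compose f)
    show "(\<lambda>x. p x * u k (\<phi> t x)) \<in> borel_measurable lebesgue" for k
      by (intro borel_measurable_times pm flow_measurable_compose um)
    show "integrable lebesgue (\<lambda>x. \<bar>p x\<bar> * 2)" using p by (intro integrable_mult_left integrable_abs)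
    show "AE x in lebesgue. (\<lambda>k. p x * u k (\<phi> t x)) \<longlonglongrightarrow> p x * f (\<phi> t x)"
      using flow_AE[OF ulim, of t] by eventually_elim (intro tendsto_intros)
    show "AE x in lebesgue. norm (p x * u k (\<phi> t x)) \<le> \<bar>p x\<bar> * 2" for k
      using uB by (intro AE_I2) (auto simp: abs_mult intro!: mult_left_mono)
  qed
  have "\<bar>\<integral>x. d x * f x \<partial>lebesgue\<bar> \<le> 0 + e" if "e > 0" for e
  proof -
    \<comment> \<open>The estimate \<open>var\<close> below costs 11 of these units: 5 for each of
      two comparison terms and 1 for a fixed approximant.\<close>
    define \<epsilon> where "\<epsilon> = e / 13"
    have eps: "\<epsilon> > 0" using \<open>e > 0\<close> by (simp add: \<epsilon>_def)
    obtain K where K: "K > 0" "(\<integral>x. \<bar>d x\<bar> * indicator {x. \<bar>d x\<bar> > K} x \<partial>lebesgue) < \<epsilon>"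
      "integrable lebesgue (\<lambda>x. \<bar>d x\<bar> * indicator {x. \<bar>d x\<bar> > K} x)"
      by (rule L1_tail_small[OF di eps], rule that)
    \<comment> \<open>Where \<open>\<bar>d\<bar> \<le> K\<close> the weight is bounded and
      \<open>lebesgue_transport\<close> applies; on the tail only
      \<open>\<bar>w\<bar> \<le> 4\<close> is used. The 4 bounds a difference of two approximants,
      each of size at most 2.\<close>
    have comp: "(\<integral>x. \<bar>d x\<bar> * \<bar>w (\<phi> s x)\<bar> \<partial>lebesgue) \<le> K * C * (\<integral>x. \<bar>w x\<bar> \<partial>lebesgue) + 4 * \<epsilon>"
      "integrable lebesgue (\<lambda>x. \<bar>d x\<bar> * \<bar>w (\<phi> s x)\<bar>)"
      if s: "\<bar>s\<bar> \<le> 1" and w: "integrable lebesgue w" "\<And>x. \<bar>w x\<bar> \<le> 4" for s w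
    proof -
      have wm: "w \<in> borel_measurable lebesgue" using w by auto
      show int: "integrable lebesgue (\<lambda>x. \<bar>d x\<bar> * \<bar>w (\<phi> s x)\<bar>)"
      proof (rule Bochner_Integration.integrable_bound[OF integrable_mult_left[OF di, of 4]])
        show "(\<lambda>x. \<bar>d x\<bar> * \<bar>w (\<phi> s x)\<bar>) \<in> borel_measurable lebesgue"
          by (intro borel_measurable_times borel_measurable_abs dm flow_measurable_compose wm)
        show "AE x in lebesgue. norm (\<bar>d x\<bar> * \<bar>w (\<phi> s x)\<bar>) \<le> norm (d x * 4)"
          using w(2) by (intro AE_I2) (auto simp: abs_mult intro!: mult_left_mono)
      qed
      have i1: "integrable lebesgue (\<lambda>x. K * \<bar>w (\<phi> s x)\<bar>)"
        by (intro integrable_mult_right integrable_abs lebesgue_transport w)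
      have i2: "integrable lebesgue (\<lambda>x. 4 * (\<bar>d x\<bar> * indicator {x. \<bar>d x\<bar> > K} x))"
        by (rule integrable_mult_right[OF K(3)])
      have "(\<integral>x. \<bar>d x\<bar> * \<bar>w (\<phi> s x)\<bar> \<partial>lebesgue)
        \<le> (\<integral>x. K * \<bar>w (\<phi> s x)\<bar> + 4 * (\<bar>d x\<bar> * indicator {x. \<bar>d x\<bar> > K} x) \<partial>lebesgue)"
      proof (rule integral_mono[OF int Bochner_Integration.integrable_add[OF i1 i2]])
        fix x
        show "\<bar>d x\<bar> * \<bar>w (\<phi> s x)\<bar> \<le> K * \<bar>w (\<phi> s x)\<bar> + 4 * (\<bar>d x\<bar> * indicator {x. \<bar>d x\<bar> > K} x)"
        proof (cases "\<bar>d x\<bar> > K")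
          case True
          have "\<bar>d x\<bar> * \<bar>w (\<phi> s x)\<bar> \<le> \<bar>d x\<bar> * 4" using w(2) by (intro mult_left_mono) auto
          moreover have "0 \<le> K * \<bar>w (\<phi> s x)\<bar>" using K(1) by simp
          ultimately show ?thesis using True by simp
        next
          case False
          then show ?thesis by (auto intro!: mult_right_mono)
        qed
      qed
      also have "\<dots> = K * (\<integral>x. \<bar>w (\<phi> s x)\<bar> \<partial>lebesgue) + 4 * (\<integral>x. \<bar>d x\<bar> * indicator {x. \<bar>d x\<bar> > K} x \<partial>lebesgue)"
        by (subst Bochner_Integration.integral_add[OF i1 i2]) simp
      also have "\<dots> \<le> K * (C * (\<integral>x. \<bar>w x\<bar> \<partial>lebesgue)) + 4 * \<epsilon>"
      proof (intro add_mono mult_left_mono)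
        have "(\<integral>x. \<bar>w (\<phi> s x)\<bar> \<partial>lebesgue) \<le> exp (real CARD('n) * L * \<bar>s\<bar>) * (\<integral>x. \<bar>w x\<bar> \<partial>lebesgue)"
          by (rule lebesgue_transport[OF w(1)])
        also have "\<dots> \<le> C * (\<integral>x. \<bar>w x\<bar> \<partial>lebesgue)"
          unfolding C_def using s L_nonneg
          by (intro mult_right_mono) (auto intro!: mult_left_le)
        finally show "(\<integral>x. \<bar>w (\<phi> s x)\<bar> \<partial>lebesgue) \<le> C * (\<integral>x. \<bar>w x\<bar> \<partial>lebesgue)" .
      qed (use K in auto)
      finally show "(\<integral>x. \<bar>d x\<bar> * \<bar>w (\<phi> s x)\<bar> \<partial>lebesgue) \<le> K * C * (\<integral>x. \<bar>w x\<bar> \<partial>lebesgue) + 4 * \<epsilon>"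
        by (simp add: mult.assoc)
    qed
    \<comment> \<open>Any two approximants from \<open>k0\<close> on are then within
      \<open>\<epsilon> / (K * C)\<close> in \<open>L1\<close>, which cancels the factor
      \<open>K * C\<close> of \<open>comp\<close>.\<close>
    have "eventually (\<lambda>k. (\<integral>x. \<bar>u k x - f x\<bar> \<partial>lebesgue) < \<epsilon> / (2 * K * C)) sequentially"
      using L1 K(1) C1 eps by (intro order_tendstoD(2)[OF L1]) auto
    then obtain k0 where k0: "\<And>k. k \<ge> k0 \<Longrightarrow> (\<integral>x. \<bar>u k x - f x\<bar> \<partial>lebesgue) < \<epsilon> / (2 * K * C)"
      unfolding eventually_sequentially by blast
    have udiff: "K * C * (\<integral>x. \<bar>u k x - u k0 x\<bar> \<partial>lebesgue) \<le> \<epsilon>" if "k \<ge> k0" for k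
    proof -
      have fint: "integrable lebesgue f"
      proof (rule Bochner_Integration.integrable_bound[OF ball f(1)])
        show "AE x in lebesgue. norm (f x) \<le> norm (indicator (cball 0 (R + 1)) x :: real)"
          using f by (intro AE_I2) (force simp: indicator_def)
      qed
      have "(\<integral>x. \<bar>u k x - u k0 x\<bar> \<partial>lebesgue) \<le> (\<integral>x. \<bar>u k x - f x\<bar> + \<bar>u k0 x - f x\<bar> \<partial>lebesgue)"
        using uint fint by (intro integral_mono) (auto intro!: Bochner_Integration.integrable_add)
      also have "\<dots> = (\<integral>x. \<bar>u k x - f x\<bar> \<partial>lebesgue) + (\<integral>x. \<bar>u k0 x - f x\<bar> \<partial>lebesgue)"
        using uint fint by (intro Bochner_Integration.integral_add) auto
      also have "\<dots> \<le> \<epsilon> / (2 * K * C) + \<epsilon> / (2 * K * C)"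
        by (intro add_mono less_imp_le k0 that order_refl)
      also have "\<dots> = \<epsilon> / (K * C)" by simp
      finally have "K * C * (\<integral>x. \<bar>u k x - u k0 x\<bar> \<partial>lebesgue) \<le> K * C * (\<epsilon> / (K * C))"
        using K C1 by (intro mult_left_mono) auto
      then show ?thesis using K C1 by simp
    qed
    \<comment> \<open>The time window is chosen from the single function \<open>u k0\<close>, whose
      continuity along orbits suffices. Later \<open>u k\<close> inherit the estimate through
      \<open>comp\<close>, so the window does not depend on \<open>k\<close>.\<close>
    have "((\<lambda>s. \<integral>x. \<bar>d x\<bar> * \<bar>u k0 (\<phi> s x) - u k0 x\<bar> \<partial>lebesgue) \<longlongrightarrow> (\<integral>x. 0 \<partial>(lebesgue :: (real^'n) measure))) (at 0)"
    proof (rule integral_dominated_convergence_at)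
      show "(\<lambda>x. \<bar>d x\<bar> * \<bar>u k0 (\<phi> s x) - u k0 x\<bar>) \<in> borel_measurable lebesgue" for s
        by (intro borel_measurable_times borel_measurable_abs borel_measurable_diff dm flow_measurable_compose um)
      show "integrable lebesgue (\<lambda>x. \<bar>d x\<bar> * 4)" using di by (intro integrable_mult_left integrable_abs)
      show "AE x in lebesgue. ((\<lambda>s. \<bar>d x\<bar> * \<bar>u k0 (\<phi> s x) - u k0 x\<bar>) \<longlongrightarrow> 0) (at 0)"
      proof (rule AE_I2)
        fix x
        have "isCont (\<lambda>s. u k0 (\<phi> s x)) 0" by (rule DERIV_isCont[OF C1c_flow_deriv[OF uC]])
        then have "((\<lambda>s. u k0 (\<phi> s x)) \<longlongrightarrow> u k0 x) (at 0)" by (simp add: isCont_def flow0)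
        then have "((\<lambda>s. \<bar>d x\<bar> * \<bar>u k0 (\<phi> s x) - u k0 x\<bar>) \<longlongrightarrow> \<bar>d x\<bar> * \<bar>u k0 x - u k0 x\<bar>) (at 0)"
          by (intro tendsto_intros)
        then show "((\<lambda>s. \<bar>d x\<bar> * \<bar>u k0 (\<phi> s x) - u k0 x\<bar>) \<longlongrightarrow> 0) (at 0)" by simp
      qed
      show "AE x in lebesgue. \<bar>\<bar>d x\<bar> * \<bar>u k0 (\<phi> s x) - u k0 x\<bar>\<bar> \<le> \<bar>d x\<bar> * 4" for s
      proof (rule AE_I2)
        fix x
        have "\<bar>u k0 (\<phi> s x) - u k0 x\<bar> \<le> 4" using uB[of k0 x] uB[of k0 "\<phi> s x"] by linarith
        then show "\<bar>\<bar>d x\<bar> * \<bar>u k0 (\<phi> s x) - u k0 x\<bar>\<bar> \<le> \<bar>d x\<bar> * 4" by (auto simp: abs_mult intro!: mult_left_mono)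
      qed
    qed simp
    then have "eventually (\<lambda>s. (\<integral>x. \<bar>d x\<bar> * \<bar>u k0 (\<phi> s x) - u k0 x\<bar> \<partial>lebesgue) < \<epsilon>) (at 0)"
      using eps by (intro order_tendstoD) auto
    then obtain \<tau>0 where t0: "\<tau>0 > 0" "\<And>s. s \<noteq> 0 \<Longrightarrow> \<bar>s\<bar> < \<tau>0 \<Longrightarrow>
        (\<integral>x. \<bar>d x\<bar> * \<bar>u k0 (\<phi> s x) - u k0 x\<bar> \<partial>lebesgue) < \<epsilon>"
      unfolding eventually_at by (auto simp: dist_real_def)
    define \<tau> where "\<tau> = min 1 (\<tau>0 / 2)"
    have tau: "\<tau> > 0" "\<tau> \<le> 1" "\<tau> < \<tau>0" using t0(1) by (auto simp: \<tau>_def)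
    have D: "(\<integral>x. \<bar>d x\<bar> * \<bar>u k0 (\<phi> s x) - u k0 x\<bar> \<partial>lebesgue) \<le> \<epsilon>" if "\<bar>s\<bar> \<le> \<tau>" for s
    proof (cases "s = 0")
      case True
      then show ?thesis using eps by (simp add: flow0)
    next
      case False
      then show ?thesis using t0(2)[of s] that tau by linarith
    qed
    \<comment> \<open>With \<open>w = u k - u k0\<close>, the increment of \<open>u k\<close> along
      the flow consists of the increment of \<open>u k0\<close> and of \<open>w\<close> at the two
      end points.\<close>
    have var: "\<bar>(\<integral>x. d x * u k x \<partial>lebesgue) - (\<integral>x. d x * u k (\<phi> s x) \<partial>lebesgue)\<bar> \<le> 11 * \<epsilon>"
      if k: "k \<ge> k0" and s: "\<bar>s\<bar> \<le> \<tau>" for k s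
    proof -
      have s1: "\<bar>s\<bar> \<le> 1" using s tau by linarith
      define w where "w x = u k x - u k0 x" for x
      have w: "integrable lebesgue w" unfolding w_def by (intro Bochner_Integration.integrable_diff uint)
      have w4: "\<bar>w x\<bar> \<le> 4" for x using uB[of k x] uB[of k0 x] unfolding w_def by linarith
      have di_u: "integrable lebesgue (\<lambda>x. d x * u k (\<phi> s x))" for k s
        by (rule C1c_flow_integrable[OF integrable_imp_locally_integrable[OF di] uC])
      have di_u0: "integrable lebesgue (\<lambda>x. d x * u k x)" for k using di_u[of k 0] by (simp add: flow0)
      have i3: "integrable lebesgue (\<lambda>x. \<bar>d x\<bar> * \<bar>u k0 (\<phi> s x) - u k0 x\<bar>)"
      proof -
        have "integrable lebesgue (\<lambda>x. \<bar>d x * u k0 (\<phi> s x) - d x * u k0 x\<bar>)"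
          by (intro integrable_abs Bochner_Integration.integrable_diff di_u di_u0)
        then show ?thesis by (simp add: abs_mult right_diff_distrib[symmetric])
      qed
      have i1: "integrable lebesgue (\<lambda>x. \<bar>d x\<bar> * \<bar>w (\<phi> s x)\<bar>)" by (rule comp(2)[OF s1 w w4])
      have i2: "integrable lebesgue (\<lambda>x. \<bar>d x\<bar> * \<bar>w x\<bar>)" using comp(2)[of 0, OF _ w w4] by (simp add: flow0)
      have "\<bar>(\<integral>x. d x * u k x \<partial>lebesgue) - (\<integral>x. d x * u k (\<phi> s x) \<partial>lebesgue)\<bar>
        = \<bar>\<integral>x. d x * u k x - d x * u k (\<phi> s x) \<partial>lebesgue\<bar>"
        by (subst Bochner_Integration.integral_diff[OF di_u0 di_u]) simp
      also have "\<dots> \<le> (\<integral>x. \<bar>d x * u k x - d x * u k (\<phi> s x)\<bar> \<partial>lebesgue)" by (rule integral_abs_bound)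
      also have "\<dots> \<le> (\<integral>x. \<bar>d x\<bar> * \<bar>w (\<phi> s x)\<bar> + \<bar>d x\<bar> * \<bar>w x\<bar> + \<bar>d x\<bar> * \<bar>u k0 (\<phi> s x) - u k0 x\<bar> \<partial>lebesgue)"
      proof (rule integral_mono)
        show "integrable lebesgue (\<lambda>x. \<bar>d x * u k x - d x * u k (\<phi> s x)\<bar>)"
          by (intro integrable_abs Bochner_Integration.integrable_diff di_u di_u0)
        show "integrable lebesgue (\<lambda>x. \<bar>d x\<bar> * \<bar>w (\<phi> s x)\<bar> + \<bar>d x\<bar> * \<bar>w x\<bar> + \<bar>d x\<bar> * \<bar>u k0 (\<phi> s x) - u k0 x\<bar>)"
          by (intro Bochner_Integration.integrable_add i1 i2 i3)
        fix x
        have "\<bar>u k x - u k (\<phi> s x)\<bar> \<le> \<bar>w (\<phi> s x)\<bar> + \<bar>w x\<bar> + \<bar>u k0 (\<phi> s x) - u k0 x\<bar>"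
          unfolding w_def by linarith
        then have "\<bar>d x\<bar> * \<bar>u k x - u k (\<phi> s x)\<bar> \<le> \<bar>d x\<bar> * (\<bar>w (\<phi> s x)\<bar> + \<bar>w x\<bar> + \<bar>u k0 (\<phi> s x) - u k0 x\<bar>)"
          by (intro mult_left_mono) auto
        then show "\<bar>d x * u k x - d x * u k (\<phi> s x)\<bar> \<le>
          \<bar>d x\<bar> * \<bar>w (\<phi> s x)\<bar> + \<bar>d x\<bar> * \<bar>w x\<bar> + \<bar>d x\<bar> * \<bar>u k0 (\<phi> s x) - u k0 x\<bar>"
          by (simp add: distrib_left abs_mult[symmetric] right_diff_distrib)
      qed
      also have "\<dots> = (\<integral>x. \<bar>d x\<bar> * \<bar>w (\<phi> s x)\<bar> \<partial>lebesgue) + (\<integral>x. \<bar>d x\<bar> * \<bar>w x\<bar> \<partial>lebesgue)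
          + (\<integral>x. \<bar>d x\<bar> * \<bar>u k0 (\<phi> s x) - u k0 x\<bar> \<partial>lebesgue)"
        by (simp only: Bochner_Integration.integral_add Bochner_Integration.integrable_add i1 i2 i3)
      also have "\<dots> \<le> (\<epsilon> + 4 * \<epsilon>) + (\<epsilon> + 4 * \<epsilon>) + \<epsilon>"
      proof (intro add_mono D s)
        have kc: "K * C * (\<integral>x. \<bar>w x\<bar> \<partial>lebesgue) \<le> \<epsilon>" unfolding w_def by (rule udiff[OF k])
        show "(\<integral>x. \<bar>d x\<bar> * \<bar>w (\<phi> s x)\<bar> \<partial>lebesgue) \<le> \<epsilon> + 4 * \<epsilon>"
          using comp(1)[OF s1 w w4] kc by linarith
        show "(\<integral>x. \<bar>d x\<bar> * \<bar>w x\<bar> \<partial>lebesgue) \<le> \<epsilon> + 4 * \<epsilon>"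
          using comp(1)[of 0, OF _ w w4] kc by (simp add: flow0)
      qed
      finally show ?thesis by simp
    qed
    \<comment> \<open>The function \<open>?n k\<close> adds to the weighted integral its expected
      linear loss, so its derivative is exactly the difference estimated in \<open>var\<close>. The
      mean value bound is free of \<open>k\<close> and survives the limit; at time 0 the weighted
      integral of \<open>f\<close> vanishes by \<open>rf\<close>.\<close>
    have main: "\<bar>(\<integral>x. \<rho> x * f (\<phi> t x) \<partial>lebesgue) + t * (\<integral>x. d x * f x \<partial>lebesgue)\<bar> \<le> 11 * \<epsilon> * \<bar>t\<bar>"
      if t: "\<bar>t\<bar> \<le> \<tau>" for t
    proof (rule LIMSEQ_le_const2)
      let ?n = "\<lambda>k s. (\<integral>x. \<rho> x * u k (\<phi> s x) \<partial>lebesgue) + s * (\<integral>x. d x * u k x \<partial>lebesgue)"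
      have "(\<lambda>k. \<bar>?n k t - ?n k 0\<bar>) \<longlonglongrightarrow> \<bar>((\<integral>x. \<rho> x * f (\<phi> t x) \<partial>lebesgue) + t * (\<integral>x. d x * f (\<phi> 0 x) \<partial>lebesgue))
          - ((\<integral>x. \<rho> x * f (\<phi> 0 x) \<partial>lebesgue) + 0 * (\<integral>x. d x * f (\<phi> 0 x) \<partial>lebesgue))\<bar>"
        using domlim[OF ri, of t] domlim[OF ri, of 0] domlim[OF di, of 0]
        by (intro tendsto_intros) (simp_all add: flow0)
      then show "(\<lambda>k. \<bar>?n k t - ?n k 0\<bar>) \<longlonglongrightarrow> \<bar>(\<integral>x. \<rho> x * f (\<phi> t x) \<partial>lebesgue) + t * (\<integral>x. d x * f x \<partial>lebesgue)\<bar>"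
        by (simp add: flow0 rf)
      have "\<bar>?n k t - ?n k 0\<bar> \<le> 11 * \<epsilon> * \<bar>t\<bar>" if k: "k \<ge> k0" for k
      proof -
        have "norm (?n k t - ?n k 0) \<le> 11 * \<epsilon> * norm (t - 0)"
        proof (rule field_differentiable_bound[of "{-\<tau>..\<tau>}" "?n k"
              "\<lambda>s. (\<integral>x. d x * u k x \<partial>lebesgue) - (\<integral>x. d x * u k (\<phi> s x) \<partial>lebesgue)"])
          fix s assume s: "s \<in> {-\<tau>..\<tau>}"
          have "(?n k has_real_derivative (- (\<integral>x. d x * u k (\<phi> s x) \<partial>lebesgue) + 1 * (\<integral>x. d x * u k x \<partial>lebesgue))) (at s)"
            by (intro DERIV_add transport_deriv[OF rd uC] DERIV_cmult_right DERIV_ident)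
          then show "(?n k has_real_derivative (\<integral>x. d x * u k x \<partial>lebesgue) - (\<integral>x. d x * u k (\<phi> s x) \<partial>lebesgue)) (at s within {-\<tau>..\<tau>})"
            by (rule DERIV_cong[OF has_field_derivative_at_within]) simp
          show "norm ((\<integral>x. d x * u k x \<partial>lebesgue) - (\<integral>x. d x * u k (\<phi> s x) \<partial>lebesgue)) \<le> 11 * \<epsilon>"
            using var[OF k, of s] s by (auto simp: abs_le_iff)
        qed (use t tau in \<open>auto simp: abs_le_iff\<close>)
        then show ?thesis by simp
      qed
      then show "\<exists>N. \<forall>k\<ge>N. \<bar>?n k t - ?n k 0\<bar> \<le> 11 * \<epsilon> * \<bar>t\<bar>" by blast
    qed
    have nn: "(\<integral>x. \<rho> x * f (\<phi> t x) \<partial>lebesgue) \<ge> 0" for t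
      using r0 f(2) by (intro integral_nonneg_AE) auto
    \<comment> \<open>Nonnegativity of the weighted integral at time \<open>\<tau>\<close> bounds
      the integral of \<open>d * f\<close> from above, and at time \<open>- \<tau>\<close> from
      below. The group property matters here: the minimum at 0 is interior.\<close>
    have "\<tau> * (\<integral>x. d x * f x \<partial>lebesgue) \<le> \<tau> * (11 * \<epsilon>)"
    proof -
      have "\<bar>(\<integral>x. \<rho> x * f (\<phi> \<tau> x) \<partial>lebesgue) + \<tau> * (\<integral>x. d x * f x \<partial>lebesgue)\<bar> \<le> \<tau> * (11 * \<epsilon>)"
        using main[of \<tau>] tau by (simp add: mult.commute)
      then show ?thesis using nn[of \<tau>] by linarith
    qed
    moreover have "- (\<tau> * (\<integral>x. d x * f x \<partial>lebesgue)) \<le> \<tau> * (11 * \<epsilon>)"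
    proof -
      have "\<bar>(\<integral>x. \<rho> x * f (\<phi> (-\<tau>) x) \<partial>lebesgue) + (-\<tau>) * (\<integral>x. d x * f x \<partial>lebesgue)\<bar> \<le> \<tau> * (11 * \<epsilon>)"
        using main[of "-\<tau>"] tau by (simp add: mult.commute)
      then show ?thesis using nn[of "-\<tau>"] by linarith
    qed
    ultimately have "\<bar>\<tau> * (\<integral>x. d x * f x \<partial>lebesgue)\<bar> \<le> \<tau> * (11 * \<epsilon>)" by (rule abs_leI)
    then have "\<tau> * \<bar>\<integral>x. d x * f x \<partial>lebesgue\<bar> \<le> \<tau> * (11 * \<epsilon>)" using tau by (simp add: abs_mult)
    then have "\<bar>\<integral>x. d x * f x \<partial>lebesgue\<bar> \<le> 11 * \<epsilon>" using tau by simp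
    then show ?thesis using eps by (simp add: \<epsilon>_def)
  qed
  then have "\<bar>\<integral>x. d x * f x \<partial>lebesgue\<bar> \<le> 0" by (rule field_le_epsilon)
  then show ?thesis by simp
qed

lemma weak_div_vanishes_on_zero_set:
  assumes rd: "loc_weak_div \<rho> d" and ri: "integrable lebesgue \<rho>" and di: "integrable lebesgue d"
    and r0: "\<And>x. \<rho> x \<ge> 0"
  shows "AE x in lebesgue. \<rho> x = 0 \<longrightarrow> d x = 0"
proof -
  have dm[measurable]: "d \<in> borel_measurable lebesgue" using di by auto
  have rm[measurable]: "\<rho> \<in> borel_measurable lebesgue" using ri by auto
  have "AE x in lebesgue. norm x \<le> real n \<longrightarrow> \<rho> x = 0 \<longrightarrow> \<sigma> * d x \<le> 0" for n :: nat and \<sigma> :: real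
  proof -
    \<comment> \<open>\<open>f\<close> selects the part of the zero set in a ball where
      \<open>d\<close> has the sign given by \<open>\<sigma>\<close>, so that
      \<open>\<sigma> * (d x * f x)\<close> is nonnegative with integral 0. Below,
      \<open>\<sigma>\<close> takes the values 1 and -1.\<close>
    define f where "f x = (if norm x \<le> real n \<and> \<rho> x = 0 \<and> \<sigma> * d x > 0 then 1 else 0 :: real)" for x
    have nm[measurable]: "(norm :: real^'n \<Rightarrow> real) \<in> borel_measurable lebesgue"
      by (intro continuous_borel_measurable_lebesgue continuous_intros)
    have fm: "f \<in> borel_measurable lebesgue" unfolding f_def by measurable
    have "(\<integral>x. d x * f x \<partial>lebesgue) = 0"
      by (rule weak_div_vanishes_aux[OF rd ri di r0 fm, of "real n"]) (auto simp: f_def)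
    then have z: "(\<integral>x. \<sigma> * (d x * f x) \<partial>lebesgue) = 0" by simp
    have i: "integrable lebesgue (\<lambda>x. \<sigma> * (d x * f x))"
    proof (rule integrable_mult_right, rule Bochner_Integration.integrable_bound[OF di])
      show "(\<lambda>x. d x * f x) \<in> borel_measurable lebesgue" using fm by measurable
    qed (auto simp: f_def)
    have "AE x in lebesgue. \<sigma> * (d x * f x) = 0"
      using integral_nonneg_eq_0_iff_AE[OF i] z by (auto simp: f_def)
    then show ?thesis by eventually_elim (auto simp: f_def split: if_splits)
  qed
  then have "AE x in lebesgue. \<forall>n::nat. (norm x \<le> real n \<longrightarrow> \<rho> x = 0 \<longrightarrow> 1 * d x \<le> 0) \<and>
      (norm x \<le> real n \<longrightarrow> \<rho> x = 0 \<longrightarrow> (-1) * d x \<le> 0)"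
    unfolding AE_all_countable by (intro allI AE_conjI)
  then show ?thesis
  proof eventually_elim
    case (elim x)
    obtain n where "norm x \<le> real n" using real_arch_simple by blast
    with elim show ?case by force
  qed
qed

end

section \<open>The Koopman group\<close>

lemma L2_mult_integrable:
  assumes "f \<in> L2 P" "g \<in> L2 P"
  shows "integrable P (\<lambda>x. f x * g x)"
proof (rule Bochner_Integration.integrable_bound)
  show "integrable P (\<lambda>x. (f x)\<^sup>2 + (g x)\<^sup>2)" using assms by (auto simp: L2_def)
  show "(\<lambda>x. f x * g x) \<in> borel_measurable P" using assms by (auto simp: L2_def)
  show "AE x in P. norm (f x * g x) \<le> norm ((f x)\<^sup>2 + (g x)\<^sup>2)"
  proof (rule AE_I2)
    fix x
    have "2 * \<bar>f x\<bar> * \<bar>g x\<bar> \<le> \<bar>f x\<bar>\<^sup>2 + \<bar>g x\<bar>\<^sup>2" by (rule sum_squares_bound)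
    then have "2 * (\<bar>f x\<bar> * \<bar>g x\<bar>) \<le> (f x)\<^sup>2 + (g x)\<^sup>2" by (simp add: mult.assoc)
    moreover have "0 \<le> \<bar>f x\<bar> * \<bar>g x\<bar>" by simp
    ultimately have "\<bar>f x\<bar> * \<bar>g x\<bar> \<le> (f x)\<^sup>2 + (g x)\<^sup>2" by linarith
    then show "norm (f x * g x) \<le> norm ((f x)\<^sup>2 + (g x)\<^sup>2)" by (simp add: abs_mult)
  qed
qed

lemma L2_add:
  assumes "f \<in> L2 P" "g \<in> L2 P"
  shows "(\<lambda>x. f x + g x) \<in> L2 P"
proof -
  have "integrable P (\<lambda>x. (f x)\<^sup>2 + (g x)\<^sup>2 + 2 * (f x * g x))"
    using assms L2_mult_integrable[OF assms] by (auto simp: L2_def)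
  then have "integrable P (\<lambda>x. (f x + g x)\<^sup>2)" by (simp add: power2_sum mult.assoc)
  then show ?thesis using assms by (auto simp: L2_def)
qed

lemma L2_scale: "f \<in> L2 P \<Longrightarrow> (\<lambda>x. c * f x) \<in> L2 P"
  by (auto simp: L2_def power_mult_distrib)

lemma L2_diff: "f \<in> L2 P \<Longrightarrow> g \<in> L2 P \<Longrightarrow> (\<lambda>x. f x - g x) \<in> L2 P"
  using L2_add[OF _ L2_scale[of g P "-1"], of f] by simp

lemma L2_divide: "f \<in> L2 P \<Longrightarrow> (\<lambda>x. f x / c) \<in> L2 P"
  using L2_scale[of f P "1 / c"] by simp

lemma L2_sum:
  assumes "finite I" "\<And>i. i \<in> I \<Longrightarrow> f i \<in> L2 P"
  shows "(\<lambda>x. \<Sum>i\<in>I. f i x) \<in> L2 P"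
  using assms
proof (induction I rule: finite_induct)
  case empty
  then show ?case by (simp add: L2_def)
next
  case (insert i I)
  then show ?case by (simp add: L2_add)
qed

lemma l2norm_nonneg [simp]: "l2norm P f \<ge> 0"
  by (simp add: l2norm_def)

lemma l2norm_square: "(l2norm P f)\<^sup>2 = (\<integral>x. (f x)\<^sup>2 \<partial>P)"
  by (simp add: l2norm_def)

lemma l2norm_scale: "l2norm P (\<lambda>x. c * f x) = \<bar>c\<bar> * l2norm P f"
  by (simp add: l2norm_def power_mult_distrib real_sqrt_mult)

lemma l2norm_divide: "l2norm P (\<lambda>x. f x / c) = l2norm P f / \<bar>c\<bar>"
  using l2norm_scale[of P "1 / c" f] by simp

lemma l2norm_minus_commute: "l2norm P (\<lambda>x. f x - g x) = l2norm P (\<lambda>x. g x - f x)"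
  by (simp add: l2norm_def power2_commute)

text \<open>The integral of \<open>(f x + a * g x)\<^sup>2\<close> is a quadratic in
  \<open>a\<close> that is never negative; its minimiser \<open>- B / C\<close> gives the inequality
  when \<open>C\<close> is not 0.\<close>

lemma l2norm_Cauchy_Schwarz:
  assumes f: "f \<in> L2 P" and g: "g \<in> L2 P"
  shows "\<bar>\<integral>x. f x * g x \<partial>P\<bar> \<le> l2norm P f * l2norm P g"
proof -
  define A B C where "A = (\<integral>x. (f x)\<^sup>2 \<partial>P)" and "B = (\<integral>x. f x * g x \<partial>P)" and "C = (\<integral>x. (g x)\<^sup>2 \<partial>P)"
  have AC: "A \<ge> 0" "C \<ge> 0" by (simp_all add: A_def C_def)
  have q: "0 \<le> A + 2 * a * B + a\<^sup>2 * C" for a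
  proof -
    have "0 \<le> (\<integral>x. (f x + a * g x)\<^sup>2 \<partial>P)" by simp
    also have "\<dots> = (\<integral>x. (f x)\<^sup>2 + 2 * a * (f x * g x) + a\<^sup>2 * (g x)\<^sup>2 \<partial>P)"
      by (rule Bochner_Integration.integral_cong) (auto simp: power2_eq_square algebra_simps)
    also have "\<dots> = A + 2 * a * B + a\<^sup>2 * C"
      using f g L2_mult_integrable[OF f g] by (simp add: L2_def A_def B_def C_def)
    finally show ?thesis .
  qed
  have "B\<^sup>2 \<le> A * C"
  proof (cases "C = 0")
    case True
    have "B = 0"
    proof (rule ccontr)
      assume "B \<noteq> 0"
      \<comment> \<open>For \<open>C = 0\<close> the quadratic is affine in \<open>a\<close>, and
        this argument gives it the value -1.\<close>
      then show False using q[of "- (A + 1) / (2 * B)"] True by (simp add: field_simps)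
    qed
    then show ?thesis using True by simp
  next
    case False
    have "0 \<le> C * (A + 2 * (- B / C) * B + (- B / C)\<^sup>2 * C)" by (intro mult_nonneg_nonneg q AC)
    also have "\<dots> = A * C - B\<^sup>2" using False by (simp add: field_simps power2_eq_square)
    finally show ?thesis by simp
  qed
  also have "A * C = (l2norm P f * l2norm P g)\<^sup>2" by (simp add: power_mult_distrib l2norm_square A_def C_def)
  finally have "\<bar>B\<bar>\<^sup>2 \<le> (l2norm P f * l2norm P g)\<^sup>2" by simp
  then show ?thesis unfolding B_def by (rule power2_le_imp_le) simp
qed

lemma l2norm_triangle:
  assumes f: "f \<in> L2 P" and g: "g \<in> L2 P"
  shows "l2norm P (\<lambda>x. f x + g x) \<le> l2norm P f + l2norm P g"
proof (rule power2_le_imp_le)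
  have "(l2norm P (\<lambda>x. f x + g x))\<^sup>2 = (\<integral>x. (f x)\<^sup>2 + (g x)\<^sup>2 + 2 * (f x * g x) \<partial>P)"
    by (simp add: l2norm_square power2_sum mult.assoc)
  also have "\<dots> = (l2norm P f)\<^sup>2 + (l2norm P g)\<^sup>2 + 2 * (\<integral>x. f x * g x \<partial>P)"
    using f g L2_mult_integrable[OF f g] by (simp add: L2_def l2norm_square)
  also have "\<dots> \<le> (l2norm P f)\<^sup>2 + (l2norm P g)\<^sup>2 + 2 * (l2norm P f * l2norm P g)"
    using l2norm_Cauchy_Schwarz[OF f g] by linarith
  also have "\<dots> = (l2norm P f + l2norm P g)\<^sup>2" by (simp add: power2_sum mult.assoc)
  finally show "(l2norm P (\<lambda>x. f x + g x))\<^sup>2 \<le> (l2norm P f + l2norm P g)\<^sup>2" .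
qed simp

lemma l2norm_triangle_diff:
  assumes "f \<in> L2 P" "g \<in> L2 P" "h \<in> L2 P"
  shows "l2norm P (\<lambda>x. f x - h x) \<le> l2norm P (\<lambda>x. f x - g x) + l2norm P (\<lambda>x. g x - h x)"
  using l2norm_triangle[OF L2_diff[OF assms(1,2)] L2_diff[OF assms(2,3)]] by simp

lemma l2norm_sum_le:
  assumes "finite I" "\<And>i. i \<in> I \<Longrightarrow> f i \<in> L2 P"
  shows "l2norm P (\<lambda>x. \<Sum>i\<in>I. f i x) \<le> (\<Sum>i\<in>I. l2norm P (f i))"
  using assms
proof (induction I rule: finite_induct)
  case empty
  then show ?case by (simp add: l2norm_def)
next
  case (insert i I)
  have "l2norm P (\<lambda>x. f i x + (\<Sum>i\<in>I. f i x)) \<le> l2norm P (f i) + l2norm P (\<lambda>x. \<Sum>i\<in>I. f i x)"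
    using insert by (intro l2norm_triangle L2_sum) auto
  then show ?case using insert by force
qed

lemma (in finite_measure) bounded_L2:
  assumes "f \<in> borel_measurable M" "\<And>x. \<bar>f x\<bar> \<le> B"
  shows "f \<in> L2 M"
proof -
  have "integrable M (\<lambda>x. (f x)\<^sup>2)"
  proof (rule integrable_const_bound[of _ "B\<^sup>2"])
    show "AE x in M. norm ((f x)\<^sup>2) \<le> B\<^sup>2"
    proof (rule AE_I2)
      fix x show "norm ((f x)\<^sup>2) \<le> B\<^sup>2" using power_mono[OF assms(2)[of x], of 2] by simp
    qed
  qed (use assms in auto)
  with assms show ?thesis by (simp add: L2_def)
qed

lemma l2norm_dominated_convergence:
  assumes f: "\<And>k::nat. f k \<in> borel_measurable P" and w: "integrable P (\<lambda>x. (w x)\<^sup>2)"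
    and lim: "AE x in P. (\<lambda>k. f k x) \<longlonglongrightarrow> 0" and b: "\<And>k x. \<bar>f k x\<bar> \<le> \<bar>w x\<bar>"
  shows "(\<lambda>k. l2norm P (f k)) \<longlonglongrightarrow> 0"
proof -
  have "(\<lambda>k. \<integral>x. (f k x)\<^sup>2 \<partial>P) \<longlonglongrightarrow> (\<integral>x. 0 \<partial>P)"
  proof (rule integral_dominated_convergence[OF _ _ w])
    show "AE x in P. (\<lambda>k. (f k x)\<^sup>2) \<longlonglongrightarrow> 0"
      using lim by eventually_elim (auto intro: tendsto_eq_intros)
    show "AE x in P. norm ((f k x)\<^sup>2) \<le> (w x)\<^sup>2" for k
    proof (rule AE_I2)
      fix x show "norm ((f k x)\<^sup>2) \<le> (w x)\<^sup>2" using power_mono[OF b[of k x], of 2] by simp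
    qed
  qed (use f in auto)
  then have "(\<lambda>k. sqrt (\<integral>x. (f k x)\<^sup>2 \<partial>P)) \<longlonglongrightarrow> sqrt 0" by (intro tendsto_real_sqrt) simp
  then show ?thesis by (simp add: l2norm_def)
qed

lemma (in finite_measure) l2norm_bounded_convergence_at:
  fixes f :: "real \<Rightarrow> 'a \<Rightarrow> real"
  assumes f: "\<And>h. f h \<in> borel_measurable M"
    and lim: "\<And>x. ((\<lambda>h. f h x) \<longlongrightarrow> 0) (at a)" and b: "\<And>h x. \<bar>f h x\<bar> \<le> B"
  shows "((\<lambda>h. l2norm M (f h)) \<longlongrightarrow> 0) (at a)"
  unfolding tendsto_at_iff_sequentially
proof (intro allI impI)
  fix X :: "nat \<Rightarrow> real" assume X: "\<forall>i. X i \<in> UNIV - {a}" "X \<longlonglongrightarrow> a"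
  have "(\<lambda>k. l2norm M (f (X k))) \<longlonglongrightarrow> 0"
  proof (rule l2norm_dominated_convergence[where w="\<lambda>x. B"])
    show "AE x in M. (\<lambda>k. f (X k) x) \<longlonglongrightarrow> 0"
      using lim X unfolding tendsto_at_iff_sequentially by (auto simp: o_def)
    show "\<bar>f (X k) x\<bar> \<le> \<bar>B\<bar>" for k x using b[of "X k" x] by linarith
  qed (use f in auto)
  then show "((\<lambda>h. l2norm M (f h)) \<circ> X) \<longlonglongrightarrow> 0" by (simp add: o_def)
qed

text \<open>Everything about the group depends on \<open>\<rho>\<close> and \<open>d\<close> only
  through the bound on the image of \<open>P\<close> under the flow. The constant \<open>c\<close>
  is a parameter because the locale is used twice: with the essential supremum of the quotient, and
  with 0 in the divergence-free case.\<close>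

locale koopman = c1_flow_vec F F' L \<phi> + finite_measure P
  for F :: "real^'n \<Rightarrow> real^'n" and F' :: "real^'n \<Rightarrow> (real^'n) \<Rightarrow>\<^sub>L (real^'n)"
    and L :: real and \<phi> :: "real \<Rightarrow> real^'n \<Rightarrow> real^'n" and P :: "(real^'n) measure" +
  fixes c :: real
  assumes sets_P: "sets P = sets lebesgue"
    and absolutely_continuous_P: "\<And>Q. AE x in lebesgue. Q x \<Longrightarrow> AE x in P. Q x"
    and c_nonneg: "c \<ge> 0"
    and flow_bound: "\<And>f t. f \<in> borel_measurable lebesgue \<Longrightarrow> (\<And>x. 0 \<le> f x) \<Longrightarrow>
      (\<integral>\<^sup>+x. ennreal (f (\<phi> t x)) \<partial>P) \<le> ennreal (exp (c * \<bar>t\<bar>)) * (\<integral>\<^sup>+x. ennreal (f x) \<partial>P)"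
begin

lemma measurable_P: "borel_measurable P = borel_measurable lebesgue"
  by (rule measurable_cong_sets[OF sets_P refl])

text \<open>The root of the factor in \<open>flow_bound\<close>, since that bound is applied to
  squares. With \<open>c\<close> equal to twice \<open>\<omega>0\<close> this is
  \<open>exp (\<omega>0 * \<bar>t\<bar>)\<close>.\<close>

definition growth :: "real \<Rightarrow> real" where "growth t = exp (c / 2 * \<bar>t\<bar>)"

lemma growth_ge_1: "growth t \<ge> 1"
  using c_nonneg by (simp add: growth_def)

lemma growth_mono: "\<bar>s\<bar> \<le> \<bar>t\<bar> \<Longrightarrow> growth s \<le> growth t"
  using c_nonneg by (simp add: growth_def mult_left_mono)

lemma flow_compose_L2:
  assumes f: "f \<in> L2 P"
  shows "(\<lambda>x. f (\<phi> t x)) \<in> L2 P" "l2norm P (\<lambda>x. f (\<phi> t x)) \<le> growth t * l2norm P f"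
proof -
  have fm: "f \<in> borel_measurable lebesgue" and fi: "integrable P (\<lambda>x. (f x)\<^sup>2)"
    using f by (auto simp: L2_def measurable_P)
  have ftm: "(\<lambda>x. f (\<phi> t x)) \<in> borel_measurable P" unfolding measurable_P by (rule flow_measurable_compose[OF fm])
  have fin: "(\<integral>\<^sup>+x. ennreal ((f x)\<^sup>2) \<partial>P) = ennreal (\<integral>x. (f x)\<^sup>2 \<partial>P)"
    by (rule nn_integral_eq_integral[OF fi]) simp
  have le: "(\<integral>\<^sup>+x. ennreal ((f (\<phi> t x))\<^sup>2) \<partial>P) \<le> ennreal (exp (c * \<bar>t\<bar>) * (\<integral>x. (f x)\<^sup>2 \<partial>P))"
    using flow_bound[of "\<lambda>x. (f x)\<^sup>2" t] fm fin by (simp add: ennreal_mult)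
  have int: "integrable P (\<lambda>x. (f (\<phi> t x))\<^sup>2)"
    unfolding integrable_iff_bounded
  proof
    show "(\<lambda>x. (f (\<phi> t x))\<^sup>2) \<in> borel_measurable P" using ftm by measurable
    show "(\<integral>\<^sup>+x. ennreal (norm ((f (\<phi> t x))\<^sup>2)) \<partial>P) < \<infinity>"
      using le_less_trans[OF le] by simp
  qed
  with ftm show "(\<lambda>x. f (\<phi> t x)) \<in> L2 P" by (simp add: L2_def)
  have "ennreal (\<integral>x. (f (\<phi> t x))\<^sup>2 \<partial>P) \<le> ennreal (exp (c * \<bar>t\<bar>) * (\<integral>x. (f x)\<^sup>2 \<partial>P))"
    using le nn_integral_eq_integral[OF int] by simp
  then have "(\<integral>x. (f (\<phi> t x))\<^sup>2 \<partial>P) \<le> exp (c * \<bar>t\<bar>) * (\<integral>x. (f x)\<^sup>2 \<partial>P)"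
    by (subst (asm) ennreal_le_iff) auto
  also have "exp (c * \<bar>t\<bar>) = (growth t)\<^sup>2" by (simp add: growth_def power2_eq_square mult_exp_exp)
  finally have "(l2norm P (\<lambda>x. f (\<phi> t x)))\<^sup>2 \<le> (growth t * l2norm P f)\<^sup>2"
    by (simp add: l2norm_square power_mult_distrib)
  then show "l2norm P (\<lambda>x. f (\<phi> t x)) \<le> growth t * l2norm P f"
    by (rule power2_le_imp_le) (use growth_ge_1[of t] in simp)
qed

text \<open>Composition acts on representatives, so it must respect equality almost everywhere with
  respect to \<open>P\<close>. This follows from the norm bound for \<open>f - g\<close>, whose
  seminorm is 0.\<close>

lemma flow_compose_AE:
  assumes "AE x in P. f x = g x" "f \<in> L2 P" "g \<in> L2 P"
  shows "AE x in P. f (\<phi> t x) = g (\<phi> t x)"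
proof -
  let ?h = "\<lambda>x. f x - g x"
  have h: "?h \<in> L2 P" by (rule L2_diff[OF assms(2,3)])
  have "(\<integral>x. (?h x)\<^sup>2 \<partial>P) = (\<integral>x. 0 \<partial>P)"
    using assms h by (intro integral_cong_AE) (auto simp: L2_def)
  then have "l2norm P ?h = 0" by (simp add: l2norm_def)
  then have "l2norm P (\<lambda>x. ?h (\<phi> t x)) = 0"
    using flow_compose_L2(2)[OF h, of t] l2norm_nonneg[of P "\<lambda>x. ?h (\<phi> t x)"] by simp
  then have "(\<integral>x. (?h (\<phi> t x))\<^sup>2 \<partial>P) = 0" using l2norm_square by (metis zero_power2)
  moreover have "integrable P (\<lambda>x. (?h (\<phi> t x))\<^sup>2)" using flow_compose_L2(1)[OF h, of t] by (simp add: L2_def)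
  ultimately have "AE x in P. (?h (\<phi> t x))\<^sup>2 = 0" by (simp add: integral_nonneg_eq_0_iff_AE)
  then show ?thesis by eventually_elim simp
qed

lemma C1c_L2: assumes "C1c u" shows "u \<in> L2 P"
proof -
  obtain B where B: "B \<ge> 0" "\<And>x. \<bar>u x\<bar> \<le> B" by (rule C1c_bounded[OF assms], rule that)
  show ?thesis using C1c_measurable[OF assms] B(2) by (intro bounded_L2) (auto simp: measurable_P)
qed

lemma F_grad_L2: assumes "C1c u" shows "(\<lambda>x. F x \<bullet> grad u x) \<in> L2 P"
proof -
  obtain B where B: "B \<ge> 0" "\<And>x. \<bar>F x \<bullet> grad u x\<bar> \<le> B" "\<And>x s t. \<bar>u (\<phi> s x) - u (\<phi> t x)\<bar> \<le> B * \<bar>s - t\<bar>"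
    by (rule C1c_flow_lipschitz[OF assms], rule that)
  show ?thesis using F_grad_measurable[OF assms] B(2) by (intro bounded_L2) (auto simp: measurable_P)
qed

text \<open>Clipping \<open>f\<close> at height \<open>n\<close> has an error dominated by
  \<open>\<bar>f\<bar>\<close>. The clipped function is approximated boundedly by test functions,
  and the error is dominated by the constant \<open>2 * real n + 1\<close>, which is square
  integrable for a finite measure.\<close>

lemma C1c_dense:
  assumes f: "f \<in> L2 P" and e: "e > 0"
  obtains u where "C1c u" "l2norm P (\<lambda>x. u x - f x) < e"
proof -
  have fm: "f \<in> borel_measurable lebesgue" and fi: "integrable P (\<lambda>x. (f x)\<^sup>2)"
    using f by (auto simp: L2_def measurable_P)
  define g where "g n x = max (- real n) (min (real n) (f x))" for n :: nat and x
  have gm: "g n \<in> borel_measurable lebesgue" for n unfolding g_def using fm by measurable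
  have gB: "\<bar>g n x\<bar> \<le> real n" for n x by (auto simp: g_def)
  have gL2: "g n \<in> L2 P" for n using gm gB by (intro bounded_L2) (auto simp: measurable_P)
  have "(\<lambda>n. l2norm P (\<lambda>x. g n x - f x)) \<longlonglongrightarrow> 0"
  proof (rule l2norm_dominated_convergence[OF _ fi])
    show "(\<lambda>x. g n x - f x) \<in> borel_measurable P" for n
      using gm[of n] fm unfolding measurable_P by (intro borel_measurable_diff)
    show "AE x in P. (\<lambda>n. g n x - f x) \<longlonglongrightarrow> 0"
    proof (rule AE_I2)
      fix x
      obtain N where N: "\<bar>f x\<bar> \<le> real N" using real_arch_simple by blast
      have "eventually (\<lambda>n. g n x - f x = 0) sequentially"
        using eventually_ge_at_top[of N] by eventually_elim (use N in \<open>auto simp: g_def\<close>)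
      then show "(\<lambda>n. g n x - f x) \<longlonglongrightarrow> 0" by (rule tendsto_eventually)
    qed
    show "\<bar>g n x - f x\<bar> \<le> \<bar>f x\<bar>" for n x by (auto simp: g_def)
  qed
  then have "eventually (\<lambda>n. l2norm P (\<lambda>x. g n x - f x) < e / 2) sequentially"
    using e by (intro order_tendstoD) auto
  then obtain n where n: "l2norm P (\<lambda>x. g n x - f x) < e / 2"
    using eventually_happens'[OF sequentially_bot] by blast
  obtain u where u: "\<And>k::nat. C1c (u k)" "\<And>k x. \<bar>u k x\<bar> \<le> real n + 1"
    "AE x in lebesgue. (\<lambda>k. u k x) \<longlonglongrightarrow> g n x"
    by (rule bounded_measurable_approx_C1c[OF gm gB], rule that)
  have "(\<lambda>k. l2norm P (\<lambda>x. u k x - g n x)) \<longlonglongrightarrow> 0"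
  proof (rule l2norm_dominated_convergence[where w="\<lambda>x. 2 * real n + 1"])
    show "(\<lambda>x. u k x - g n x) \<in> borel_measurable P" for k
      using gm[of n] C1c_measurable[OF u(1)] unfolding measurable_P by (intro borel_measurable_diff)
    show "AE x in P. (\<lambda>k. u k x - g n x) \<longlonglongrightarrow> 0"
      using absolutely_continuous_P[OF u(3)] by eventually_elim (rule LIM_zero)
    show "\<bar>u k x - g n x\<bar> \<le> \<bar>2 * real n + 1\<bar>" for k x using u(2)[of k x] gB[of n x] by linarith
  qed simp
  then have "eventually (\<lambda>k. l2norm P (\<lambda>x. u k x - g n x) < e / 2) sequentially"
    using e by (intro order_tendstoD) auto
  then obtain k where k: "l2norm P (\<lambda>x. u k x - g n x) < e / 2"
    using eventually_happens'[OF sequentially_bot] by blast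
  have "l2norm P (\<lambda>x. u k x - f x) < e"
    using l2norm_triangle_diff[OF C1c_L2[OF u(1)] gL2 f, of k n] n k by simp
  with u(1) that show thesis by blast
qed

lemma flow_compose_diff_le:
  assumes "f \<in> L2 P" "g \<in> L2 P"
  shows "l2norm P (\<lambda>x. f (\<phi> t x) - g (\<phi> t x)) \<le> growth t * l2norm P (\<lambda>x. f x - g x)"
  using flow_compose_L2(2)[OF L2_diff[OF assms]] .

lemma C1c_strongly_continuous:
  assumes u: "C1c u"
  shows "((\<lambda>t. l2norm P (\<lambda>x. u (\<phi> t x) - u x)) \<longlongrightarrow> 0) (at 0)"
proof -
  obtain B where B: "B \<ge> 0" "\<And>x. \<bar>u x\<bar> \<le> B" by (rule C1c_bounded[OF u], rule that)
  show ?thesis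
  proof (rule l2norm_bounded_convergence_at[where B="2 * B"])
    show "(\<lambda>x. u (\<phi> t x) - u x) \<in> borel_measurable P" for t
      unfolding measurable_P by (intro borel_measurable_diff flow_measurable_compose C1c_measurable u)
    show "((\<lambda>t. u (\<phi> t x) - u x) \<longlongrightarrow> 0) (at 0)" for x
      using DERIV_isCont[OF C1c_flow_deriv[OF u, of x 0]] by (intro LIM_zero) (simp add: isCont_def flow0)
    show "\<bar>u (\<phi> t x) - u x\<bar> \<le> 2 * B" for t x using B(2)[of x] B(2)[of "\<phi> t x"] by linarith
  qed
qed

lemma strongly_continuous_at_0:
  assumes f: "f \<in> L2 P"
  shows "((\<lambda>t. l2norm P (\<lambda>x. f (\<phi> t x) - f x)) \<longlongrightarrow> 0) (at 0)"
proof (rule tendstoI)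
  fix e :: real assume e: "e > 0"
  have M: "growth 1 \<ge> 1" by (rule growth_ge_1)
  \<comment> \<open>The divisor \<open>growth 1\<close> absorbs the norm of composition with
    \<open>\<phi> t\<close> for \<open>\<bar>t\<bar> < 1\<close>, so one approximant serves all
    these times.\<close>
  obtain u where u: "C1c u" "l2norm P (\<lambda>x. u x - f x) < e / (3 * growth 1)"
    by (rule C1c_dense[OF f, of "e / (3 * growth 1)"]) (use e M in auto)
  have u2: "growth 1 * l2norm P (\<lambda>x. u x - f x) < e / 3" using u(2) M by (simp add: field_simps)
  have u3: "l2norm P (\<lambda>x. u x - f x) < e / 3"
    using u2 mult_right_mono[OF M l2norm_nonneg[of P "\<lambda>x. u x - f x"]] by simp
  have "eventually (\<lambda>t. l2norm P (\<lambda>x. u (\<phi> t x) - u x) < e / 3) (at 0)"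
    using C1c_strongly_continuous[OF u(1)] e by (intro order_tendstoD) auto
  moreover have "eventually (\<lambda>t::real. \<bar>t\<bar> < 1) (at 0)"
    unfolding eventually_at by (auto intro!: exI[of _ 1] simp: dist_real_def)
  ultimately show "eventually (\<lambda>t. dist (l2norm P (\<lambda>x. f (\<phi> t x) - f x)) 0 < e) (at 0)"
  proof eventually_elim
    case (elim t)
    note uL = C1c_L2[OF u(1)]
    have "l2norm P (\<lambda>x. f (\<phi> t x) - f x) \<le> l2norm P (\<lambda>x. f (\<phi> t x) - u (\<phi> t x)) + l2norm P (\<lambda>x. u (\<phi> t x) - f x)"
      by (intro l2norm_triangle_diff flow_compose_L2 f uL)
    moreover have "l2norm P (\<lambda>x. u (\<phi> t x) - f x) \<le> l2norm P (\<lambda>x. u (\<phi> t x) - u x) + l2norm P (\<lambda>x. u x - f x)"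
      by (intro l2norm_triangle_diff flow_compose_L2 f uL)
    moreover have "l2norm P (\<lambda>x. f (\<phi> t x) - u (\<phi> t x)) \<le> growth t * l2norm P (\<lambda>x. f x - u x)"
      by (rule flow_compose_diff_le[OF f uL])
    moreover have "growth t * l2norm P (\<lambda>x. f x - u x) \<le> growth 1 * l2norm P (\<lambda>x. u x - f x)"
      unfolding l2norm_minus_commute[of P f u] using elim by (intro mult_right_mono growth_mono) auto
    ultimately show ?case using elim u2 u3 by simp
  qed
qed

lemma sc_group_flow: "sc_group P (\<lambda>t f x. f (\<phi> t x))"
  unfolding sc_group_def
proof (intro conjI allI ballI impI)
  show "\<exists>C. \<forall>f\<in>L2 P. l2norm P (\<lambda>x. f (\<phi> t x)) \<le> C * l2norm P f" for t
    using flow_compose_L2(2) by blast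
  show "((\<lambda>t. l2norm P (\<lambda>x. f (\<phi> t x) - f (\<phi> t0 x))) \<longlongrightarrow> 0) (at t0)" if f: "f \<in> L2 P" for f t0
  proof -
    have lim: "((\<lambda>h. growth t0 * l2norm P (\<lambda>x. f (\<phi> h x) - f x)) \<longlongrightarrow> 0) (at 0)"
      using tendsto_mult_left[OF strongly_continuous_at_0[OF f], of "growth t0"] by simp
    \<comment> \<open>Writing the increment at \<open>t0\<close> as the increment at 0 composed with
      \<open>\<phi> t0\<close> reduces continuity at any time to continuity at 0.\<close>
    have le: "l2norm P (\<lambda>x. f (\<phi> (t0 + h) x) - f (\<phi> t0 x)) \<le> growth t0 * l2norm P (\<lambda>x. f (\<phi> h x) - f x)" for h
      unfolding add.commute[of t0 h] flow_add' by (rule flow_compose_diff_le[OF flow_compose_L2(1)[OF f] f])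
    have "((\<lambda>h. l2norm P (\<lambda>x. f (\<phi> (t0 + h) x) - f (\<phi> t0 x))) \<longlongrightarrow> 0) (at 0)"
      by (rule Lim_null_comparison[OF always_eventually lim]) (simp add: le)
    then show ?thesis by (rule LIM_offset_zero_cancel)
  qed
  \<comment> \<open>Composition reverses the order of the flow maps: applying the operator for
    \<open>t\<close> and then that for \<open>s\<close> evaluates \<open>f\<close> at
    \<open>\<phi> t (\<phi> s x)\<close>, so the group law holds because times commute.\<close>
  show "AE x in P. f (\<phi> (s + t) x) = f (\<phi> t (\<phi> s x))" for f s t
    by (simp add: add.commute[of s t] flow_add')
  show "AE x in P. f (\<phi> t x) = g (\<phi> t x)" if "f \<in> L2 P" "g \<in> L2 P" "AE x in P. f x = g x" for f g t
    using flow_compose_AE that by blast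
qed (auto simp: flow0 intro: flow_compose_L2)

end

section \<open>The generator and its core of test functions\<close>

context koopman
begin

lemma C1c_difference_quotient:
  assumes u: "C1c u"
  shows "((\<lambda>t. l2norm P (\<lambda>x. (u (\<phi> t x) - u x) / t - F x \<bullet> grad u x)) \<longlongrightarrow> 0) (at 0)"
proof -
  obtain B where B: "B \<ge> 0" "\<And>x. \<bar>F x \<bullet> grad u x\<bar> \<le> B" "\<And>x s t. \<bar>u (\<phi> s x) - u (\<phi> t x)\<bar> \<le> B * \<bar>s - t\<bar>"
    by (rule C1c_flow_lipschitz[OF u], rule that)
  show ?thesis
  proof (rule l2norm_bounded_convergence_at[where B="2 * B"])
    show "(\<lambda>x. (u (\<phi> t x) - u x) / t - F x \<bullet> grad u x) \<in> borel_measurable P" for t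
      unfolding measurable_P
      by (intro borel_measurable_diff borel_measurable_divide borel_measurable_const
          C1c_measurable[OF u] flow_measurable_compose[OF C1c_measurable[OF u]] F_grad_measurable[OF u])
    show "((\<lambda>t. (u (\<phi> t x) - u x) / t - F x \<bullet> grad u x) \<longlongrightarrow> 0) (at 0)" for x
      using C1c_flow_deriv[OF u, of x 0] by (intro LIM_zero) (simp add: DERIV_def flow0)
    show "\<bar>(u (\<phi> t x) - u x) / t - F x \<bullet> grad u x\<bar> \<le> 2 * B" for t x
    proof -
      \<comment> \<open>At \<open>t = 0\<close> division returns 0, so the bound holds for every
        \<open>t\<close>.\<close>
      have "\<bar>(u (\<phi> t x) - u x) / t\<bar> \<le> B"
        using B(3)[of t x 0] B(1) by (cases "t = 0") (simp_all add: flow0 divide_le_eq)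
      then show ?thesis using B(2)[of x] by linarith
    qed
  qed
qed

text \<open>The difference quotient at time \<open>s\<close> is the one at time 0 composed with
  \<open>\<phi> s\<close>, so its error grows by at most \<open>growth s\<close>; Cauchy-Schwarz
  pairs it with \<open>h\<close>. Passing to real functions of time makes the real mean value
  inequality available.\<close>

lemma inner_flow_deriv:
  assumes u: "C1c u" and h: "h \<in> L2 P"
  shows "((\<lambda>s. \<integral>x. u (\<phi> s x) * h x \<partial>P) has_real_derivative
    (\<integral>x. F (\<phi> s x) \<bullet> grad u (\<phi> s x) * h x \<partial>P)) (at s)"
  unfolding DERIV_def
proof (rule LIM_zero_cancel, rule Lim_null_comparison)
  note uL = C1c_L2[OF u] and gL = F_grad_L2[OF u]
  have "((\<lambda>k. growth s * l2norm P (\<lambda>x. (u (\<phi> k x) - u x) / k - F x \<bullet> grad u x) * l2norm P h) \<longlongrightarrow>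
      growth s * 0 * l2norm P h) (at 0)"
    by (intro tendsto_mult tendsto_const C1c_difference_quotient u)
  then show "((\<lambda>k. growth s * l2norm P (\<lambda>x. (u (\<phi> k x) - u x) / k - F x \<bullet> grad u x) * l2norm P h) \<longlongrightarrow> 0) (at 0)"
    by simp
  have "norm (((\<integral>x. u (\<phi> (s + k) x) * h x \<partial>P) - (\<integral>x. u (\<phi> s x) * h x \<partial>P)) / k
      - (\<integral>x. F (\<phi> s x) \<bullet> grad u (\<phi> s x) * h x \<partial>P))
    \<le> growth s * l2norm P (\<lambda>x. (u (\<phi> k x) - u x) / k - F x \<bullet> grad u x) * l2norm P h" for k
  proof -
    let ?w = "\<lambda>x. (u (\<phi> k x) - u x) / k - F x \<bullet> grad u x"
    have w: "?w \<in> L2 P" by (intro L2_diff L2_divide flow_compose_L2 uL gL)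
    have i1: "integrable P (\<lambda>x. u (\<phi> (s + k) x) * h x)" by (intro L2_mult_integrable flow_compose_L2 uL h)
    have i2: "integrable P (\<lambda>x. u (\<phi> s x) * h x)" by (intro L2_mult_integrable flow_compose_L2 uL h)
    have i3: "integrable P (\<lambda>x. F (\<phi> s x) \<bullet> grad u (\<phi> s x) * h x)"
      by (intro L2_mult_integrable flow_compose_L2(1)[OF gL] h)
    have "((\<integral>x. u (\<phi> (s + k) x) * h x \<partial>P) - (\<integral>x. u (\<phi> s x) * h x \<partial>P)) / k
      - (\<integral>x. F (\<phi> s x) \<bullet> grad u (\<phi> s x) * h x \<partial>P)
      = (\<integral>x. (u (\<phi> (s + k) x) * h x - u (\<phi> s x) * h x) / k - F (\<phi> s x) \<bullet> grad u (\<phi> s x) * h x \<partial>P)"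
      using i1 i2 i3 by simp
    also have "\<dots> = (\<integral>x. ?w (\<phi> s x) * h x \<partial>P)"
      by (rule Bochner_Integration.integral_cong)
        (auto simp: add.commute[of s k] flow_add' left_diff_distrib diff_divide_distrib)
    also have "norm \<dots> \<le> l2norm P (\<lambda>x. ?w (\<phi> s x)) * l2norm P h"
      using l2norm_Cauchy_Schwarz[OF flow_compose_L2(1)[OF w, of s] h] by simp
    also have "\<dots> \<le> growth s * l2norm P ?w * l2norm P h"
      by (intro mult_right_mono flow_compose_L2(2)[OF w]) simp
    finally show ?thesis .
  qed
  then show "\<forall>\<^sub>F k in at 0. norm (((\<integral>x. u (\<phi> (s + k) x) * h x \<partial>P) - (\<integral>x. u (\<phi> s x) * h x \<partial>P)) / k
      - (\<integral>x. F (\<phi> s x) \<bullet> grad u (\<phi> s x) * h x \<partial>P))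
    \<le> growth s * l2norm P (\<lambda>x. (u (\<phi> k x) - u x) / k - F x \<bullet> grad u x) * l2norm P h"
    by (intro always_eventually allI)
qed

text \<open>The remainder is tested against itself. With \<open>h\<close> the remainder at time
  \<open>t\<close>, the increment of \<open>\<eta>\<close> over the interval is
  \<open>(l2norm P h)\<^sup>2\<close>, while its derivative is at most
  \<open>b * l2norm P h\<close>; dividing by \<open>l2norm P h\<close> leaves the claim. This
  replaces the integral of the derivative along the group.\<close>

lemma C1c_taylor_bound:
  assumes u: "C1c u"
    and b: "\<And>s. \<bar>s\<bar> \<le> \<bar>t\<bar> \<Longrightarrow> l2norm P (\<lambda>x. F (\<phi> s x) \<bullet> grad u (\<phi> s x) - F x \<bullet> grad u x) \<le> b"
  shows "l2norm P (\<lambda>x. u (\<phi> t x) - u x - t * (F x \<bullet> grad u x)) \<le> b * \<bar>t\<bar>"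
proof -
  note uL = C1c_L2[OF u] and gL = F_grad_L2[OF u]
  define h where "h x = u (\<phi> t x) - u x - t * (F x \<bullet> grad u x)" for x
  have hL: "h \<in> L2 P" unfolding h_def by (intro L2_diff L2_scale flow_compose_L2 uL gL)
  define \<eta> where "\<eta> s = (\<integral>x. u (\<phi> s x) * h x \<partial>P) - s * (\<integral>x. F x \<bullet> grad u x * h x \<partial>P)" for s
  have "norm (\<eta> t - \<eta> 0) \<le> b * l2norm P h * norm (t - 0)"
  proof (rule field_differentiable_bound[of "{-\<bar>t\<bar>..\<bar>t\<bar>}"])
    fix s assume s: "s \<in> {-\<bar>t\<bar>..\<bar>t\<bar>}"
    have "(\<eta> has_real_derivative ((\<integral>x. F (\<phi> s x) \<bullet> grad u (\<phi> s x) * h x \<partial>P) - 1 * (\<integral>x. F x \<bullet> grad u x * h x \<partial>P))) (at s)"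
      unfolding \<eta>_def by (intro DERIV_diff inner_flow_deriv u hL DERIV_cmult_right DERIV_ident)
    then show "(\<eta> has_real_derivative ((\<integral>x. F (\<phi> s x) \<bullet> grad u (\<phi> s x) * h x \<partial>P) - 1 * (\<integral>x. F x \<bullet> grad u x * h x \<partial>P)))
        (at s within {-\<bar>t\<bar>..\<bar>t\<bar>})"
      by (rule has_field_derivative_at_within)
    have i1: "integrable P (\<lambda>x. F (\<phi> s x) \<bullet> grad u (\<phi> s x) * h x)"
      by (intro L2_mult_integrable flow_compose_L2(1)[OF gL] hL)
    have i2: "integrable P (\<lambda>x. F x \<bullet> grad u x * h x)" by (intro L2_mult_integrable gL hL)
    have "(\<integral>x. F (\<phi> s x) \<bullet> grad u (\<phi> s x) * h x \<partial>P) - 1 * (\<integral>x. F x \<bullet> grad u x * h x \<partial>P)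
      = (\<integral>x. (F (\<phi> s x) \<bullet> grad u (\<phi> s x) - F x \<bullet> grad u x) * h x \<partial>P)"
      using i1 i2 by (simp add: left_diff_distrib)
    also have "norm \<dots> \<le> l2norm P (\<lambda>x. F (\<phi> s x) \<bullet> grad u (\<phi> s x) - F x \<bullet> grad u x) * l2norm P h"
      using l2norm_Cauchy_Schwarz[OF L2_diff[OF flow_compose_L2(1)[OF gL] gL] hL, of s] by simp
    also have "\<dots> \<le> b * l2norm P h"
      using s by (intro mult_right_mono b) auto
    finally show "norm ((\<integral>x. F (\<phi> s x) \<bullet> grad u (\<phi> s x) * h x \<partial>P) - 1 * (\<integral>x. F x \<bullet> grad u x * h x \<partial>P)) \<le> b * l2norm P h" .
  qed auto
  moreover have "\<eta> t - \<eta> 0 = (l2norm P h)\<^sup>2"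
  proof -
    have i1: "integrable P (\<lambda>x. u (\<phi> t x) * h x)" by (intro L2_mult_integrable flow_compose_L2(1)[OF uL] hL)
    have i2: "integrable P (\<lambda>x. u x * h x)" by (intro L2_mult_integrable uL hL)
    have i3: "integrable P (\<lambda>x. F x \<bullet> grad u x * h x)" by (intro L2_mult_integrable gL hL)
    have "(l2norm P h)\<^sup>2 = (\<integral>x. u (\<phi> t x) * h x - u x * h x - t * (F x \<bullet> grad u x * h x) \<partial>P)"
      unfolding l2norm_square
      by (rule Bochner_Integration.integral_cong) (auto simp: h_def power2_eq_square algebra_simps)
    also have "\<dots> = \<eta> t - \<eta> 0" using i1 i2 i3 by (simp add: \<eta>_def flow0)
    finally show ?thesis by simp
  qed
  ultimately have le: "l2norm P h * l2norm P h \<le> b * \<bar>t\<bar> * l2norm P h"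
    by (simp add: power2_eq_square mult_ac)
  have "l2norm P h \<le> b * \<bar>t\<bar>"
  proof (cases "l2norm P h = 0")
    case True
    have "0 \<le> b" using b[of 0] by (rule order_trans[OF l2norm_nonneg]) simp
    then show ?thesis using True by simp
  next
    case False
    then have "l2norm P h > 0" using l2norm_nonneg[of P h] by linarith
    then show ?thesis using le by (rule mult_right_le_imp_le[rotated])
  qed
  then show ?thesis by (simp add: h_def[abs_def])
qed

text \<open>The Taylor bound for \<open>u k\<close> involves the modulus of continuity of
  \<open>F \<bullet> grad (u k)\<close> along the group, which differs from that of \<open>g\<close>
  by the graph error. Letting \<open>k\<close> tend to infinity at fixed \<open>t\<close> leaves a
  bound that depends on \<open>g\<close> alone, and only afterwards does \<open>t\<close> tend to
  0.\<close>

lemma closure_imp_generator: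
  assumes "closure_rel P F f g"
  shows "generator_rel P (\<lambda>t f x. f (\<phi> t x)) f g"
proof -
  obtain u where f: "f \<in> L2 P" and g: "g \<in> L2 P" and u: "\<And>k::nat. C1c (u k)"
    and uf: "(\<lambda>k. l2norm P (\<lambda>x. u k x - f x)) \<longlonglongrightarrow> 0"
    and ug: "(\<lambda>k. l2norm P (\<lambda>x. F x \<bullet> grad (u k) x - g x)) \<longlonglongrightarrow> 0"
    using assms unfolding closure_rel_def by auto
  note uL = C1c_L2[OF u] and gL = F_grad_L2[OF u]
  have "((\<lambda>t. l2norm P (\<lambda>x. (f (\<phi> t x) - f x) / t - g x)) \<longlongrightarrow> 0) (at 0)"
  proof (rule tendstoI)
    fix e :: real assume e: "e > 0"
    have "eventually (\<lambda>s. l2norm P (\<lambda>x. g (\<phi> s x) - g x) < e / 2) (at 0)"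
      using strongly_continuous_at_0[OF g] e by (intro order_tendstoD) auto
    then obtain \<tau> where tau: "\<tau> > 0" "\<And>s. s \<noteq> 0 \<Longrightarrow> \<bar>s\<bar> < \<tau> \<Longrightarrow> l2norm P (\<lambda>x. g (\<phi> s x) - g x) < e / 2"
      unfolding eventually_at by (auto simp: dist_real_def)
    have gs: "l2norm P (\<lambda>x. g (\<phi> s x) - g x) \<le> e / 2" if "\<bar>s\<bar> < \<tau>" for s
      using tau(2)[of s] that e by (cases "s = 0") (auto simp: flow0 l2norm_def)
    have main: "l2norm P (\<lambda>x. f (\<phi> t x) - f x - t * g x) \<le> e / 2 * \<bar>t\<bar>" if t: "\<bar>t\<bar> < \<tau>" for t
    proof (rule LIMSEQ_le_const)
      let ?d = "\<lambda>k. l2norm P (\<lambda>x. F x \<bullet> grad (u k) x - g x)"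
      let ?a = "\<lambda>k. l2norm P (\<lambda>x. u k x - f x)"
      show "(\<lambda>k. growth t * ?a k + ?a k + \<bar>t\<bar> * ?d k + (e / 2 + (growth t + 1) * ?d k) * \<bar>t\<bar>) \<longlonglongrightarrow> e / 2 * \<bar>t\<bar>"
        by (rule tendsto_eq_intros uf ug refl | simp)+
      have "l2norm P (\<lambda>x. f (\<phi> t x) - f x - t * g x) \<le>
        growth t * ?a k + ?a k + \<bar>t\<bar> * ?d k + (e / 2 + (growth t + 1) * ?d k) * \<bar>t\<bar>" for k
      proof -
        let ?G = "\<lambda>x. F x \<bullet> grad (u k) x"
        let ?p = "\<lambda>x. u k (\<phi> t x) - u k x - t * ?G x"
        have "l2norm P (\<lambda>x. ?G (\<phi> s x) - ?G x) \<le> e / 2 + (growth t + 1) * ?d k" if s: "\<bar>s\<bar> \<le> \<bar>t\<bar>" for s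
        proof -
          have "l2norm P (\<lambda>x. ?G (\<phi> s x) - ?G x) \<le> l2norm P (\<lambda>x. ?G (\<phi> s x) - g (\<phi> s x)) + l2norm P (\<lambda>x. g (\<phi> s x) - ?G x)"
            by (intro l2norm_triangle_diff flow_compose_L2(1)[OF gL] flow_compose_L2(1)[OF g] gL)
          also have "l2norm P (\<lambda>x. g (\<phi> s x) - ?G x) \<le> l2norm P (\<lambda>x. g (\<phi> s x) - g x) + l2norm P (\<lambda>x. g x - ?G x)"
            by (intro l2norm_triangle_diff flow_compose_L2(1)[OF g] gL g)
          also have "l2norm P (\<lambda>x. g (\<phi> s x) - g x) \<le> e / 2" using s t by (intro gs) auto
          also have "l2norm P (\<lambda>x. ?G (\<phi> s x) - g (\<phi> s x)) \<le> growth s * ?d k" by (rule flow_compose_diff_le[OF gL g])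
          also have "growth s * ?d k \<le> growth t * ?d k" by (intro mult_right_mono growth_mono s) simp
          finally show ?thesis using l2norm_minus_commute[of P g ?G] by (simp add: algebra_simps)
        qed
        from C1c_taylor_bound[OF u this]
        have p: "l2norm P ?p \<le> (e / 2 + (growth t + 1) * ?d k) * \<bar>t\<bar>" .
        have pL: "?p \<in> L2 P" by (intro L2_diff L2_scale flow_compose_L2(1)[OF uL] uL gL)
        have q1: "(\<lambda>x. f (\<phi> t x) - u k (\<phi> t x)) \<in> L2 P" by (intro L2_diff flow_compose_L2 f uL)
        have q2: "(\<lambda>x. u k x - f x) \<in> L2 P" by (intro L2_diff f uL)
        have q3: "(\<lambda>x. t * (?G x - g x)) \<in> L2 P" by (intro L2_scale L2_diff g gL)
        have "(\<lambda>x. f (\<phi> t x) - f x - t * g x) =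
          (\<lambda>x. ((f (\<phi> t x) - u k (\<phi> t x)) + (u k x - f x)) + (t * (?G x - g x) + ?p x))"
          by (auto simp: algebra_simps)
        then have "l2norm P (\<lambda>x. f (\<phi> t x) - f x - t * g x) \<le>
            l2norm P (\<lambda>x. (f (\<phi> t x) - u k (\<phi> t x)) + (u k x - f x)) + l2norm P (\<lambda>x. t * (?G x - g x) + ?p x)"
          using l2norm_triangle[OF L2_add[OF q1 q2] L2_add[OF q3 pL]] by simp
        also have "l2norm P (\<lambda>x. (f (\<phi> t x) - u k (\<phi> t x)) + (u k x - f x)) \<le>
            l2norm P (\<lambda>x. f (\<phi> t x) - u k (\<phi> t x)) + l2norm P (\<lambda>x. u k x - f x)"
          by (rule l2norm_triangle[OF q1 q2])
        also have "l2norm P (\<lambda>x. t * (?G x - g x) + ?p x) \<le> l2norm P (\<lambda>x. t * (?G x - g x)) + l2norm P ?p"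
          by (rule l2norm_triangle[OF q3 pL])
        also have "l2norm P (\<lambda>x. t * (?G x - g x)) = \<bar>t\<bar> * ?d k" by (rule l2norm_scale)
        also have "l2norm P (\<lambda>x. f (\<phi> t x) - u k (\<phi> t x)) \<le> growth t * ?a k"
          using flow_compose_diff_le[OF f uL[of k], of t] l2norm_minus_commute[of P f "u k"] by simp
        finally show ?thesis using p by simp
      qed
      then show "\<exists>N. \<forall>k\<ge>N. l2norm P (\<lambda>x. f (\<phi> t x) - f x - t * g x) \<le>
        growth t * ?a k + ?a k + \<bar>t\<bar> * ?d k + (e / 2 + (growth t + 1) * ?d k) * \<bar>t\<bar>" by blast
    qed
    have "l2norm P (\<lambda>x. (f (\<phi> t x) - f x) / t - g x) < e" if t: "t \<noteq> 0" "\<bar>t\<bar> < \<tau>" for t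
    proof -
      have "(\<lambda>x. (f (\<phi> t x) - f x) / t - g x) = (\<lambda>x. (f (\<phi> t x) - f x - t * g x) / t)"
        using t by (auto simp: diff_divide_distrib)
      then have "l2norm P (\<lambda>x. (f (\<phi> t x) - f x) / t - g x) = l2norm P (\<lambda>x. f (\<phi> t x) - f x - t * g x) / \<bar>t\<bar>"
        by (simp only: l2norm_divide)
      also have "\<dots> \<le> e / 2" using main[OF t(2)] t(1) by (simp add: divide_le_eq)
      finally show ?thesis using e by simp
    qed
    then show "eventually (\<lambda>t. dist (l2norm P (\<lambda>x. (f (\<phi> t x) - f x) / t - g x)) 0 < e) (at 0)"
      unfolding eventually_at using tau(1) by (intro exI[of _ \<tau>]) (auto simp: dist_real_def)
  qed
  with f g show ?thesis by (simp add: generator_rel_def)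
qed

text \<open>Averages of \<open>v \<circ> \<phi> s\<close> over \<open>s \<in> [0, t]\<close> approximate elements of the generator domain in the graph
  norm; replacing them by Riemann sums keeps the approximants in \<open>C\<^sup>1\<^sub>c\<close>.\<close>

lemma generator_graph_approx:
  assumes gen: "generator_rel P (\<lambda>t f x. f (\<phi> t x)) f g" and e: "e > 0"
  obtains u where "C1c u" "l2norm P (\<lambda>x. u x - f x) < e" "l2norm P (\<lambda>x. F x \<bullet> grad u x - g x) < e"
proof -
  have f: "f \<in> L2 P" and g: "g \<in> L2 P"
    and q: "((\<lambda>t. l2norm P (\<lambda>x. (f (\<phi> t x) - f x) / t - g x)) \<longlongrightarrow> 0) (at 0)"
    using gen by (auto simp: generator_rel_def)
  \<comment> \<open>Three errors of this size meet in the estimate for \<open>g\<close>: the Riemann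
    sum, the exchange of \<open>f\<close> for \<open>v\<close> in the quotient, and the quotient of
    \<open>f\<close> itself. The estimate for \<open>f\<close> collects two.\<close>
  define \<epsilon> where "\<epsilon> = e / 4"
  have eps: "\<epsilon> > 0" using e by (simp add: \<epsilon>_def)
  have "eventually (\<lambda>t. l2norm P (\<lambda>x. (f (\<phi> t x) - f x) / t - g x) < \<epsilon>) (at 0)"
    using q eps by (intro order_tendstoD) auto
  moreover have "eventually (\<lambda>t. l2norm P (\<lambda>x. f (\<phi> t x) - f x) < \<epsilon>) (at 0)"
    using strongly_continuous_at_0[OF f] eps by (intro order_tendstoD) auto
  ultimately have "eventually (\<lambda>t. l2norm P (\<lambda>x. (f (\<phi> t x) - f x) / t - g x) < \<epsilon> \<and> l2norm P (\<lambda>x. f (\<phi> t x) - f x) < \<epsilon>) (at 0)"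
    by (rule eventually_conj)
  then obtain \<tau> where tau: "\<tau> > 0" "\<And>s. s \<noteq> 0 \<Longrightarrow> \<bar>s\<bar> < \<tau> \<Longrightarrow>
      l2norm P (\<lambda>x. (f (\<phi> s x) - f x) / s - g x) < \<epsilon> \<and> l2norm P (\<lambda>x. f (\<phi> s x) - f x) < \<epsilon>"
    unfolding eventually_at by (auto simp: dist_real_def)
  define t where "t = min 1 (\<tau> / 2)"
  have t: "t > 0" "t \<le> 1" "t < \<tau>" using tau(1) by (auto simp: t_def)
  have qt: "l2norm P (\<lambda>x. (f (\<phi> t x) - f x) / t - g x) < \<epsilon>" using tau(2)[of t] t by simp
  have ct: "l2norm P (\<lambda>x. f (\<phi> s x) - f x) \<le> \<epsilon>" if "\<bar>s\<bar> \<le> t" for s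
    using tau(2)[of s] that t eps by (cases "s = 0") (auto simp: flow0 l2norm_def)
  define M where "M = growth t"
  have M1: "M \<ge> 1" unfolding M_def by (rule growth_ge_1)
  have Ms: "growth s \<le> M" if "\<bar>s\<bar> \<le> t" for s unfolding M_def using that by (intro growth_mono) auto
  \<comment> \<open>The time \<open>t\<close> is fixed before \<open>v\<close> is chosen, so the
    exchange of \<open>f\<close> for \<open>v\<close> stays small even after division by
    \<open>t\<close>: \<open>(M + 1) * \<delta> / t = \<epsilon>\<close>.\<close>
  define \<delta> where "\<delta> = \<epsilon> * t / (1 + M)"
  have d: "\<delta> > 0" using eps t M1 by (simp add: \<delta>_def)
  obtain v where v: "C1c v" "l2norm P (\<lambda>x. v x - f x) < \<delta>" by (rule C1c_dense[OF f d], rule that)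
  note vL = C1c_L2[OF v(1)]
  let ?G = "\<lambda>x. F x \<bullet> grad v x"
  have gL: "?G \<in> L2 P" by (rule F_grad_L2[OF v(1)])
  have "eventually (\<lambda>h. l2norm P (\<lambda>x. (v (\<phi> h x) - v x) / h - ?G x) < \<epsilon> / M) (at 0)"
    using C1c_difference_quotient[OF v(1)] eps M1 by (intro order_tendstoD) auto
  then obtain \<tau>' where tau': "\<tau>' > 0" "\<And>h. h \<noteq> 0 \<Longrightarrow> \<bar>h\<bar> < \<tau>' \<Longrightarrow>
      l2norm P (\<lambda>x. (v (\<phi> h x) - v x) / h - ?G x) < \<epsilon> / M"
    unfolding eventually_at by (auto simp: dist_real_def)
  obtain N :: nat where N: "real N > t / \<tau>'" using reals_Archimedean2 by blast
  have "t / \<tau>' > 0" using t tau'(1) by simp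
  then have N0: "N > 0" using N of_nat_0_less_iff[where 'a=real] by (metis less_trans)
  define h where "h = t / real N"
  have h: "h > 0" "\<bar>h\<bar> < \<tau>'" using N N0 t tau'(1) by (auto simp: h_def field_simps)
  have jh: "\<bar>real j * h\<bar> \<le> t" if "j < N" for j
  proof -
    have "real j * h \<le> real N * h" using that h by (intro mult_right_mono) auto
    also have "\<dots> = t" using N0 by (simp add: h_def)
    finally show ?thesis using h by (simp add: abs_mult)
  qed
  let ?w = "\<lambda>x. (v (\<phi> h x) - v x) / h - ?G x"
  have wL: "?w \<in> L2 P" by (intro L2_diff L2_divide flow_compose_L2(1)[OF vL] vL gL)
  have w: "l2norm P ?w < \<epsilon> / M" using tau'(2)[of h] h by simp
  \<comment> \<open>The left-endpoint Riemann sum, with mesh \<open>h\<close>, of the mean of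
    \<open>v \<circ> \<phi> s\<close> over \<open>[0, t]\<close>.\<close>
  define u where "u x = (\<Sum>j<N. (1 / real N) * v (\<phi> (real j * h) x))" for x
  have uj: "C1c (\<lambda>x. (1 / real N) * v (\<phi> (real j * h) x))" for j
    by (rule C1c_scale[OF C1c_flow(1)[OF v(1)]])
  have uC: "C1c u" and gu: "grad u = (\<lambda>x. \<Sum>j<N. grad (\<lambda>x. (1 / real N) * v (\<phi> (real j * h) x)) x)"
    using C1c_sum[of "{..<N}" "\<lambda>j x. (1 / real N) * v (\<phi> (real j * h) x)"] uj by (auto simp: u_def[abs_def])
  have Fu: "F x \<bullet> grad u x = (\<Sum>j<N. (1 / real N) * ?G (\<phi> (real j * h) x))" for x
  proof -
    have "grad (\<lambda>x. (1 / real N) * v (\<phi> (real j * h) x)) x = (1 / real N) *\<^sub>R grad (\<lambda>x. v (\<phi> (real j * h) x)) x" for j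
      using grad_scale[of "\<lambda>x. v (\<phi> (real j * h) x)" "1 / real N"] C1c_flow(1)[OF v(1), of "real j * h"]
      by (simp add: C1c_iff)
    then show ?thesis by (simp add: gu inner_sum_right C1c_flow(2)[OF v(1)])
  qed
  have avg: "(\<Sum>j<N. (1 / real N) * b) = b" for b :: real using N0 by simp
  have uf: "l2norm P (\<lambda>x. u x - f x) \<le> M * \<delta> + \<epsilon>"
  proof -
    have "(\<lambda>x. u x - f x) = (\<lambda>x. \<Sum>j<N. (1 / real N) * (v (\<phi> (real j * h) x) - f x))"
    proof
      fix x
      have "u x - f x = (\<Sum>j<N. (1 / real N) * v (\<phi> (real j * h) x)) - (\<Sum>j<N. (1 / real N) * f x)"
        unfolding u_def avg ..
      also have "\<dots> = (\<Sum>j<N. (1 / real N) * (v (\<phi> (real j * h) x) - f x))"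
        by (simp only: sum_subtractf[symmetric] right_diff_distrib)
      finally show "u x - f x = (\<Sum>j<N. (1 / real N) * (v (\<phi> (real j * h) x) - f x))" .
    qed
    then have "l2norm P (\<lambda>x. u x - f x) \<le> (\<Sum>j<N. l2norm P (\<lambda>x. (1 / real N) * (v (\<phi> (real j * h) x) - f x)))"
      by (simp only:) (intro l2norm_sum_le L2_scale L2_diff flow_compose_L2(1)[OF vL] f, simp)
    also have "\<dots> \<le> (\<Sum>j<N. (1 / real N) * (M * \<delta> + \<epsilon>))"
    proof (rule sum_mono)
      fix j assume "j \<in> {..<N}"
      then have j: "\<bar>real j * h\<bar> \<le> t" using jh by simp
      let ?s = "real j * h"
      have "l2norm P (\<lambda>x. v (\<phi> ?s x) - f x) \<le> l2norm P (\<lambda>x. v (\<phi> ?s x) - f (\<phi> ?s x)) + l2norm P (\<lambda>x. f (\<phi> ?s x) - f x)"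
        by (intro l2norm_triangle_diff flow_compose_L2(1)[OF vL] flow_compose_L2(1)[OF f] f)
      also have "l2norm P (\<lambda>x. v (\<phi> ?s x) - f (\<phi> ?s x)) \<le> growth ?s * l2norm P (\<lambda>x. v x - f x)"
        by (rule flow_compose_diff_le[OF vL f])
      also have "\<dots> \<le> M * \<delta>" using v(2) M1 by (intro mult_mono Ms j) auto
      also have "l2norm P (\<lambda>x. f (\<phi> ?s x) - f x) \<le> \<epsilon>" by (rule ct[OF j])
      finally have "l2norm P (\<lambda>x. v (\<phi> ?s x) - f x) \<le> M * \<delta> + \<epsilon>" by simp
      then show "l2norm P (\<lambda>x. (1 / real N) * (v (\<phi> ?s x) - f x)) \<le> (1 / real N) * (M * \<delta> + \<epsilon>)"
        unfolding l2norm_scale by (simp add: divide_right_mono)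
    qed
    also have "\<dots> = M * \<delta> + \<epsilon>" by (rule avg)
    finally show ?thesis .
  qed
  have uq: "l2norm P (\<lambda>x. F x \<bullet> grad u x - (v (\<phi> t x) - v x) / t) \<le> \<epsilon>"
  proof -
    \<comment> \<open>Telescoping turns the quotient over \<open>t\<close> into the average of
      quotients over the mesh \<open>h\<close>, taken along the orbit. Compared with
      \<open>Fu\<close> term by term, the difference is the average of \<open>- ?w\<close> moved by
      the flow, and \<open>?w\<close> is small by the choice of \<open>N\<close>.\<close>
    have tel: "(v (\<phi> t x) - v x) / t = (\<Sum>j<N. (1 / real N) * ((v (\<phi> h (\<phi> (real j * h) x)) - v (\<phi> (real j * h) x)) / h))" for x
    proof -
      have "(\<Sum>j<N. v (\<phi> h (\<phi> (real j * h) x)) - v (\<phi> (real j * h) x)) =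
        (\<Sum>j<N. v (\<phi> (real (Suc j) * h) x) - v (\<phi> (real j * h) x))"
        by (simp add: flow_add'[symmetric] algebra_simps)
      also have "\<dots> = v (\<phi> (real N * h) x) - v (\<phi> (real 0 * h) x)" by (rule sum_lessThan_telescope)
      also have "\<dots> = v (\<phi> t x) - v x" using N0 by (simp add: h_def flow0)
      finally have "v (\<phi> t x) - v x = (\<Sum>j<N. v (\<phi> h (\<phi> (real j * h) x)) - v (\<phi> (real j * h) x))" ..
      then have "(v (\<phi> t x) - v x) / t = (\<Sum>j<N. (v (\<phi> h (\<phi> (real j * h) x)) - v (\<phi> (real j * h) x)) / t)"
        by (simp only: sum_divide_distrib)
      also have "\<dots> = (\<Sum>j<N. (1 / real N) * ((v (\<phi> h (\<phi> (real j * h) x)) - v (\<phi> (real j * h) x)) / h))"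
        by (intro sum.cong refl) (use N0 in \<open>simp add: h_def\<close>)
      finally show ?thesis .
    qed
    have "(\<lambda>x. F x \<bullet> grad u x - (v (\<phi> t x) - v x) / t) = (\<lambda>x. \<Sum>j<N. (- 1 / real N) * ?w (\<phi> (real j * h) x))"
      unfolding Fu tel sum_subtractf[symmetric]
      by (intro ext sum.cong refl) (simp add: algebra_simps diff_divide_distrib)
    then have "l2norm P (\<lambda>x. F x \<bullet> grad u x - (v (\<phi> t x) - v x) / t) \<le>
        (\<Sum>j<N. l2norm P (\<lambda>x. (- 1 / real N) * ?w (\<phi> (real j * h) x)))"
      by (simp only:) (intro l2norm_sum_le L2_scale flow_compose_L2(1)[OF wL], simp)
    also have "\<dots> \<le> (\<Sum>j<N. (1 / real N) * \<epsilon>)"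
    proof (rule sum_mono)
      fix j assume "j \<in> {..<N}"
      then have j: "\<bar>real j * h\<bar> \<le> t" using jh by simp
      have "l2norm P (\<lambda>x. ?w (\<phi> (real j * h) x)) \<le> growth (real j * h) * l2norm P ?w"
        by (rule flow_compose_L2(2)[OF wL])
      also have "\<dots> \<le> M * (\<epsilon> / M)" using w M1 by (intro mult_mono Ms j) auto
      also have "\<dots> = \<epsilon>" using M1 by simp
      finally have "l2norm P (\<lambda>x. ?w (\<phi> (real j * h) x)) \<le> \<epsilon>" .
      then show "l2norm P (\<lambda>x. (- 1 / real N) * ?w (\<phi> (real j * h) x)) \<le> (1 / real N) * \<epsilon>"
        unfolding l2norm_scale by (simp add: divide_right_mono)
    qed
    also have "\<dots> = \<epsilon>" by (rule avg)
    finally show ?thesis .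
  qed
  have Md: "M * \<delta> \<le> \<epsilon>"
  proof -
    have "M * \<delta> = \<epsilon> * (t * (M / (1 + M)))" by (simp add: \<delta>_def)
    also have "\<dots> \<le> \<epsilon> * (1 * 1)" using eps t M1 by (intro mult_left_mono mult_mono) (auto simp: divide_le_eq)
    finally show ?thesis by simp
  qed
  have vf: "l2norm P (\<lambda>x. (v (\<phi> t x) - v x) / t - (f (\<phi> t x) - f x) / t) \<le> \<epsilon>"
  proof -
    have "(\<lambda>x. (v (\<phi> t x) - v x) / t - (f (\<phi> t x) - f x) / t) = (\<lambda>x. ((v (\<phi> t x) - f (\<phi> t x)) - (v x - f x)) / t)"
      by (auto simp: diff_divide_distrib)
    then have "l2norm P (\<lambda>x. (v (\<phi> t x) - v x) / t - (f (\<phi> t x) - f x) / t)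
      = l2norm P (\<lambda>x. (v (\<phi> t x) - f (\<phi> t x)) - (v x - f x)) / \<bar>t\<bar>" by (simp only: l2norm_divide)
    also have "l2norm P (\<lambda>x. (v (\<phi> t x) - f (\<phi> t x)) - (v x - f x)) \<le> (M + 1) * \<delta>"
    proof -
      have "l2norm P (\<lambda>x. (v (\<phi> t x) - f (\<phi> t x)) - (v x - f x)) \<le>
        l2norm P (\<lambda>x. (v (\<phi> t x) - f (\<phi> t x)) - 0) + l2norm P (\<lambda>x. 0 - (v x - f x))"
        by (rule l2norm_triangle_diff)
          (intro L2_diff flow_compose_L2(1)[OF vL] flow_compose_L2(1)[OF f] f vL, simp add: L2_def,
            intro L2_diff f vL)
      also have "l2norm P (\<lambda>x. 0 - (v x - f x)) = l2norm P (\<lambda>x. v x - f x)" by (simp add: l2norm_minus_commute[of P f v])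
      also have "l2norm P (\<lambda>x. (v (\<phi> t x) - f (\<phi> t x)) - 0) \<le> M * l2norm P (\<lambda>x. v x - f x)"
        using flow_compose_diff_le[OF vL f, of t] by (simp add: M_def)
      finally have "l2norm P (\<lambda>x. (v (\<phi> t x) - f (\<phi> t x)) - (v x - f x)) \<le> (M + 1) * l2norm P (\<lambda>x. v x - f x)"
        by (simp add: distrib_right)
      also have "\<dots> \<le> (M + 1) * \<delta>" using v(2) M1 by (intro mult_left_mono) auto
      finally show ?thesis .
    qed
    also have "(M + 1) * \<delta> / \<bar>t\<bar> = \<epsilon>" using t M1 by (simp add: \<delta>_def add.commute[of M])
    finally show ?thesis using t by (simp add: divide_right_mono)
  qed
  have "l2norm P (\<lambda>x. F x \<bullet> grad u x - g x) \<le>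
      l2norm P (\<lambda>x. F x \<bullet> grad u x - (v (\<phi> t x) - v x) / t) + l2norm P (\<lambda>x. (v (\<phi> t x) - v x) / t - g x)"
    by (intro l2norm_triangle_diff F_grad_L2 uC L2_divide L2_diff flow_compose_L2(1)[OF vL] vL g)
  also have "l2norm P (\<lambda>x. (v (\<phi> t x) - v x) / t - g x) \<le>
      l2norm P (\<lambda>x. (v (\<phi> t x) - v x) / t - (f (\<phi> t x) - f x) / t) + l2norm P (\<lambda>x. (f (\<phi> t x) - f x) / t - g x)"
    by (intro l2norm_triangle_diff L2_divide L2_diff flow_compose_L2(1)[OF vL] flow_compose_L2(1)[OF f] vL f g)
  finally have "l2norm P (\<lambda>x. F x \<bullet> grad u x - g x) < e"
    using uq vf qt eps by (simp add: \<epsilon>_def)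
  moreover have "l2norm P (\<lambda>x. u x - f x) < e" using uf Md eps by (simp add: \<epsilon>_def)
  ultimately show thesis using that uC by blast
qed

lemma generator_imp_closure:
  assumes gen: "generator_rel P (\<lambda>t f x. f (\<phi> t x)) f g"
  shows "closure_rel P F f g"
proof -
  have "\<exists>u. C1c u \<and> l2norm P (\<lambda>x. u x - f x) < 1 / real (Suc k) \<and>
      l2norm P (\<lambda>x. F x \<bullet> grad u x - g x) < 1 / real (Suc k)" for k
    by (rule generator_graph_approx[OF gen, of "1 / real (Suc k)"]) auto
  then have "\<exists>u. \<forall>k. C1c (u k) \<and> l2norm P (\<lambda>x. u k x - f x) < 1 / real (Suc k) \<and>
      l2norm P (\<lambda>x. F x \<bullet> grad (u k) x - g x) < 1 / real (Suc k)"
    by (intro choice allI)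
  then obtain u where u: "\<And>k. C1c (u k)" "\<And>k. l2norm P (\<lambda>x. u k x - f x) < 1 / real (Suc k)"
    "\<And>k. l2norm P (\<lambda>x. F x \<bullet> grad (u k) x - g x) < 1 / real (Suc k)"
    by blast
  have lim: "(\<lambda>k. 1 / real (Suc k)) \<longlonglongrightarrow> 0" by (rule LIMSEQ_Suc[OF lim_1_over_n])
  have "(\<lambda>k. l2norm P (\<lambda>x. u k x - f x)) \<longlonglongrightarrow> 0"
    by (rule Lim_null_comparison[OF always_eventually lim]) (use u(2) less_imp_le in auto)
  moreover have "(\<lambda>k. l2norm P (\<lambda>x. F x \<bullet> grad (u k) x - g x)) \<longlonglongrightarrow> 0"
    by (rule Lim_null_comparison[OF always_eventually lim]) (use u(3) less_imp_le in auto)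
  moreover have "f \<in> L2 P" "g \<in> L2 P" using gen by (auto simp: generator_rel_def)
  ultimately show ?thesis unfolding closure_rel_def using u(1) by blast
qed

end

section \<open>From the essential bound on \<open>d / \<rho>\<close> to the group on
  \<open>L2 P\<close>\<close>

theorem theorem6:
  fixes \<rho> :: "real^'n \<Rightarrow> real"
    and F :: "real^'n \<Rightarrow> real^'n"
    and \<phi> :: "real \<Rightarrow> real^'n \<Rightarrow> real^'n"
    and d :: "real^'n \<Rightarrow> real"
    and P :: "(real^'n) measure"
    and \<omega>0 :: real
  assumes rho_meas: "\<rho> \<in> borel_measurable lebesgue"
    and rho_int: "integrable lebesgue \<rho>"
    and rho_nonneg: "\<And>x. \<rho> x \<ge> 0"
    and rho_one: "(\<integral>x. \<rho> x \<partial>lebesgue) = 1"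
    and P_def: "P = density lebesgue (\<lambda>x. ennreal (\<rho> x))"
    and F_C1: "\<exists>F' :: real^'n \<Rightarrow> ((real^'n) \<Rightarrow>\<^sub>L (real^'n)).
                 continuous_on UNIV F' \<and> bounded (range F') \<and>
                 (\<forall>x. (F has_derivative blinfun_apply (F' x)) (at x))"
    and flow0: "\<And>x. \<phi> 0 x = x"
    and flow_add: "\<And>s t. \<phi> (t + s) = \<phi> t \<circ> \<phi> s"
    and flow_deriv: "\<And>t x. ((\<lambda>t. \<phi> t x) has_vector_derivative F (\<phi> t x)) (at t)"
    and W11: "W11 (\<lambda>x. \<rho> x *\<^sub>R F x)"
    and div: "weak_div (\<lambda>x. \<rho> x *\<^sub>R F x) d"
    and omega_fin: "esssup P (\<lambda>x. ereal \<bar>d x / \<rho> x\<bar>) < \<infinity>"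
    and omega_def: "\<omega>0 = real_of_ereal (esssup P (\<lambda>x. ereal \<bar>d x / \<rho> x\<bar>)) / 2"
  shows "\<exists>U. sc_group P U
           \<and> (\<forall>f g. generator_rel P U f g \<longleftrightarrow> closure_rel P F f g)
           \<and> (\<forall>t. \<forall>f\<in>L2 P. l2norm P (U t f) \<le> exp (\<omega>0 * \<bar>t\<bar>) * l2norm P f)
           \<and> (\<forall>t u. C1c u \<longrightarrow> (AE x in P. U t u x = u (\<phi> t x)))
           \<and> ((AE x in lebesgue. d x = 0) \<longrightarrow>
                (\<forall>t. \<forall>f\<in>L2 P. l2norm P (U t f) = l2norm P f)
              \<and> (\<forall>t. \<forall>A\<in>sets lebesgue. \<phi> t -` A \<in> sets lebesgue \<and>
                       emeasure P (\<phi> t -` A) = emeasure P A)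
              \<and> (\<forall>t. \<forall>f\<in>L2 P. AE x in P. U t f x = f (\<phi> t x)))"
proof -
  obtain F' :: "real^'n \<Rightarrow> ((real^'n) \<Rightarrow>\<^sub>L (real^'n))" and L where
    F': "continuous_on UNIV F'" "\<And>x. norm (F' x) \<le> L" "\<And>x. (F has_derivative blinfun_apply (F' x)) (at x)"
    using F_C1 unfolding bounded_iff by auto
  interpret c1_flow_vec F F' L \<phi>
    by unfold_locales (use F' flow0 flow_add flow_deriv in auto)
  have di: "integrable lebesgue d" using div by (simp add: weak_div_def)
  have dm: "d \<in> borel_measurable lebesgue" using di by auto
  have lwd: "loc_weak_div \<rho> d"
    using div integrable_imp_locally_integrable[OF rho_int] integrable_imp_locally_integrable[OF di]
    by (simp add: loc_weak_div_def weak_div_def)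
  have setsP: "sets P = sets lebesgue" by (simp add: P_def)
  have rm: "(\<lambda>x. ennreal (\<rho> x)) \<in> borel_measurable lebesgue" using rho_meas by measurable
  have fin: "emeasure P (space P) = 1"
    using nn_integral_eq_integral[OF rho_int] rho_nonneg rho_one by (simp add: P_def emeasure_density[OF rm])
  then have P: "finite_measure P" by (intro finite_measureI) simp
  have ac: "AE x in P. Q x" if "AE x in lebesgue. Q x" for Q
    using that unfolding P_def AE_density[OF rm] by eventually_elim simp
  have koop: "koopman F F' L \<phi> P c" if c: "c \<ge> 0" "AE x in lebesgue. \<bar>d x\<bar> \<le> c * \<rho> x" for c
  proof (intro koopman.intro koopman_axioms.intro P c ac setsP)
    show "c1_flow_vec F F' L \<phi>" by unfold_locales
    fix f :: "real^'n \<Rightarrow> real" and t assume f: "f \<in> borel_measurable lebesgue" "\<And>x. 0 \<le> f x"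
    have dens: "(\<integral>\<^sup>+x. ennreal (g x) \<partial>P) = (\<integral>\<^sup>+x. ennreal (\<rho> x * g x) \<partial>lebesgue)"
      if "g \<in> borel_measurable lebesgue" "\<And>x. 0 \<le> g x" for g
      unfolding P_def using that rho_nonneg by (subst nn_integral_density[OF rm]) (auto simp: ennreal_mult)
    show "(\<integral>\<^sup>+x. ennreal (f (\<phi> t x)) \<partial>P) \<le> ennreal (exp (c * \<bar>t\<bar>)) * (\<integral>\<^sup>+x. ennreal (f x) \<partial>P)"
      using transport_bound[OF lwd c(2) rho_nonneg f, of t] f by (simp add: dens flow_measurable_compose)
  qed
  let ?E = "esssup P (\<lambda>x. ereal \<bar>d x / \<rho> x\<bar>)"
  have Eae: "AE x in P. ereal \<bar>d x / \<rho> x\<bar> \<le> ?E" by (rule esssup_AE)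
  \<comment> \<open>Total mass 1 excludes a negative essential supremum, in particular
    \<open>-\<infinity>\<close>. Together with finiteness this makes \<open>real_of_ereal\<close>
    return the true value and yields an admissible constant for \<open>koopman\<close>.\<close>
  have E0: "?E \<ge> 0"
  proof (rule ccontr)
    assume "\<not> 0 \<le> ?E"
    then have "\<not> ereal \<bar>d x / \<rho> x\<bar> \<le> ?E" for x
      using order_trans[of 0 "ereal \<bar>d x / \<rho> x\<bar>" ?E] by auto
    then have "AE x in P. False" using Eae by simp
    then show False using prob_space.AE_False[OF prob_spaceI[OF fin]] by simp
  qed
  then obtain E where E: "?E = ereal E" "E \<ge> 0" using omega_fin by (cases ?E) auto
  have omega: "\<omega>0 = E / 2" unfolding omega_def E by simp
  have "AE x in P. \<bar>d x / \<rho> x\<bar> \<le> E" using Eae unfolding E by simp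
  then have "AE x in lebesgue. \<rho> x > 0 \<longrightarrow> \<bar>d x / \<rho> x\<bar> \<le> E"
    unfolding P_def AE_density[OF rm] by simp
  \<comment> \<open>The essential bound lives on \<open>P\<close> and is blind to the zero set,
    whereas the transport estimate asks for a bound almost everywhere in Lebesgue measure; here
    \<open>d\<close> is 0 on that set.\<close>
  moreover have "AE x in lebesgue. \<rho> x = 0 \<longrightarrow> d x = 0"
    by (rule weak_div_vanishes_on_zero_set[OF lwd rho_int di rho_nonneg])
  ultimately have dE: "AE x in lebesgue. \<bar>d x\<bar> \<le> E * \<rho> x"
  proof eventually_elim
    case (elim x)
    then show ?case using rho_nonneg[of x] by (cases "\<rho> x = 0") (auto simp: divide_le_eq)
  qed
  interpret K: koopman F F' L \<phi> P E by (rule koop[OF E(2) dE])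
  \<comment> \<open>With constant 0 the growth factor is 1, so composition is a contraction and the
    measure of preimages does not increase, at every time. Applying this at \<open>- t\<close> to
    the moved function or set gives the reverse inequalities.\<close>
  have iso: "l2norm P (\<lambda>x. f (\<phi> t x)) = l2norm P f \<and>
      (\<forall>A\<in>sets lebesgue. emeasure P (\<phi> t -` A) = emeasure P A)"
    if d0: "AE x in lebesgue. d x = 0" and f: "f \<in> L2 P" for t f
  proof -
    have "AE x in lebesgue. \<bar>d x\<bar> \<le> 0 * \<rho> x" using d0 by eventually_elim simp
    then interpret Z: koopman F F' L \<phi> P 0 by (rule koop[OF order_refl])
    have le: "l2norm P (\<lambda>x. f (\<phi> t x)) \<le> l2norm P f" if "f \<in> L2 P" for t f
      using Z.flow_compose_L2(2)[OF that] by (simp add: Z.growth_def)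
    have "l2norm P f \<le> l2norm P (\<lambda>x. f (\<phi> t x))"
      using le[OF Z.flow_compose_L2(1)[OF f, of t], of "-t"] by simp
    moreover have mle: "emeasure P (\<phi> t -` A) \<le> emeasure P A" if A: "A \<in> sets lebesgue" for A t
    proof -
      have eq: "(\<integral>\<^sup>+x. ennreal (indicator B x) \<partial>P) = emeasure P B" if "B \<in> sets lebesgue" for B
        using that setsP by (simp add: ennreal_indicator)
      have "(\<integral>\<^sup>+x. ennreal (indicator A (\<phi> t x)) \<partial>P) \<le> (\<integral>\<^sup>+x. ennreal (indicator A x) \<partial>P)"
        using Z.flow_bound[of "indicator A" t] A by simp
      moreover have "indicator A (\<phi> t x) = (indicator (\<phi> t -` A) x :: real)" for x by (simp add: indicator_def)
      ultimately show ?thesis using eq[OF A] eq[OF flow_vimage_sets[OF A, of t]] by simp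
    qed
    have "emeasure P (\<phi> t -` A) = emeasure P A" if A: "A \<in> sets lebesgue" for A
    proof (rule antisym[OF mle[OF A]])
      have "\<phi> (-t) -` (\<phi> t -` A) = A" by (auto simp: vimage_def)
      then show "emeasure P A \<le> emeasure P (\<phi> t -` A)" using mle[OF flow_vimage_sets[OF A, of t], of "-t"] by simp
    qed
    ultimately show ?thesis using le[OF f, of t] by (auto intro: antisym)
  qed
  show ?thesis
  proof (intro exI[of _ "\<lambda>t f x. f (\<phi> t x)"] conjI allI impI ballI)
    show "sc_group P (\<lambda>t f x. f (\<phi> t x))" by (rule K.sc_group_flow)
    show "generator_rel P (\<lambda>t f x. f (\<phi> t x)) f g \<longleftrightarrow> closure_rel P F f g" for f g
      using K.closure_imp_generator K.generator_imp_closure by blast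
    show "l2norm P (\<lambda>x. f (\<phi> t x)) \<le> exp (\<omega>0 * \<bar>t\<bar>) * l2norm P f" if "f \<in> L2 P" for t f
      using K.flow_compose_L2(2)[OF that, of t] by (simp add: K.growth_def omega)
    \<comment> \<open>\<open>iso\<close> attaches the invariance of \<open>P\<close> to an element
      of \<open>L2 P\<close>; the zero function serves as one.\<close>
    show "emeasure P (\<phi> t -` A) = emeasure P A" if "AE x in lebesgue. d x = 0" "A \<in> sets lebesgue" for t A
      using iso[OF that(1), of "\<lambda>x. 0" t] that(2) by (simp add: L2_def)
  qed (use iso flow_vimage_sets in auto)
qed

end
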